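(* Let $n\ge 2$ be an integer, let $\mathbf F_n$ be the Fermat curve of degree $n$, and let $\mathcal M_n$ be the regular map of type $\{3,2n\}$ on $\mathbf F_n$. Then: (i) if $n$ is odd, the patterns of the mirrors of reflections of $\mathcal M_n$ on $\mathbf F_n$ are of one of the forms $(\mathbf{01})^3$ and $(\mathbf{0212})^n$; (ii) if $n$ is even, they are of one of the forms $(\mathbf{01})^4$ and $(\mathbf{0212})^2$.
   Context: $\mathbf F_n$ is the Riemann surface of the projective curve $x^n+y^n+z^n=0$ in $\mathbf P^2(\mathbb C)$; it has genus $(n-1)(n-2)/2$. If $K_n$ is the commutator subgroup of the triangle group $\Gamma[n,n,n]$, then $\mathbf F_n$ is the quotient of the universal cover by $K_n$, and $K_n$ is normal in the triangle group $\Gamma[2,3,2n]$ with quotient $(\mathbb Z_n\oplus\mathbb Z_n)\rtimes S_3$ of order $6n^2$; this gives the regular map $\mathcal M_n$ of type $\{3,2n\}$ (triangular faces, vertices of valency $2n$). Concretely, with $\lambda=e^{2\pi i/n}$, its orientation-preserving automorphism group is generated by the projective transformations $A=\begin{pmatrix}0&\lambda&0\\ \lambda^{-1}&0&0\\0&0&1\end{pmatrix}$, $B=\begin{pmatrix}0&\lambda&0\\0&0&1\\1&0&0\end{pmatrix}$, $C=\begin{pmatrix}0&0&1\\0&1&0\\ \lambda^{-1}&0&0\end{pmatrix}$ in $\mathrm{PGL}(3,\mathbb C)$, with $A^2=B^3=C^{2n}=ABC=1$. The geometric points of a map are its vertices ($\mathbf 0$), edge-centres ($\mathbf 1$) and face-centres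 ($\mathbf 2$). The pattern of a mirror (fixed curve of a reflection of the map) is the cyclic sequence of geometric points met along it, written $(\ell)^K$ meaning the minimal repeating word $\ell$ repeated $K$ times. *)

theory Defs
  imports "HOL-Analysis.Analysis" "HOL-Algebra.Bij" "HOL-Algebra.Generated_Groups"
begin

definition proportional :: "complex ^ 3 \<Rightarrow> complex ^ 3 \<Rightarrow> bool" where
  "proportional u v \<longleftrightarrow> u \<noteq> 0 \<and> v \<noteq> 0 \<and> (\<exists>c. c \<noteq> 0 \<and> u = c *s v)"

lemma part_equivp_proportional: "part_equivp proportional"
proof (rule part_equivpI)
  have "(vec 1 :: complex ^ 3) \<noteq> 0"
    by (simp add: vec_eq_iff)
  then have "proportional (vec 1) (vec 1)"
    unfolding proportional_def by (intro conjI exI[of _ 1]) simp_all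
  then show "\<exists>x. proportional x x" ..
  show "symp proportional"
  proof (rule sympI)
    fix u v assume "proportional u v"
    then obtain c where c: "u \<noteq> 0" "v \<noteq> 0" "c \<noteq> 0" "u = c *s v"
      unfolding proportional_def by blast
    then have "v = inverse c *s u"
      by (simp add: vector_smult_assoc)
    with c(1-3) show "proportional v u"
      unfolding proportional_def by (intro conjI exI[of _ "inverse c"]) simp_all
  qed
  show "transp proportional"
  proof (rule transpI)
    fix u v w assume "proportional u v" "proportional v w"
    then obtain c d where "u \<noteq> 0" "w \<noteq> 0" "c \<noteq> 0" "d \<noteq> 0" "u = c *s v" "v = d *s w"
      unfolding proportional_def by blast
    then show "proportional u w"
      unfolding proportional_def
      by (intro conjI exI[of _ "c * d"]) (simp_all add: vector_smult_assoc)
  qed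
qed

text \<open>\<open>proj v\<close> is the point with homogeneous coordinates \<open>v\<close> (meaningful for \<open>v \<noteq> 0\<close>);
  \<open>hcoords p\<close> is a choice of homogeneous coordinates of \<open>p\<close>.\<close>

quotient_type cp2 = "complex ^ 3" / partial: proportional
  morphisms hcoords proj
  by (rule part_equivp_proportional)

instantiation cp2 :: topological_space
begin

definition open_cp2 :: "cp2 set \<Rightarrow> bool" where
  "open_cp2 U \<longleftrightarrow> open {v. v \<noteq> 0 \<and> proj v \<in> U}"

instance
proof
  have "{v :: complex ^ 3. v \<noteq> 0 \<and> proj v \<in> UNIV} = - {0}"
    by auto
  then show "open (UNIV :: cp2 set)"
    unfolding open_cp2_def by (simp only: open_Compl closed_singleton)
next
  fix S T :: "cp2 set"
  assume "open S" "open T"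
  moreover have "{v. v \<noteq> 0 \<and> proj v \<in> S \<inter> T} =
      {v. v \<noteq> 0 \<and> proj v \<in> S} \<inter> {v. v \<noteq> 0 \<and> proj v \<in> T}"
    by auto
  ultimately show "open (S \<inter> T)"
    unfolding open_cp2_def by (simp only: open_Int)
next
  fix K :: "cp2 set set"
  assume "\<forall>S\<in>K. open S"
  moreover have "{v. v \<noteq> 0 \<and> proj v \<in> \<Union>K} = (\<Union>S\<in>K. {v. v \<noteq> 0 \<and> proj v \<in> S})"
    by auto
  ultimately show "open (\<Union>K)"
    unfolding open_cp2_def by (simp only: open_UN)
qed

end

definition proj_map :: "complex ^ 3 ^ 3 \<Rightarrow> cp2 \<Rightarrow> cp2" where
  "proj_map M p = proj (M *v hcoords p)"

definition proj_cnj :: "cp2 \<Rightarrow> cp2" where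
  "proj_cnj p = proj (\<chi> i. cnj (hcoords p $ i))"

definition antiprojective :: "(cp2 \<Rightarrow> cp2) \<Rightarrow> bool" where
  "antiprojective f \<longleftrightarrow> (\<exists>M. invertible M \<and> f = proj_map M \<circ> proj_cnj)"

definition fermat_curve :: "nat \<Rightarrow> cp2 set" where
  "fermat_curve n = {p. (\<Sum>i\<in>UNIV. (hcoords p $ i) ^ n) = 0}"

definition lam :: "nat \<Rightarrow> complex" where
  "lam n = cis (2 * pi / real n)"

definition mat_A :: "nat \<Rightarrow> complex ^ 3 ^ 3" where
  "mat_A n = vector [vector [0, lam n, 0], vector [inverse (lam n), 0, 0], vector [0, 0, 1]]"

definition mat_B :: "nat \<Rightarrow> complex ^ 3 ^ 3" where
  "mat_B n = vector [vector [0, lam n, 0], vector [0, 0, 1], vector [1, 0, 0]]"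

definition mat_C :: "nat \<Rightarrow> complex ^ 3 ^ 3" where
  "mat_C n = vector [vector [0, 0, 1], vector [0, 1, 0], vector [inverse (lam n), 0, 0]]"

definition rot_group :: "nat \<Rightarrow> (cp2 \<Rightarrow> cp2) set" where
  "rot_group n = generate (BijGroup UNIV)
     {proj_map (mat_A n), proj_map (mat_B n), proj_map (mat_C n)}"

definition rot_stabilizer :: "nat \<Rightarrow> cp2 \<Rightarrow> (cp2 \<Rightarrow> cp2) set" where
  "rot_stabilizer n p = {g \<in> rot_group n. g p = p}"

text \<open>The torsion-free group \<open>K\<^sub>n\<close> acts freely on the universal cover,
  so the stabilizer of a point of the curve in \<open>\<Gamma>[2,3,2n]/K\<^sub>n\<close> is the image of the stabilizer of a
  point above it. Hence the vertices, edge-centres and face-centres, which are the images of the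
  fixed points of the elliptic elements of order \<open>2n\<close>, \<open>2\<close> and \<open>3\<close>, are the points whose stabilizer
  is a conjugate of \<open>\<langle>C\<rangle>\<close>, \<open>\<langle>A\<rangle>\<close> and \<open>\<langle>B\<rangle>\<close> respectively. Being merely fixed by a conjugate of
  \<open>A\<close> is not enough: for odd \<open>n\<close> the vertices have that property, too.\<close>

definition points_with_rotation :: "nat \<Rightarrow> complex ^ 3 ^ 3 \<Rightarrow> cp2 set" where
  "points_with_rotation n M = {p \<in> fermat_curve n. \<exists>h\<in>rot_group n.
     rot_stabilizer n p = (\<lambda>g. h \<circ> g \<circ> inv_into UNIV h) ` generate (BijGroup UNIV) {proj_map M}}"

definition vertices :: "nat \<Rightarrow> cp2 set" where
  "vertices n = points_with_rotation n (mat_C n)"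

definition edge_centres :: "nat \<Rightarrow> cp2 set" where
  "edge_centres n = points_with_rotation n (mat_A n)"

definition face_centres :: "nat \<Rightarrow> cp2 set" where
  "face_centres n = points_with_rotation n (mat_B n)"

text \<open>The faces of the map are the triangles of the tessellation belonging to \<open>\<Gamma>[n,n,n]\<close>. The
  quotient of the curve by \<open>\<Gamma>[n,n,n]/K\<^sub>n\<close> is the map \<open>[x:y:z] \<mapsto> [x^n:y^n:z^n]\<close> onto the line
  \<open>X + Y + Z = 0\<close>, which is branched over the three points with \<open>XYZ = 0\<close>; the two triangles forming
  a fundamental domain are the two half-planes bounded by the real points of that line. So the
  embedded graph consists of the points lying over real points, its vertices being those over
  the branch points. Edges and faces are taken to be open cells.\<close>

definition map_graph :: "nat \<Rightarrow> cp2 set" where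
  "map_graph n = {p \<in> fermat_curve n. \<exists>c. c \<noteq> 0 \<and> (\<forall>i. c * (hcoords p $ i) ^ n \<in> \<real>)}"

definition edges :: "nat \<Rightarrow> cp2 set set" where
  "edges n = components (map_graph n - vertices n)"

definition faces :: "nat \<Rightarrow> cp2 set set" where
  "faces n = components (fermat_curve n - map_graph n)"

definition preserves_map :: "nat \<Rightarrow> (cp2 \<Rightarrow> cp2) \<Rightarrow> bool" where
  "preserves_map n f \<longleftrightarrow> bij_betw f (fermat_curve n) (fermat_curve n) \<and>
     f ` vertices n = vertices n \<and> (`) f ` edges n = edges n \<and> (`) f ` faces n = faces n"

text \<open>The orientation-preserving automorphisms of the map are projective transformations, and complex
  conjugation is an orientation-reversing automorphism; so the orientation-reversing automorphisms
  are the antiprojective transformations preserving the map.\<close>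

definition map_reflection :: "nat \<Rightarrow> (cp2 \<Rightarrow> cp2) \<Rightarrow> bool" where
  "map_reflection n f \<longleftrightarrow> antiprojective f \<and> preserves_map n f \<and>
     (\<forall>p\<in>fermat_curve n. f (f p) = p) \<and> (\<exists>p\<in>fermat_curve n. f p = p)"

text \<open>The fixed-point set of a reflection may consist of several disjoint closed curves; each of them
  is a mirror.\<close>

definition mirrors :: "nat \<Rightarrow> cp2 set set" where
  "mirrors n = (\<Union>f\<in>{f. map_reflection n f}. components {p \<in> fermat_curve n. f p = p})"

definition geometric_points :: "nat \<Rightarrow> cp2 set" where
  "geometric_points n = vertices n \<union> edge_centres n \<union> face_centres n"

definition geometric_type :: "nat \<Rightarrow> cp2 \<Rightarrow> nat" where
  "geometric_type n p = (if p \<in> vertices n then 0 else if p \<in> edge_centres n then 1 else 2)"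

definition meeting_times :: "nat \<Rightarrow> (real \<Rightarrow> cp2) \<Rightarrow> real set" where
  "meeting_times n \<gamma> = {t \<in> {0..<1}. \<gamma> t \<in> geometric_points n}"

definition primitive_word :: "'a list \<Rightarrow> bool" where
  "primitive_word l \<longleftrightarrow> \<not> (\<exists>u k. k \<ge> 2 \<and> l = concat (replicate k u))"

text \<open>\<open>has_pattern n S l K\<close>: the closed curve \<open>S\<close> has pattern \<open>(l)^K\<close>. A pattern is a cyclic sequence,
  so it is given by the word read off along one traversal of the curve, with some starting
  point and some direction.\<close>

definition has_pattern :: "nat \<Rightarrow> cp2 set \<Rightarrow> nat list \<Rightarrow> nat \<Rightarrow> bool" where
  "has_pattern n S l K \<longleftrightarrow> primitive_word l \<and>
     (\<exists>\<gamma>. simple_path \<gamma> \<and> pathfinish \<gamma> = pathstart \<gamma> \<and> path_image \<gamma> = S \<and>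
          finite (meeting_times n \<gamma>) \<and>
          map (geometric_type n \<circ> \<gamma>) (sorted_list_of_set (meeting_times n \<gamma>)) =
            concat (replicate K l))"

end

theory Submission
  imports Defs
begin

text \<open>
  The rotation group consists of all monomial transformations with \<open>n\<close>-th roots of unity as entries.
  Hence a point \<open>[x:y:z]\<close> of the curve is a vertex, edge-centre or face-centre according to the
  triple \<open>(|x|^n, |y|^n, |z|^n)\<close> alone: a coordinate vanishes, the triple is proportional to a
  permutation of \<open>(1, 1, 2)\<close>, or the three moduli agree.

  Two distinct vertices lie in the closure of a common edge iff they lie on different coordinate lines,
  so an antiprojective map that preserves vertices and edges permutes the coordinate lines. It is
  therefore monomial after conjugation, and being an involution it is, up to the order of the
  coordinates, either \<open>v\<^sub>i \<mapsto> d\<^sub>i cnj v\<^sub>i\<close> or \<open>[x:y:z] \<mapsto> [a cnj y : a cnj x : cnj z]\<close>.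

  In the first case the fixed points are, up to unit factors, the real solutions of
  \<open>X + Y + Z = 0\<close> with \<open>X = x^n\<close> etc. (\<open>n\<close> odd), or of \<open>x^n + y^n = z^n\<close> (\<open>n\<close> even). In the second case
  they are the points \<open>[x : a cnj x : r]\<close> with \<open>|x| = 1\<close>, \<open>r\<close> real and \<open>2 Re (x^n) + r^n = 0\<close>, which form one
  closed curve for odd \<open>n\<close> and \<open>n/2\<close> ovals for even \<open>n\<close>. Each curve is parametrised explicitly and
  its geometric points are read off.
\<close>

subsection \<open>Points of the projective plane\<close>

text \<open>Behind the classification by moduli stands the triple (X, Y, Z) = (x^n, y^n, z^n).
  Points whose triples agree up to a scalar and a permutation lie in one orbit of the rotation
  group. On the curve X + Y + Z = 0, so X, Y, Z are the sides of a closed triangle: side lengths 1,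
  1, 2 make it degenerate and 1, 1, 1 make it equilateral, and in both cases the phases are forced
  up to a common factor and the order of the sides. The obstacle for reflections is that preserving
  the map is a set-theoretic condition on vertices and on components. It becomes linear algebra
  because the preimages of two vertices of one coordinate line again share a coordinate line, and
  two such points already determine which entries of a matrix row vanish. Parity enters through real
  n-th roots. For odd n the value r^n determines the real number r, and changing the sign of all
  coordinates changes the sign of X, Y, Z, so half a turn of the parameter closes the curve. For
  even n the value r^n is nonnegative and hides the sign of r: the angle of x is confined to arcs,
  each arc carries its own oval, and the ovals have to be shown to be different components.\<close>

lemma proj_hcoords [simp]: "proj (hcoords p) = p"
  by (rule Quotient3_abs_rep[OF Quotient3_cp2])

lemma hcoords_nonzero [simp]: "hcoords p \<noteq> 0"
  using Quotient3_rep_reflp[OF Quotient3_cp2, of p] by (simp add: proportional_def)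

lemma proportional_refl: "v \<noteq> 0 \<Longrightarrow> proportional v v"
  unfolding proportional_def by (intro conjI exI[of _ 1]) simp_all

lemma proj_eq_iff:
  assumes "u \<noteq> 0" "v \<noteq> 0"
  shows "proj u = proj v \<longleftrightarrow> (\<exists>c. c \<noteq> 0 \<and> (\<forall>i. u $ i = c * v $ i))"
  using Quotient3_rel[OF Quotient3_cp2, of u v] proportional_refl assms
  by (auto simp: proportional_def vec_eq_iff)

lemma cp2_cases:
  obtains v where "v \<noteq> 0" "p = proj v"
  by (metis hcoords_nonzero proj_hcoords)

lemma hcoords_proj:
  assumes "v \<noteq> 0"
  obtains c where "c \<noteq> 0" "\<And>i. hcoords (proj v) $ i = c * v $ i"
  using proj_eq_iff[of "hcoords (proj v)" v] assms by auto

lemma proj_mem_fermat_iff: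
  assumes "v \<noteq> 0"
  shows "proj v \<in> fermat_curve n \<longleftrightarrow> (\<Sum>i\<in>UNIV. (v $ i) ^ n) = 0"
proof -
  obtain c where c: "c \<noteq> 0" "\<And>i. hcoords (proj v) $ i = c * v $ i"
    using hcoords_proj[OF assms] by blast
  show ?thesis
    using c by (simp add: fermat_curve_def power_mult_distrib flip: sum_distrib_left)
qed

lemma continuous_on_proj:
  assumes "continuous_on S f" "\<And>x. x \<in> S \<Longrightarrow> f x \<noteq> 0"
  shows "continuous_on S (\<lambda>x. proj (f x))"
proof -
  have "continuous_on (- {0}) proj"
    unfolding continuous_on_open_vimage[OF open_Compl[OF closed_singleton]]
    by (auto simp: open_cp2_def vimage_def Int_def conj_commute)
  then show ?thesis
    by (rule continuous_on_compose2[OF _ assms(1)]) (use assms(2) in auto)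
qed

text \<open>Open subsets of \<open>cp2\<close> are by definition those whose cones of coordinate
  vectors are open, so continuity can be tested after composing with \<open>proj\<close>. This is
  the universal property of the quotient topology.\<close>

lemma continuous_on_cp2I:
  fixes h :: "cp2 \<Rightarrow> 'a::topological_space"
  assumes "open U" "continuous_on {v. v \<noteq> 0 \<and> proj v \<in> U} (\<lambda>v. h (proj v))"
  shows "continuous_on U h"
proof -
  have op: "open {v. v \<noteq> 0 \<and> proj v \<in> U}" using assms(1) by (simp add: open_cp2_def)
  show ?thesis
    unfolding continuous_on_open_vimage[OF assms(1)]
  proof (intro allI impI)
    fix B :: "'a set" assume "open B"
    then have "open ((\<lambda>v. h (proj v)) -` B \<inter> {v. v \<noteq> 0 \<and> proj v \<in> U})"
      using assms(2) unfolding continuous_on_open_vimage[OF op] by blast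
    then show "open (h -` B \<inter> U)"
      by (simp add: open_cp2_def vimage_def Int_def conj_ac)
  qed
qed

lemma proj_map_proj:
  assumes "invertible M" "v \<noteq> 0"
  shows "proj_map M (proj v) = proj (M *v v)" 
proof -
  obtain c where c: "c \<noteq> 0" "\<And>i. hcoords (proj v) $ i = c * v $ i"
    using hcoords_proj[OF assms(2)] by blast
  then have e: "hcoords (proj v) = c *s v" by (simp add: vec_eq_iff)
  have nz: "M *v v \<noteq> 0"
    using assms by (metis invertible_def matrix_left_invertible_ker)
  have "M *v hcoords (proj v) = c *s (M *v v)"
    by (simp add: e matrix_vector_mult_scaleR vector_scalar_commute)
  moreover from this nz c have "c *s (M *v v) \<noteq> 0" by simp
  ultimately show ?thesis unfolding proj_map_def
    using c nz by (subst proj_eq_iff) (auto)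
qed

lemma proj_cnj_proj:
  assumes "v \<noteq> 0"
  shows "proj_cnj (proj v) = proj (\<chi> i. cnj (v $ i))"
proof -
  obtain c where c: "c \<noteq> 0" "\<And>i. hcoords (proj v) $ i = c * v $ i"
    using hcoords_proj[OF assms] by blast
  then show ?thesis unfolding proj_cnj_def
    using assms by (subst proj_eq_iff) (auto simp: vec_eq_iff intro!: exI[of _ "cnj c"])
qed

section \<open>Three arbitrary distinct indices as a coordinate system\<close>

lemma distinct3_UNIV:
  fixes i j k :: 3
  assumes "distinct [i, j, k]"
  shows "UNIV = {i, j, k}"
proof -
  have "card {i,j,k} = CARD(3)" using assms by simp
  then show ?thesis by (metis card_eq_UNIV_imp_eq_UNIV finite_class.finite_UNIV)
qed

lemma sum_distinct3:
  fixes i j k :: 3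
  assumes "distinct [i, j, k]"
  shows "(\<Sum>m\<in>UNIV. f m) = f i + f j + (f k :: 'a::comm_monoid_add)"
  using assms by (subst distinct3_UNIV[OF assms]) (simp add: add.assoc)

lemma all_distinct3:
  fixes i j k :: 3
  assumes "distinct [i, j, k]"
  shows "(\<forall>m. P m) \<longleftrightarrow> P i \<and> P j \<and> P k"
proof -
  have "m = i \<or> m = j \<or> m = k" for m
  proof -
    have "m \<in> {i, j, k}" by (subst distinct3_UNIV[OF assms, symmetric]) (rule UNIV_I)
    then show ?thesis by simp
  qed
  then show ?thesis by metis
qed

lemma third_index:
  fixes i j :: 3
  assumes "i \<noteq> j"
  obtains k where "distinct [i, j, k]"
proof -
  have "card {i,j} < CARD(3)" using assms by simp
  then have "{i,j} \<noteq> UNIV" by (metis less_irrefl)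
  then obtain k where "k \<notin> {i,j}" by blast
  then show ?thesis using that[of k] assms by auto
qed

lemma other_indices:
  obtains j k where "distinct [i::3, j, k]"
proof -
  have "card {i} < CARD(3)" by simp
  then have "{i} \<noteq> UNIV" by (metis less_irrefl)
  then have "\<exists>j. j \<notin> {i}" by blast
  then obtain j where "i \<noteq> j" by (metis insert_iff)
  then show ?thesis using third_index[of i j] that by blast
qed

subsection \<open>Monomial transformations and the rotation group\<close>

lemma mem_Bij_UNIV [simp]: "f \<in> Bij UNIV \<longleftrightarrow> bij f"
  by (simp add: Bij_def)

lemma BijGroup_UNIV_simps [simp]:
  "carrier (BijGroup UNIV) = {f. bij f}"
  "\<one>\<^bsub>BijGroup UNIV\<^esub> = id"
  by (auto simp: BijGroup_def fun_eq_iff)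

lemma BijGroup_UNIV_mult [simp]:
  "bij f \<Longrightarrow> bij g \<Longrightarrow> f \<otimes>\<^bsub>BijGroup UNIV\<^esub> g = f \<circ> g"
  by (auto simp: BijGroup_def fun_eq_iff compose_def)

lemma BijGroup_UNIV_inv:
  assumes "bij f"
  shows "inv\<^bsub>BijGroup UNIV\<^esub> f = inv_into UNIV f"
proof -
  interpret group "BijGroup (UNIV :: 'a set)" by (rule group_BijGroup)
  show ?thesis
    using assms by (intro inv_equality) (auto simp: bij_imp_bij_inv bij_is_inj)
qed

lemma generate_BijGroup:
  assumes "\<And>f. f \<in> H \<Longrightarrow> bij f"
  shows generate_bij: "f \<in> generate (BijGroup UNIV) H \<Longrightarrow> bij f"
    and generate_id: "id \<in> generate (BijGroup UNIV) H"
    and generate_comp: "\<lbrakk>f \<in> generate (BijGroup UNIV) H; g \<in> generate (BijGroup UNIV) H\<rbrakk>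
           \<Longrightarrow> f \<circ> g \<in> generate (BijGroup UNIV) H"
    and generate_inv: "f \<in> generate (BijGroup UNIV) H \<Longrightarrow> inv_into UNIV f \<in> generate (BijGroup UNIV) H"
    and generate_least: "\<lbrakk>f \<in> generate (BijGroup UNIV) H; H \<subseteq> K; id \<in> K; \<And>f. f \<in> K \<Longrightarrow> inv_into UNIV f \<in> K; 
           \<And>f g. f \<in> K \<Longrightarrow> g \<in> K \<Longrightarrow> f \<circ> g \<in> K\<rbrakk> \<Longrightarrow> f \<in> K"
proof -
  interpret G: group "BijGroup (UNIV :: 'a set)" by (rule group_BijGroup)
  have H: "H \<subseteq> carrier (BijGroup UNIV)" using assms by auto
  show bij: "bij f" if "f \<in> generate (BijGroup UNIV) H" for f
    using G.generate_in_carrier[OF H that] by simp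
  show "id \<in> generate (BijGroup UNIV) H"
    using generate.one[of "BijGroup UNIV" H] by simp
  show "f \<circ> g \<in> generate (BijGroup UNIV) H"
    if "f \<in> generate (BijGroup UNIV) H" "g \<in> generate (BijGroup UNIV) H"
    using generate.eng[OF that] bij[OF that(1)] bij[OF that(2)] by simp
  show "inv_into UNIV f \<in> generate (BijGroup UNIV) H" if "f \<in> generate (BijGroup UNIV) H"
    using G.generate_m_inv_closed[OF H that] bij[OF that] by (simp add: BijGroup_UNIV_inv)
  show "f \<in> K" if "f \<in> generate (BijGroup UNIV) H" and K: "H \<subseteq> K" "id \<in> K" "\<And>f. f \<in> K \<Longrightarrow> inv_into UNIV f \<in> K"
           "\<And>f g. f \<in> K \<Longrightarrow> g \<in> K \<Longrightarrow> f \<circ> g \<in> K"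
    using that(1)
  proof (induction rule: generate.induct)
    case (eng h1 h2)
    then show ?case using K(4) bij by (metis BijGroup_UNIV_mult)
  qed (use K(1,3) K(2)[unfolded id_def] assms in \<open>auto simp: BijGroup_UNIV_inv\<close>)
qed

text \<open>The permutation pulls coordinates back, so composing two such maps composes their
  permutations in the opposite order.\<close>

definition monomial_map :: "(3 \<Rightarrow> 3) \<Rightarrow> (3 \<Rightarrow> complex) \<Rightarrow> cp2 \<Rightarrow> cp2" where
  "monomial_map s d p = proj (\<chi> i. d i * hcoords p $ s i)"

lemma monomial_vec_nonzero:
  fixes v :: "complex ^ 3"
  assumes "bij s" "\<And>i. d i \<noteq> 0" "v \<noteq> 0"
  shows "(\<chi> i. d i * v $ s i) \<noteq> 0"
proof -
  obtain j where "v $ j \<noteq> 0" using assms(3) by (auto simp: vec_eq_iff)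
  moreover obtain i where "s i = j" using assms(1) by (metis bij_pointE)
  ultimately show ?thesis using assms(2) by (auto simp: vec_eq_iff)
qed

lemma monomial_map_proj:
  assumes "bij s" "\<And>i. d i \<noteq> 0" "v \<noteq> 0"
  shows "monomial_map s d (proj v) = proj (\<chi> i. d i * v $ s i)"
proof -
  obtain c where c: "c \<noteq> 0" "\<And>i. hcoords (proj v) $ i = c * v $ i"
    using hcoords_proj[OF assms(3)] by blast
  then show ?thesis unfolding monomial_map_def
    using assms monomial_vec_nonzero[OF assms(1,2), of "hcoords (proj v)"]
    by (subst proj_eq_iff) (auto simp: monomial_vec_nonzero intro!: exI[of _ c])
qed

lemma cp2_ext: "(\<And>v. v \<noteq> 0 \<Longrightarrow> f (proj v) = g (proj v)) \<Longrightarrow> f = g"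
  by (metis cp2_cases ext)

lemma monomial_map_comp:
  assumes "bij s" "bij t" "\<And>i. d i \<noteq> 0" "\<And>i. e i \<noteq> 0"
  shows "monomial_map s d \<circ> monomial_map t e = monomial_map (t \<circ> s) (\<lambda>i. d i * e (s i))"
  using assms
  by (intro cp2_ext) (simp add: monomial_map_proj monomial_vec_nonzero bij_comp mult.assoc)

lemma monomial_map_id [simp]: "monomial_map id (\<lambda>_. 1) = id"
  by (simp add: fun_eq_iff monomial_map_def)

lemma monomial_map_scale:
  assumes "bij s" "\<forall>i. d i \<noteq> 0" "c \<noteq> 0" "\<forall>i. e i = c * d i"
  shows "monomial_map s e = monomial_map s d"
proof (rule cp2_ext)
  fix v :: "complex^3" assume "v \<noteq> 0"
  moreover have "e i \<noteq> 0" for i using assms by simp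
  ultimately show "monomial_map s e (proj v) = monomial_map s d (proj v)"
    using assms by (simp add: monomial_map_proj, subst proj_eq_iff)
      (auto simp: monomial_vec_nonzero intro!: exI[of _ c])
qed

lemma monomial_map_inverse:
  assumes "bij s" "\<And>i. d i \<noteq> 0"
  shows "bij (monomial_map s d)" 
    and "inv_into UNIV (monomial_map s d) = monomial_map (inv_into UNIV s) (\<lambda>i. inverse (d (inv_into UNIV s i)))"
proof -
  let ?g = "monomial_map (inv_into UNIV s) (\<lambda>i. inverse (d (inv_into UNIV s i)))"
  have "monomial_map s d \<circ> ?g = id" "?g \<circ> monomial_map s d = id"
    using assms by (auto simp: monomial_map_comp bij_imp_bij_inv bij_is_inj inv_o_cancel
        surj_iff[THEN iffD1] bij_is_surj surj_f_inv_f simp flip: id_def)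
  then show "bij (monomial_map s d)" "inv_into UNIV (monomial_map s d) = ?g"
    using o_bij inv_unique_comp by blast+
qed

lemma proj_map_monomial:
  assumes "\<And>i j. M $ i $ j = (if j = s i then d i else 0)"
  shows "proj_map M = monomial_map s d"
  unfolding fun_eq_iff proj_map_def monomial_map_def matrix_vector_mult_def
  by (simp add: assms if_distrib[where f="\<lambda>x. x * _"] cong: if_cong)

text \<open>The third index stays implicit: it is whichever differs from \<open>i\<close> and
  \<open>j\<close>. One notation thus serves permutations, coefficients and coordinate vectors, in
  any order of the coordinates.\<close>

definition tri :: "3 \<Rightarrow> 3 \<Rightarrow> 'a \<Rightarrow> 'a \<Rightarrow> 'a \<Rightarrow> 3 \<Rightarrow> 'a" where
  "tri i j a b c m = (if m = i then a else if m = j then b else c)"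

lemma tri_simps [simp]:
  shows "tri i j a b c i = a" "i \<noteq> j \<Longrightarrow> tri i j a b c j = b"
    "i \<noteq> k \<Longrightarrow> j \<noteq> k \<Longrightarrow> tri i j a b c k = c"
  by (auto simp: tri_def)

lemma distinct_123: "distinct [1, 2, 3 :: 3]"
  by simp


lemma fun_eq_123: "f = g \<longleftrightarrow> f 1 = g 1 \<and> f 2 = g 2 \<and> f (3::3) = g 3"
  by (simp add: fun_eq_iff forall_3)

lemma bij_tri [simp]:
  assumes "distinct [i, j, k]" "distinct [a, b, c]"
  shows "bij (tri i j a b (c::3))"
proof -
  have "range (tri i j a b c) = {a, b, c}"
    using assms(1) by (subst distinct3_UNIV[OF assms(1)]) simp
  then have "surj (tri i j a b c)"
    using distinct3_UNIV[OF assms(2)] by simp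
  then show ?thesis by (metis bij_betw_def finite_UNIV_surj_inj finite_class.finite_UNIV)
qed

lemma lam_nonzero [simp]: "lam n \<noteq> 0"
  by (simp add: lam_def)

lemma lam_power: "n > 0 \<Longrightarrow> lam n ^ n = 1"
  by (simp only: lam_def Complex.DeMoivre) simp

lemma norm_lam [simp]: "cmod (lam n) = 1"
  by (simp add: lam_def)

lemma lam_neq_1: 
  assumes "n \<ge> 2" shows "lam n \<noteq> 1"
proof
  assume "lam n = 1"
  then have "cos (2 * pi / n) = 1" by (simp add: lam_def complex_eq_iff)
  then obtain k :: int where "2 * pi / n = of_int k * 2 * pi" using cos_one_2pi_int by auto
  then have "1 = of_int k * real n" using assms by (simp add: field_simps)
  then have "1 = k * int n" by (metis of_int_1 of_int_eq_iff of_int_mult of_int_of_nat_eq)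
  then have "int n dvd 1" by (metis dvd_triv_right)
  then show False using assms by simp
qed

lemma root_of_unity_lam_power:
  assumes "n > 0" "z ^ n = 1"
  obtains k where "z = lam n ^ k"
proof -
  have "z \<in> {z. z^n = 1}" using assms by simp
  also have "\<dots> = (\<lambda>k. cis (2 * pi * real k / real n)) ` {..<n}"
    using Complex.bij_betw_roots_unity[OF assms(1)] by (simp add: bij_betw_def)
  finally obtain k where "z = cis (2 * pi * real k / real n)" by auto
  then show ?thesis by (intro that[of k]) (simp add: lam_def Complex.DeMoivre mult_ac)
qed


text \<open>The concrete form of the group (Z_n + Z_n) : S_3 of order 6n^2: coefficient triples
  count only modulo a common factor, and the permutations supply S_3.\<close>

definition monomial_group :: "nat \<Rightarrow> (cp2 \<Rightarrow> cp2) set" where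
  "monomial_group n = {monomial_map s d | s d. bij s \<and> (\<forall>i. d i ^ n = 1)}"

lemma root_of_unity_nonzero: "n > 0 \<Longrightarrow> z ^ n = 1 \<Longrightarrow> z \<noteq> (0::complex)"
  by (auto simp: zero_power)

lemma monomial_groupI: "bij s \<Longrightarrow> (\<And>i. d i ^ n = 1) \<Longrightarrow> monomial_map s d \<in> monomial_group n"
  by (auto simp: monomial_group_def)

lemma monomial_groupE:
  assumes "g \<in> monomial_group n" "n > 0"
  obtains s d where "g = monomial_map s d" "bij s" "\<And>i. d i ^ n = 1" "\<And>i. d i \<noteq> 0"
  using assms root_of_unity_nonzero unfolding monomial_group_def by blast

lemma monomial_group_closed:
  assumes "n > 0"
  shows "id \<in> monomial_group n"
    and "f \<in> monomial_group n \<Longrightarrow> g \<in> monomial_group n \<Longrightarrow> f \<circ> g \<in> monomial_group n"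
    and "f \<in> monomial_group n \<Longrightarrow> inv_into UNIV f \<in> monomial_group n"
    and "f \<in> monomial_group n \<Longrightarrow> bij f"
proof -
  show "id \<in> monomial_group n"
    using monomial_groupI[of id "\<lambda>_. 1" n] by simp
  show "f \<circ> g \<in> monomial_group n" if fg: "f \<in> monomial_group n" "g \<in> monomial_group n"
  proof -
    obtain s d where f: "f = monomial_map s d" "bij s" "\<And>i. d i ^ n = 1" "\<And>i. d i \<noteq> 0"
      using monomial_groupE[OF fg(1) assms] by metis
    obtain t e where g: "g = monomial_map t e" "bij t" "\<And>i. e i ^ n = 1" "\<And>i. e i \<noteq> 0"
      using monomial_groupE[OF fg(2) assms] by metis
    show ?thesis
      using f g by (auto simp: monomial_map_comp bij_comp power_mult_distrib intro!: monomial_groupI)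
  qed
  show "inv_into UNIV f \<in> monomial_group n" "bij f" if fg: "f \<in> monomial_group n"
  proof -
    obtain s d where f: "f = monomial_map s d" "bij s" "\<And>i. d i ^ n = 1" "\<And>i. d i \<noteq> 0"
      using monomial_groupE[OF fg(1) assms] by metis
    show "inv_into UNIV f \<in> monomial_group n" "bij f"
      using f by (auto simp: monomial_map_inverse bij_imp_bij_inv power_inverse intro!: monomial_groupI)
  qed
qed

lemma proj_map_mat_A:
  "proj_map (mat_A n) = monomial_map (tri 1 2 2 1 3) (tri 1 2 (lam n) (inverse (lam n)) 1)"
    (is "_ = monomial_map ?s ?d")
proof (rule proj_map_monomial)
  show "mat_A n $ i $ j = (if j = ?s i then ?d i else 0)" for i j
    using exhaust_3[of i] exhaust_3[of j] by (auto simp: mat_A_def tri_def)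
qed

lemma proj_map_mat_B:
  "proj_map (mat_B n) = monomial_map (tri 1 2 2 3 1) (tri 1 2 (lam n) 1 1)"
    (is "_ = monomial_map ?s ?d")
proof (rule proj_map_monomial)
  show "mat_B n $ i $ j = (if j = ?s i then ?d i else 0)" for i j
    using exhaust_3[of i] exhaust_3[of j] by (auto simp: mat_B_def tri_def)
qed

lemma proj_map_mat_C:
  "proj_map (mat_C n) = monomial_map (tri 1 2 3 2 1) (tri 1 2 1 1 (inverse (lam n)))"
    (is "_ = monomial_map ?s ?d")
proof (rule proj_map_monomial)
  show "mat_C n $ i $ j = (if j = ?s i then ?d i else 0)" for i j
    using exhaust_3[of i] exhaust_3[of j] by (auto simp: mat_C_def tri_def)
qed

lemma tri_nonzero [simp]: "a \<noteq> 0 \<Longrightarrow> b \<noteq> 0 \<Longrightarrow> c \<noteq> 0 \<Longrightarrow> tri i j a b c m \<noteq> (0::complex)"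
  by (simp add: tri_def)

lemma bij_tri_123 [simp]: "distinct [a, b, c] \<Longrightarrow> bij (tri 1 2 a b (c::3))"
  by (rule bij_tri[OF distinct_123])

lemma id_tri: "id = tri 1 2 1 2 3"
  by (simp add: fun_eq_123)

abbreviation monomial3 where
  "monomial3 a b c x y z \<equiv> monomial_map (tri 1 2 a b c) (tri 1 2 x y z)"

lemma monomial3_comp:
  assumes "distinct [a, b, c]" "distinct [a', b', c']"
    "x \<noteq> 0" "y \<noteq> 0" "z \<noteq> 0" "x' \<noteq> 0" "y' \<noteq> 0" "z' \<noteq> 0"
  shows "monomial3 a b c x y z \<circ> monomial3 a' b' c' x' y' z' =
    monomial3 (tri 1 2 a' b' c' a) (tri 1 2 a' b' c' b) (tri 1 2 a' b' c' c)
      (x * tri 1 2 x' y' z' a) (y * tri 1 2 x' y' z' b) (z * tri 1 2 x' y' z' c)"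
proof -
  have "tri 1 2 a' b' c' \<circ> tri 1 2 a b c =
      tri 1 2 (tri 1 2 a' b' c' a) (tri 1 2 a' b' c' b) (tri 1 2 a' b' c' c)"
    "(\<lambda>i. tri 1 2 x y z i * tri 1 2 x' y' z' (tri 1 2 a b c i)) =
      tri 1 2 (x * tri 1 2 x' y' z' a) (y * tri 1 2 x' y' z' b) (z * tri 1 2 x' y' z' c)"
    by (simp_all add: fun_eq_123)
  then show ?thesis using assms by (subst monomial_map_comp) simp_all
qed

lemma monomial3_scale:
  assumes "distinct [a, b, c]" "x \<noteq> 0" "y \<noteq> 0" "z \<noteq> 0" "k \<noteq> 0" 
    "x' = k * x" "y' = k * y" "z' = k * z"
  shows "monomial3 a b c x' y' z' = monomial3 a b c x y z"
  using assms by (intro monomial_map_scale[of _ _ k]) (auto simp: tri_def)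

lemma bij_mat: "bij (proj_map (mat_A n))" "bij (proj_map (mat_B n))" "bij (proj_map (mat_C n))"
  unfolding proj_map_mat_A proj_map_mat_B proj_map_mat_C
  by (intro monomial_map_inverse; simp)+

lemma rot_group_closed:
  shows "id \<in> rot_group n"
    and "f \<in> rot_group n \<Longrightarrow> g \<in> rot_group n \<Longrightarrow> f \<circ> g \<in> rot_group n"
    and "f \<in> rot_group n \<Longrightarrow> inv_into UNIV f \<in> rot_group n"
    and "f \<in> rot_group n \<Longrightarrow> bij f"
    and "proj_map (mat_A n) \<in> rot_group n" "proj_map (mat_B n) \<in> rot_group n"
      "proj_map (mat_C n) \<in> rot_group n"
proof -
  have H: "bij h" if "h \<in> {proj_map (mat_A n), proj_map (mat_B n), proj_map (mat_C n)}" for h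
    using that bij_mat by blast
  note gen = generate_BijGroup[of "{proj_map (mat_A n), proj_map (mat_B n), proj_map (mat_C n)}",
      OF H, folded rot_group_def]
  show "id \<in> rot_group n" by (rule gen)
  show "f \<in> rot_group n \<Longrightarrow> g \<in> rot_group n \<Longrightarrow> f \<circ> g \<in> rot_group n" by (rule gen)
  show "f \<in> rot_group n \<Longrightarrow> inv_into UNIV f \<in> rot_group n" by (rule gen)
  show "f \<in> rot_group n \<Longrightarrow> bij f" by (rule gen(1))
  show "proj_map (mat_A n) \<in> rot_group n" "proj_map (mat_B n) \<in> rot_group n"
      "proj_map (mat_C n) \<in> rot_group n"
    by (auto simp: rot_group_def intro: generate.incl)
qed

lemma rot_group_subset_monomial_group:
  assumes "n > 0"
  shows "rot_group n \<subseteq> monomial_group n"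
proof
  fix g assume g: "g \<in> rot_group n"
  have H: "bij h" if "h \<in> {proj_map (mat_A n), proj_map (mat_B n), proj_map (mat_C n)}" for h
    using that bij_mat by blast
  have tri_pow: "tri i j a b c m ^ n = 1" if "a ^ n = 1" "b ^ n = 1" "c ^ n = (1::complex)" for i j a b c m
    using that by (simp add: tri_def)
  have lp: "lam n ^ n = 1" "inverse (lam n) ^ n = 1"
    using lam_power[OF assms] by (simp_all add: power_inverse)
  have "{proj_map (mat_A n), proj_map (mat_B n), proj_map (mat_C n)} \<subseteq> monomial_group n"
    unfolding proj_map_mat_A proj_map_mat_B proj_map_mat_C
    by (auto intro!: monomial_groupI tri_pow bij_tri[OF distinct_123] simp: lp)
  then show "g \<in> monomial_group n"
    using generate_least[OF H g[unfolded rot_group_def], of "monomial_group n"]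
      monomial_group_closed[OF assms] by blast
qed

lemma rot_group_funpow:
  "f \<in> rot_group n \<Longrightarrow> f ^^ k \<in> rot_group n"
  by (induction k) (auto simp: rot_group_closed simp flip: id_def)

lemma monomial_map_funpow:
  assumes "\<And>i. d i \<noteq> 0"
  shows "monomial_map id d ^^ k = monomial_map id (\<lambda>i. d i ^ k)"
  using assms by (induction k) (auto simp: monomial_map_comp simp flip: id_def)

text \<open>Projectively \<open>C\<close> squared is diag(1, lam, 1). Since \<open>B\<close> cubed
  is the scalar \<open>lam n\<close>, the square of \<open>B\<close> is its projective inverse, and
  conjugation by \<open>B\<close> moves the entry \<open>lam n\<close> to the other two positions.
  Powers of these three matrices give all diagonal ones.\<close>

lemma diagonal_mem_rot_group:
  assumes "n > 0" "\<And>i. d i ^ n = 1"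
  shows "monomial_map id d \<in> rot_group n"
proof -
  let ?l = "lam n"
  let ?B = "proj_map (mat_B n)" and ?C = "proj_map (mat_C n)"
  have "?C \<circ> ?C = monomial3 1 2 3 1 ?l 1"
    unfolding proj_map_mat_C
    by (simp add: monomial3_comp, rule monomial3_scale[where k = "inverse ?l"]) simp_all
  then have D2: "monomial3 1 2 3 1 ?l 1 \<in> rot_group n"
    by (metis rot_group_closed(2,7))
  have "?B \<circ> monomial3 1 2 3 1 ?l 1 \<circ> (?B \<circ> ?B) = monomial3 1 2 3 ?l 1 1"
    unfolding proj_map_mat_B
    by (simp add: monomial3_comp, rule monomial3_scale[where k = "?l"]) simp_all
  then have D1: "monomial3 1 2 3 ?l 1 1 \<in> rot_group n"
    by (metis D2 rot_group_closed(2,6))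
  have "(?B \<circ> ?B) \<circ> monomial3 1 2 3 1 ?l 1 \<circ> ?B = monomial3 1 2 3 1 1 ?l"
    unfolding proj_map_mat_B
    by (simp add: monomial3_comp, rule monomial3_scale[where k = "?l"]) simp_all
  then have D3: "monomial3 1 2 3 1 1 ?l \<in> rot_group n"
    by (metis D2 rot_group_closed(2,6))
  have pow: "monomial3 1 2 3 x y z ^^ k = monomial3 1 2 3 (x^k) (y^k) (z^k)"
    if "x \<noteq> 0" "y \<noteq> 0" "z \<noteq> 0" for x y z k
  proof -
    have "(\<lambda>i. tri 1 2 x y z i ^ k) = tri 1 2 (x^k) (y^k) (z^k)" by (simp add: fun_eq_123)
    then show ?thesis using monomial_map_funpow[of "tri 1 2 x y z" k] that by (simp add: id_tri)
  qed
  obtain a where a: "d 1 = ?l ^ a" using root_of_unity_lam_power[OF assms] by metis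
  obtain b where b: "d 2 = ?l ^ b" using root_of_unity_lam_power[OF assms] by metis
  obtain c where c: "d 3 = ?l ^ c" using root_of_unity_lam_power[OF assms] by metis
  from a b c have "d = tri 1 2 (?l ^ a) (?l ^ b) (?l ^ c)" by (simp add: fun_eq_123)
  then have "monomial_map id d = (monomial3 1 2 3 ?l 1 1 ^^ a) \<circ> (monomial3 1 2 3 1 ?l 1 ^^ b) \<circ>
      (monomial3 1 2 3 1 1 ?l ^^ c)"
    by (simp add: pow monomial3_comp id_tri)
  then show ?thesis
    using D1 D2 D3 by (simp only: rot_group_funpow rot_group_closed(2))
qed

lemma permutation_3_cases:
  fixes s :: "3 \<Rightarrow> 3"
  assumes "bij s"
  shows "s = tri 1 2 1 2 3 \<or> s = tri 1 2 2 1 3 \<or> s = tri 1 2 3 2 1 \<or> s = tri 1 2 1 3 2 \<or>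
    s = tri 1 2 2 3 1 \<or> s = tri 1 2 3 1 2"
proof -
  have "s 1 \<noteq> s 2" "s 1 \<noteq> s 3" "s 2 \<noteq> s 3"
    using assms by (simp_all add: bij_def inj_eq)
  then show ?thesis
    using exhaust_3[of "s 1"] exhaust_3[of "s 2"] exhaust_3[of "s 3"]
    unfolding fun_eq_123 by (elim disjE) simp_all
qed

text \<open>The words id, A, B, BB, AB, BA realise all six permutations of the coordinates. Any
  other monomial map with the same permutation differs from such a word by a diagonal factor, which
  is already in the group.\<close>

lemma rot_group_eq:
  assumes "n > 0"
  shows "rot_group n = monomial_group n"
proof (rule equalityI[OF rot_group_subset_monomial_group[OF assms]], rule subsetI)
  let ?A = "proj_map (mat_A n)" and ?B = "proj_map (mat_B n)"
  fix g assume "g \<in> monomial_group n"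
  then obtain s d where g: "g = monomial_map s d" "bij s" "\<And>i. d i ^ n = 1" "\<And>i. d i \<noteq> 0"
    using monomial_groupE[OF _ assms] by metis
  have "\<exists>e. monomial_map s e \<in> rot_group n \<and> (\<forall>i. e i ^ n = 1)"
  proof -
    have *: ?thesis if "monomial3 a b c x y z \<in> rot_group n" "s = tri 1 2 a b c"
        "x ^ n = 1" "y ^ n = 1" "z ^ n = 1" for a b c x y z
      using that by (intro exI[of _ "tri 1 2 x y z"]) (auto simp: tri_def)
    have l: "lam n ^ n = 1" "inverse (lam n) ^ n = 1"
      using lam_power[OF assms] by (simp_all add: power_inverse)
    note R = rot_group_closed
    note l [simp] monomial3_comp [simp]
    note m = R(1)[of n, folded monomial_map_id] R(5)[of n] R(6)[of n]
      R(2)[OF R(6) R(6), of n] R(2)[OF R(5) R(6), of n] R(2)[OF R(6) R(5), of n]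
    note m' = m[unfolded id_tri proj_map_mat_A proj_map_mat_B, simplified]
    have one: "(\<lambda>_. 1) = tri 1 2 1 1 (1::complex)" by (simp add: fun_eq_123)
    note m'' = m'[unfolded one]
    show ?thesis
      using permutation_3_cases[OF g(2)]
      by (elim disjE) (rule *[OF m''(1)] *[OF m''(2)] *[OF m''(3)] *[OF m''(4)] *[OF m''(5)] *[OF m''(6)];
          simp; fail)+
  qed
  then obtain e where e: "monomial_map s e \<in> rot_group n" "\<And>i. e i ^ n = 1" by blast
  have e0: "e i \<noteq> 0" for i using root_of_unity_nonzero[OF assms e(2)] .
  have "monomial_map id (\<lambda>i. d i / e i) \<in> rot_group n"
    using assms g(3) e(2) by (intro diagonal_mem_rot_group) (auto simp: power_divide)
  then have "monomial_map id (\<lambda>i. d i / e i) \<circ> monomial_map s e \<in> rot_group n"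
    using e(1) rot_group_closed(2) by blast
  also have "monomial_map id (\<lambda>i. d i / e i) \<circ> monomial_map s e = g"
    using g e0 by (subst monomial_map_comp) auto
  finally show "g \<in> rot_group n" .
qed

lemma monomial_map_fixes_iff:
  assumes "bij s" "\<And>i. d i \<noteq> 0" "v \<noteq> 0"
  shows "monomial_map s d (proj v) = proj v \<longleftrightarrow> (\<exists>c. c \<noteq> 0 \<and> (\<forall>i. d i * v $ s i = c * v $ i))"
  using assms by (simp add: monomial_map_proj, subst proj_eq_iff) (auto simp: monomial_vec_nonzero)

lemma sum_bij_3: "bij s \<Longrightarrow> (\<Sum>i\<in>UNIV. f (s i)) = (\<Sum>i\<in>UNIV. f (i::3))"
  by (simp add: sum.reindex_bij_betw[of s])

lemma monomial_group_fermat: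
  assumes "g \<in> monomial_group n" "n > 0" "p \<in> fermat_curve n"
  shows "g p \<in> fermat_curve n"
proof -
  obtain s d where g: "g = monomial_map s d" "bij s" "\<And>i. d i ^ n = 1" "\<And>i. d i \<noteq> 0"
    using monomial_groupE[OF assms(1,2)] by metis
  obtain v where v: "v \<noteq> 0" "p = proj v" using cp2_cases by blast
  show ?thesis
    using assms g v
    by (simp add: monomial_map_proj proj_mem_fermat_iff monomial_vec_nonzero power_mult_distrib sum_bij_3[where f="\<lambda>i. _ $ i ^ _"])
qed

section \<open>Conjugate stabilizers and orbits\<close>

lemma rot_stabilizer_conj:
  assumes "h \<in> rot_group n"
  shows "rot_stabilizer n (h p) = (\<lambda>g. h \<circ> g \<circ> inv_into UNIV h) ` rot_stabilizer n p"
proof -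
  have h: "bij h" using assms rot_group_closed(4) by blast
  have inv: "inv_into UNIV h (h x) = x" "h (inv_into UNIV h x) = x" for x
    using h by (simp_all add: bij_is_inj bij_is_surj surj_f_inv_f)
  have "g \<in> (\<lambda>g. h \<circ> g \<circ> inv_into UNIV h) ` rot_stabilizer n p" if "g \<in> rot_stabilizer n (h p)" for g
    using that assms
    by (intro image_eqI[of _ _ "inv_into UNIV h \<circ> g \<circ> h"])
      (auto simp: rot_stabilizer_def inv fun_eq_iff intro!: rot_group_closed)
  moreover have "h \<circ> g \<circ> inv_into UNIV h \<in> rot_stabilizer n (h p)" if "g \<in> rot_stabilizer n p" for g
    using that assms by (auto simp: rot_stabilizer_def inv intro!: rot_group_closed)
  ultimately show ?thesis by blast
qed

lemma conj_image_inj: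
  assumes "bij h" "(\<lambda>g. h \<circ> g \<circ> inv_into UNIV h) ` A = (\<lambda>g. h \<circ> g \<circ> inv_into UNIV h) ` B"
  shows "A = B"
proof -
  have "inj (\<lambda>g. h \<circ> g \<circ> inv_into UNIV h)"
  proof (rule injI)
    fix f g assume "h \<circ> f \<circ> inv_into UNIV h = h \<circ> g \<circ> inv_into UNIV h"
    then have "h (f (inv_into UNIV h (h x))) = h (g (inv_into UNIV h (h x)))" for x
      by (metis comp_apply)
    then show "f = g" using assms(1) by (auto simp: bij_is_inj inj_eq)
  qed
  then show ?thesis using assms(2) by (simp add: inj_image_eq_iff)
qed

text \<open>The conjugating element is moved from the stabilizer to the point, because the
  stabilizer of \<open>h q\<close> is the conjugate by \<open>h\<close> of that of \<open>q\<close>.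
  It then suffices to exhibit one point whose stabilizer is exactly the cyclic group and to describe
  its orbit.\<close>

lemma points_with_rotation_eq:
  assumes "n > 0"
  shows "points_with_rotation n M =
    {h q | h q. h \<in> rot_group n \<and> q \<in> fermat_curve n \<and>
       rot_stabilizer n q = generate (BijGroup UNIV) {proj_map M}}"
proof (intro equalityI subsetI)
  fix p assume "p \<in> points_with_rotation n M"
  then obtain h where h: "p \<in> fermat_curve n" "h \<in> rot_group n"
    "rot_stabilizer n p = (\<lambda>g. h \<circ> g \<circ> inv_into UNIV h) ` generate (BijGroup UNIV) {proj_map M}"
    unfolding points_with_rotation_def by blast
  have bij: "bij h" using h rot_group_closed(4) by blast
  define q where "q = inv_into UNIV h p"
  have p: "p = h q" using bij by (simp add: q_def bij_is_surj surj_f_inv_f)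
  have "q \<in> fermat_curve n" unfolding q_def
    using monomial_group_fermat[OF _ assms h(1)] rot_group_closed(3)[OF h(2)] rot_group_eq[OF assms] by blast
  moreover have "rot_stabilizer n q = generate (BijGroup UNIV) {proj_map M}"
    using h(3) bij unfolding p rot_stabilizer_conj[OF h(2)] by (rule conj_image_inj[rotated])
  ultimately show "p \<in> {h q | h q. h \<in> rot_group n \<and> q \<in> fermat_curve n \<and>
       rot_stabilizer n q = generate (BijGroup UNIV) {proj_map M}}"
    using p h(2) by blast
next
  fix p assume "p \<in> {h q | h q. h \<in> rot_group n \<and> q \<in> fermat_curve n \<and>
       rot_stabilizer n q = generate (BijGroup UNIV) {proj_map M}}"
  then obtain h q where h: "p = h q" "h \<in> rot_group n" "q \<in> fermat_curve n"
       "rot_stabilizer n q = generate (BijGroup UNIV) {proj_map M}" by blast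
  then have "p \<in> fermat_curve n"
    using monomial_group_fermat[OF _ assms h(3)] rot_group_eq[OF assms] by blast
  then show "p \<in> points_with_rotation n M"
    using h rot_stabilizer_conj[OF h(2), of q] by (auto simp: points_with_rotation_def)
qed

lemma exists_complex_root:
  fixes a :: complex assumes "n > 0"
  obtains c where "c ^ n = a"
proof (cases "a = 0")
  case True
  then show ?thesis using assms that[of 0] by (simp add: zero_power)
next
  case False
  then have "exp (Ln a / of_nat n) ^ n = a"
    using assms by (simp flip: exp_of_nat_mult)
  then show ?thesis using that by blast
qed

text \<open>After dividing by an n-th root of \<open>\<kappa>\<close>, corresponding coordinates
  have equal n-th powers, so their quotients are n-th roots of unity and serve as
  coefficients.\<close>

lemma monomial_orbit:
  assumes "n > 0" "v \<noteq> 0" "w \<noteq> 0" "bij s" "\<kappa> \<noteq> 0" "\<And>i. (v $ i) ^ n = \<kappa> * (w $ s i) ^ n"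
  obtains h where "h \<in> rot_group n" "proj v = h (proj w)"
proof -
  obtain c where c: "c ^ n = \<kappa>" using exists_complex_root[OF assms(1)] by blast
  then have c0: "c \<noteq> 0" using assms by (auto simp: zero_power)
  \<comment> \<open>Where a coordinate vanishes its coefficient is arbitrary; the value 1 keeps it
    an n-th root of unity.\<close>
  define d where "d i = (if w $ s i = 0 then 1 else v $ i / (c * w $ s i))" for i
  have d: "d i ^ n = 1" for i
    using assms c c0 by (auto simp: d_def power_divide power_mult_distrib)
  have vd: "v $ i = c * (d i * w $ s i)" for i
    using assms(1) assms(6)[of i] c0 by (auto simp: d_def zero_power)
  have "monomial_map s d \<in> rot_group n"
    using assms d by (auto simp: rot_group_eq intro: monomial_groupI)
  moreover have d0: "d i \<noteq> 0" for i using root_of_unity_nonzero[OF assms(1) d] .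
  have "proj v = monomial_map s d (proj w)"
    using assms d0 c0 vd
    by (simp add: monomial_map_proj, subst proj_eq_iff) (auto simp: monomial_vec_nonzero)
  ultimately show ?thesis using that by blast
qed

lemma generate_subset_rot_stabilizer:
  assumes "m \<in> rot_group n" "m p = p"
  shows "generate (BijGroup UNIV) {m} \<subseteq> rot_stabilizer n p"
proof
  have m: "bij f" if "f \<in> {m}" for f using that assms rot_group_closed(4) by blast
  fix g assume g: "g \<in> generate (BijGroup UNIV) {m}"
  show "g \<in> rot_stabilizer n p"
  proof (rule generate_least[OF m g])
    show "{m} \<subseteq> rot_stabilizer n p" "id \<in> rot_stabilizer n p"
      using assms by (auto simp: rot_stabilizer_def rot_group_closed)
    show "inv_into UNIV f \<in> rot_stabilizer n p" if "f \<in> rot_stabilizer n p" for f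
      using that rot_group_closed(3,4)[of f n]
      by (simp add: rot_stabilizer_def) (metis bij_inv_eq_iff)
    show "f \<circ> g \<in> rot_stabilizer n p" if "f \<in> rot_stabilizer n p" "g \<in> rot_stabilizer n p" for f g
      using that by (auto simp: rot_stabilizer_def rot_group_closed)
  qed auto
qed

text \<open>At a point without zero coordinates the permutation determines the coefficients up to a
  common factor. The stabilizer of such a point therefore embeds into the permutations of the
  coordinates.\<close>

lemma monomial_map_eqI:
  assumes "bij s" "\<And>i. d i \<noteq> 0" "\<And>i. e i \<noteq> 0" "\<And>i. v $ i \<noteq> 0"
    "monomial_map s d (proj v) = proj v" "monomial_map s e (proj v) = proj v"
  shows "monomial_map s d = monomial_map s e"
proof -
  have v: "v \<noteq> 0" using assms(4)[of 1] by auto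
  obtain c where c: "c \<noteq> 0" "\<And>i. d i * v $ s i = c * v $ i"
    using monomial_map_fixes_iff[OF assms(1,2) v] assms(5) by auto
  obtain k where k: "k \<noteq> 0" "\<And>i. e i * v $ s i = k * v $ i"
    using monomial_map_fixes_iff[OF assms(1,3) v] assms(6) by auto
  have "d i = (c / k) * e i" for i
  proof -
    have "d i = c * v $ i / v $ s i" "e i = k * v $ i / v $ s i"
      using c(2)[of i] k(2)[of i] assms(4)[of "s i"] by (simp_all add: field_simps)
    then show ?thesis using k(1) by simp
  qed
  then show ?thesis using assms c k by (intro monomial_map_scale[of _ _ "c/k"]) auto
qed

subsection \<open>Stabilizers and geometric points\<close>

abbreviation tvec :: "3 \<Rightarrow> 3 \<Rightarrow> complex \<Rightarrow> complex \<Rightarrow> complex \<Rightarrow> complex ^ 3" where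
  "tvec i j x y z \<equiv> (\<chi> m. tri i j x y z m)"

lemma tvec_eq_0_iff:
  assumes "distinct [i, j, k]"
  shows "tvec i j x y z = 0 \<longleftrightarrow> x = 0 \<and> y = 0 \<and> z = 0"
  using assms by (simp add: vec_eq_iff all_distinct3[OF assms])

lemma proj_tvec_mem_fermat:
  assumes "distinct [i, j, k]" "x \<noteq> 0 \<or> y \<noteq> 0 \<or> z \<noteq> 0"
  shows "proj (tvec i j x y z) \<in> fermat_curve n \<longleftrightarrow> x ^ n + y ^ n + z ^ n = 0"
  using assms by (auto simp: proj_mem_fermat_iff tvec_eq_0_iff[OF assms(1)] sum_distinct3[OF assms(1)])

lemma norm_root_of_unity:
  assumes "n > 0" "z ^ n = (1::complex)"
  shows "cmod z = 1"
proof -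
  have "cmod z ^ n = 1 ^ n" using assms(2) by (metis norm_one norm_power power_one)
  then show ?thesis using assms(1) by (simp only: power_eq_iff_eq_base norm_ge_zero zero_le_one)
qed

text \<open>The coefficients are unimodular, so a rotation only permutes the moduli of the
  coordinates. This makes conditions on moduli invariant under the group.\<close>

lemma rot_group_norms:
  assumes "n > 0" "h \<in> rot_group n" "v \<noteq> 0" "w \<noteq> 0" "proj v = h (proj w)"
  obtains s r where "bij s" "r > 0" "\<And>i. cmod (v $ i) = r * cmod (w $ s i)"
proof -
  obtain s d where g: "h = monomial_map s d" "bij s" "\<And>i. d i ^ n = 1" "\<And>i. d i \<noteq> 0"
    using monomial_groupE[of h n] assms by (metis rot_group_eq)
  have "proj v = proj (\<chi> i. d i * w $ s i)"
    using assms g by (simp add: monomial_map_proj)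
  then obtain c where c: "c \<noteq> 0" "\<And>i. v $ i = c * (d i * w $ s i)"
    using assms g by (subst (asm) proj_eq_iff) (auto simp: monomial_vec_nonzero)
  have "cmod (v $ i) = cmod c * cmod (w $ s i)" for i
    using c(2) norm_root_of_unity[OF assms(1) g(3)] by (simp add: norm_mult)
  then show ?thesis using that[of s "cmod c"] g(2) c(1) by simp
qed

lemma rot_stabilizer_elem:
  assumes "n > 0" "g \<in> rot_stabilizer n (proj v)" "v \<noteq> 0"
  obtains s d c where "g = monomial_map s d" "bij s" "\<And>i. d i ^ n = 1" "\<And>i. d i \<noteq> 0" "c \<noteq> 0"
    "\<And>i. d i * v $ s i = c * v $ i"
proof -
  have "g \<in> monomial_group n" "g (proj v) = proj v"
    using assms by (auto simp: rot_stabilizer_def rot_group_eq)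
  then show ?thesis
    using monomial_groupE[of g n thesis] monomial_map_fixes_iff[OF _ _ assms(3)] that assms(1) by metis
qed

lemma generate_singleton_closed:
  assumes "m \<in> rot_group n"
  shows "m \<in> generate (BijGroup UNIV) {m}" "id \<in> generate (BijGroup UNIV) {m}"
    "f \<in> generate (BijGroup UNIV) {m} \<Longrightarrow> g \<in> generate (BijGroup UNIV) {m} \<Longrightarrow>
      f \<circ> g \<in> generate (BijGroup UNIV) {m}"
    "f \<in> generate (BijGroup UNIV) {m} \<Longrightarrow> f ^^ k \<in> generate (BijGroup UNIV) {m}"
proof -
  have m: "bij f" if "f \<in> {m}" for f using that assms rot_group_closed(4) by blast
  show "m \<in> generate (BijGroup UNIV) {m}" by (auto intro: generate.incl)
  show i: "id \<in> generate (BijGroup UNIV) {m}" using generate_id[of "{m}"] m by blast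
  show c: "f \<circ> g \<in> generate (BijGroup UNIV) {m}" if "f \<in> generate (BijGroup UNIV) {m}" "g \<in> generate (BijGroup UNIV) {m}" for f g
    using generate_comp[of "{m}"] m that by blast
  show "f ^^ k \<in> generate (BijGroup UNIV) {m}" if "f \<in> generate (BijGroup UNIV) {m}"
  proof (induction k)
    case (Suc k)
    then show ?case using c[OF that] by (simp only: funpow.simps)
  qed (use i in \<open>simp add: id_def\<close>)
qed

text \<open>The last coordinate is a square root of \<open>inverse (lam n)\<close>, which makes the
  vector an eigenvector of \<open>C\<close>. An element of the stabilizer must keep the vanishing
  middle coordinate in place. If it is diagonal, only the middle coefficient is free and it is a
  power of \<open>C\<close> squared; if it exchanges the outer coordinates, it is \<open>C\<close>
  times such a power.\<close>

lemma rot_stabilizer_vertex: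
  assumes "n \<ge> 2"
  shows "rot_stabilizer n (proj (tvec 1 2 1 0 (cis (- pi / n)))) =
    generate (BijGroup UNIV) {proj_map (mat_C n)}" (is "rot_stabilizer n (proj ?v) = ?G")
proof
  let ?nu = "cis (- pi / n)" and ?C = "proj_map (mat_C n)"
  have n: "n > 0" using assms by simp
  have v: "?v \<noteq> 0" by (simp add: tvec_eq_0_iff[OF distinct_123])
  have nu2: "inverse (lam n) = ?nu * ?nu" 
    by (simp add: lam_def cis_mult)
  have C: "?C \<in> rot_group n" by (rule rot_group_closed)
  have "?C (proj ?v) = proj ?v"
    using v nu2 unfolding proj_map_mat_C
    by (subst monomial_map_fixes_iff) (auto simp: forall_3 intro!: exI[of _ ?nu])
  then show "?G \<subseteq> rot_stabilizer n (proj ?v)"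
    using C generate_subset_rot_stabilizer by blast
  show "rot_stabilizer n (proj ?v) \<subseteq> ?G"
  proof
    fix g assume "g \<in> rot_stabilizer n (proj ?v)"
    then obtain s d c where g: "g = monomial_map s d" "bij s" "\<And>i. d i ^ n = 1" "\<And>i. d i \<noteq> 0" "c \<noteq> 0"
      "\<And>i. d i * ?v $ s i = c * ?v $ i"
      using rot_stabilizer_elem[OF n _ v] by metis
    have CC: "?C \<circ> ?C = monomial3 1 2 3 1 (lam n) 1"
      unfolding proj_map_mat_C
      by (simp add: monomial3_comp, rule monomial3_scale[where k = "inverse (lam n)"]) simp_all
    have diag: "monomial3 1 2 3 1 z 1 \<in> ?G" if z: "z ^ n = 1" for z
    proof -
      obtain k where k: "z = lam n ^ k" using root_of_unity_lam_power[OF n z] by blast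
      have "(?C \<circ> ?C) ^^ k \<in> ?G" using generate_singleton_closed[OF C] by blast
      also have "(?C \<circ> ?C) ^^ k = monomial_map id (\<lambda>i. tri 1 2 1 (lam n) 1 i ^ k)"
        unfolding CC using monomial_map_funpow[of "tri 1 2 1 (lam n) 1" k] by (simp add: id_tri)
      also have "(\<lambda>i. tri 1 2 1 (lam n) 1 i ^ k) = tri 1 2 1 z 1" by (simp add: fun_eq_123 k)
      finally show ?thesis by (simp add: id_tri)
    qed
    have "s 2 = 2" using g(6)[of 2] g(4)[of 2] exhaust_3[of "s 2"] by auto
    then consider "s = tri 1 2 1 2 3" | "s = tri 1 2 3 2 1"
      using permutation_3_cases[OF g(2)] by (elim disjE) auto
    then show "g \<in> ?G"
    proof cases
      case 1
      then have d: "d 1 = c" "d 3 = c" using g(6)[of 1] g(6)[of 3] by auto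
      have "g = monomial3 1 2 3 1 (d 2 / c) 1"
        unfolding g(1) 1 using g(4,5) d by (intro monomial_map_scale[of _ _ c]) (simp_all add: forall_3)
      then show ?thesis using diag[of "d 2 / c"] g(3)[of 1] g(3)[of 2] g(5) d by (simp add: power_divide)
    next
      case 2
      then have d: "d 1 = c * inverse ?nu" "d 3 = c * ?nu" using g(6)[of 1] g(6)[of 3] by (auto simp: field_simps)
      have "?C \<circ> monomial3 1 2 3 1 (d 2 / d 1) 1 = monomial3 3 2 1 1 (d 2 / d 1) (inverse (lam n))"
        using g(4) unfolding proj_map_mat_C by (simp add: monomial3_comp)
      also have "\<dots> = g"
      proof -
        have "c = d 1 * ?nu" using d(1) by (metis cis_neq_zero mult.assoc mult.right_neutral left_inverse)
        then have "inverse (lam n) = inverse (d 1) * d 3"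
          using g(4)[of 1] unfolding nu2 d(2) by simp
        then show ?thesis
          unfolding g(1) 2 using g(4,5)
          by (intro monomial_map_scale[of _ _ "inverse (d 1)"]) (simp_all add: forall_3 divide_inverse)
      qed
      finally show ?thesis using diag[of "d 2 / d 1"] g(3)[of 1] g(3)[of 2] generate_singleton_closed(1,3)[OF C] by (metis power_divide div_by_1)
    qed
  qed
qed

text \<open>For a point without zero coordinates it is enough to find, for each permutation that
  preserves the n-th powers up to a factor, some element of the cyclic group with that permutation;
  \<open>monomial_map_eqI\<close> then identifies the two maps.\<close>

lemma rot_stabilizer_subset_generate:
  assumes "n > 0" "m \<in> rot_group n" "\<And>i. v $ i \<noteq> 0" "m (proj v) = proj v"
    and perms: "\<And>s \<kappa>. bij s \<Longrightarrow> (\<And>i. (v $ s i) ^ n = \<kappa> * (v $ i) ^ n) \<Longrightarrow>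
      \<exists>e. (\<forall>i. e i \<noteq> 0) \<and> monomial_map s e \<in> generate (BijGroup UNIV) {m}"
  shows "rot_stabilizer n (proj v) = generate (BijGroup UNIV) {m}"
proof (intro equalityI subsetI)
  have v: "v \<noteq> 0" using assms(3)[of 1] by auto
  show "g \<in> rot_stabilizer n (proj v)" if "g \<in> generate (BijGroup UNIV) {m}" for g
    using generate_subset_rot_stabilizer[OF assms(2,4)] that by blast
  fix g assume G: "g \<in> rot_stabilizer n (proj v)"
  then obtain s d c where g: "g = monomial_map s d" "bij s" "\<And>i. d i ^ n = 1" "\<And>i. d i \<noteq> 0" "c \<noteq> 0"
      "\<And>i. d i * v $ s i = c * v $ i"
    using rot_stabilizer_elem[OF assms(1) _ v] by metis
  have "(v $ s i) ^ n = c ^ n * (v $ i) ^ n" for i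
    using arg_cong[OF g(6)[of i], of "\<lambda>x. x ^ n"] g(3) by (simp add: power_mult_distrib)
  then obtain e where e: "\<And>i. e i \<noteq> 0" "monomial_map s e \<in> generate (BijGroup UNIV) {m}"
    using perms[OF g(2)] by blast
  then have "monomial_map s e (proj v) = proj v"
    using generate_subset_rot_stabilizer[OF assms(2,4)] by (auto simp: rot_stabilizer_def)
  then have "g = monomial_map s e"
    using G monomial_map_eqI[OF g(2,4) e(1) assms(3)] by (simp add: rot_stabilizer_def g(1))
  then show "g \<in> generate (BijGroup UNIV) {m}" using e by simp
qed

text \<open>The factor \<open>lam n\<close> makes the vector an eigenvector of \<open>A\<close>. Its
  n-th powers are (1, 1, -2), and a permutation that moves the last entry would require
  \<open>\<kappa>\<close> to be both 1 and -2 or -1/2 at different positions. Only the identity and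
  the transposition carried by \<open>A\<close> remain.\<close>

lemma rot_stabilizer_edge_centre:
  assumes "n \<ge> 2" "c ^ n = - 2"
  shows "rot_stabilizer n (proj (tvec 1 2 (lam n) 1 c)) =
    generate (BijGroup UNIV) {proj_map (mat_A n)}" (is "rot_stabilizer n (proj ?v) = ?G")
proof (rule rot_stabilizer_subset_generate)
  show n: "n > 0" using assms by simp
  show A: "proj_map (mat_A n) \<in> rot_group n" by (rule rot_group_closed)
  have c: "c \<noteq> 0" using assms by (auto simp: zero_power)
  then show nz: "?v $ i \<noteq> 0" for i by (simp add: tri_def)
  then have v: "?v \<noteq> 0" by (metis zero_index)
  show "proj_map (mat_A n) (proj ?v) = proj ?v"
    unfolding proj_map_mat_A using v
    by (subst monomial_map_fixes_iff) (auto simp: forall_3 intro!: exI[of _ 1])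
  fix s \<kappa> assume s: "bij s" "\<And>i. (?v $ s i) ^ n = \<kappa> * (?v $ i) ^ n"
  have "s = tri 1 2 1 2 3 \<or> s = tri 1 2 2 1 3"
    using permutation_3_cases[OF s(1)] s(2)[of 1] s(2)[of 2] s(2)[of 3] lam_power[OF n] assms(2)
    by (elim disjE) auto
  then show "\<exists>e. (\<forall>i. e i \<noteq> 0) \<and> monomial_map s e \<in> ?G"
  proof
    assume "s = tri 1 2 1 2 3"
    then show ?thesis using generate_singleton_closed(2)[OF A] monomial_map_id
      by (intro exI[of _ "\<lambda>_. 1"]) (simp flip: id_tri)
  next
    assume "s = tri 1 2 2 1 3"
    then show ?thesis using generate_singleton_closed(1)[OF A]
      by (intro exI[of _ "tri 1 2 (lam n) (inverse (lam n)) 1"]) (simp add: proj_map_mat_A)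
  qed
qed

lemma cis_120: "cis (2 * pi / 3) = Complex (-1/2) (sqrt 3 / 2)"
  by (simp add: complex_eq_iff cos_120 sin_120)

text \<open>With c = cis (2 pi / (3 n)) the vector is (1, c^-2, c^-1), an eigenvector of
  \<open>B\<close> for the eigenvalue c because c^3 = \<open>lam n\<close>. Its n-th powers are the
  three cube roots of unity, which a cyclic permutation preserves up to a factor.\<close>

lemma rot_stabilizer_face_centre:
  assumes "n \<ge> 2"
  shows "rot_stabilizer n (proj (tvec 1 2 1 (cis (- 4 * pi / (3 * n))) (cis (- 2 * pi / (3 * n))))) =
    generate (BijGroup UNIV) {proj_map (mat_B n)}" (is "rot_stabilizer n (proj ?v) = ?G")
    and "cis (- 4 * pi / (3 * n)) ^ n = cis (2 * pi / 3)"
    and "cis (- 2 * pi / (3 * n)) ^ n = cnj (cis (2 * pi / 3))"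
proof -
  have n: "n > 0" using assms by simp
  have "cis (- 4 * pi / (3 * n)) ^ n = cis (2 * pi / 3 - 2 * pi)"
    using n by (simp add: Complex.DeMoivre field_simps)
  also have "\<dots> = cis (2 * pi / 3)" using cis_divide[of "2 * pi / 3" "2 * pi"] by simp
  finally show p2: "cis (- 4 * pi / (3 * n)) ^ n = cis (2 * pi / 3)" .
  show p3: "cis (- 2 * pi / (3 * n)) ^ n = cnj (cis (2 * pi / 3))"
    using n by (simp add: Complex.DeMoivre field_simps cis_cnj)
  show "rot_stabilizer n (proj ?v) = ?G"
  proof (rule rot_stabilizer_subset_generate)
    show "n > 0" by (rule n)
    show B: "proj_map (mat_B n) \<in> rot_group n" by (rule rot_group_closed)
    show nz: "?v $ i \<noteq> 0" for i by (simp add: tri_def)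
    then have v: "?v \<noteq> 0" by (metis zero_index)
    have eqs: "lam n * cis (- 4 * pi / (3 * n)) = cis (2 * pi / (3 * n))"
      "cis (- 2 * pi / (3 * n)) = cis (2 * pi / (3 * n)) * cis (- 4 * pi / (3 * n))"
      "1 = cis (2 * pi / (3 * n)) * cis (- 2 * pi / (3 * n))"
      using n by (simp_all add: lam_def cis_mult field_simps)
    show "proj_map (mat_B n) (proj ?v) = proj ?v"
      unfolding proj_map_mat_B using v eqs
      by (subst monomial_map_fixes_iff) (auto simp: forall_3 intro!: exI[of _ "cis (2 * pi / (3 * n))"])
    fix s \<kappa> assume s: "bij s" "\<And>i. (?v $ s i) ^ n = \<kappa> * (?v $ i) ^ n"
    have neq: "cis (2 * pi / 3) \<noteq> 1" "cnj (cis (2 * pi / 3)) \<noteq> 1" "cis (2 * pi / 3) \<noteq> cnj (cis (2 * pi / 3))"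
      unfolding cis_120 by (auto simp: complex_eq_iff)
    have nz': "(?v $ i) ^ n \<noteq> 0" for i using nz by simp
    \<comment> \<open>A transposition has a fixed index, hence factor 1; as the three n-th powers
      are distinct, factor 1 forces the identity. So no transposition survives.\<close>
    have fixpt: "\<kappa> = 1" if "s i = i" for i
      using s(2)[of i] nz'[of i] that by simp
    have inj: "s i = i" if "\<kappa> = 1" for i
      using s(2)[of i] that neq p2 p3 exhaust_3[of i] exhaust_3[of "s i"] by auto
    have "s = tri 1 2 1 2 3 \<or> s = tri 1 2 2 3 1 \<or> s = tri 1 2 3 1 2"
      using permutation_3_cases[OF s(1)] fixpt[of 1] fixpt[of 2] fixpt[of 3] inj[of 1] inj[of 2] inj[of 3]
      by (elim disjE) auto
    then show "\<exists>e. (\<forall>i. e i \<noteq> 0) \<and> monomial_map s e \<in> ?G"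
    proof (elim disjE)
      assume "s = tri 1 2 1 2 3"
      then show ?thesis using generate_singleton_closed(2)[OF B] monomial_map_id
        by (intro exI[of _ "\<lambda>_. 1"]) (simp flip: id_tri)
    next
      assume "s = tri 1 2 2 3 1"
      then show ?thesis using generate_singleton_closed(1)[OF B]
        by (intro exI[of _ "tri 1 2 (lam n) 1 1"]) (simp add: proj_map_mat_B)
    next
      assume "s = tri 1 2 3 1 2"
      moreover have "proj_map (mat_B n) \<circ> proj_map (mat_B n) = monomial3 3 1 2 (lam n) 1 (lam n)"
        by (simp add: proj_map_mat_B monomial3_comp)
      ultimately show ?thesis using generate_singleton_closed(1,3)[OF B]
        by (intro exI[of _ "tri 1 2 (lam n) 1 (lam n)"]) (metis tri_nonzero lam_nonzero one_neq_zero)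
    qed
  qed
qed

section \<open>Geometric points in terms of moduli\<close>

lemma bij_hits: "bij s \<Longrightarrow> \<exists>i. s i = j"
  by (metis bij_pointE)

lemma monomial3_id: "monomial3 1 2 3 1 1 1 = id"
proof -
  have "tri 1 2 1 1 1 = (\<lambda>_. 1 :: complex)" by (simp add: fun_eq_123)
  then show ?thesis using monomial_map_id by (simp add: id_tri)
qed

lemma vertices_iff:
  assumes "n \<ge> 2" "v \<noteq> 0" "proj v \<in> fermat_curve n"
  shows "proj v \<in> vertices n \<longleftrightarrow> (\<exists>i. v $ i = 0)"
proof
  have n: "n > 0" using assms(1) by simp
  assume "proj v \<in> vertices n"
  then obtain h q where h: "proj v = h q" "h \<in> rot_group n" "q \<in> fermat_curve n"
       "rot_stabilizer n q = generate (BijGroup UNIV) {proj_map (mat_C n)}"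
    by (auto simp: vertices_def points_with_rotation_eq[OF n])
  obtain w where w: "w \<noteq> 0" "q = proj w" using cp2_cases by blast
  have "proj_map (mat_C n) q = q"
    using generate_singleton_closed(1)[OF rot_group_closed(7), of n] h(4) by (auto simp: rot_stabilizer_def)
  then obtain c where c: "c \<noteq> 0" "\<And>i. tri 1 2 1 1 (inverse (lam n)) i * w $ tri 1 2 3 2 1 i = c * w $ i"
    using w by (auto simp: proj_map_mat_C monomial_map_fixes_iff)
  \<comment> \<open>A fixed point of \<open>C\<close> with nonzero middle coordinate has eigenvalue
    1. Since \<open>lam n\<close> differs from 1, the outer coordinates then vanish, and [0:1:0] is
    not on the curve.\<close>
  have "w $ 2 = 0"
  proof (rule ccontr)
    assume w2: "w $ 2 \<noteq> 0"
    then have "c = 1" using c(2)[of 2] by simp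
    then have w13: "w $ 3 = w $ 1" "inverse (lam n) * w $ 1 = w $ 3" using c(2)[of 1] c(2)[of 3] by auto
    then have "w $ 1 = lam n * w $ 1" by (simp add: field_simps)
    then have "w $ 1 = 0" using lam_neq_1[OF assms(1)] by (metis mult_cancel_right1)
    then show False using h(3) w w2 w13 n by (simp add: proj_mem_fermat_iff sum_3 zero_power)
  qed
  obtain s r where s: "bij s" "r > 0" "\<And>i. cmod (v $ i) = r * cmod (w $ s i)"
    using rot_group_norms[OF n h(2) assms(2) w(1) h(1)[unfolded w(2)]] by blast
  obtain i where "s i = 2" using bij_hits[OF s(1), of 2] by blast
  then show "\<exists>i. v $ i = 0" using s(3)[of i] \<open>w $ 2 = 0\<close> by auto
next
  have n: "n > 0" using assms(1) by simp
  assume "\<exists>i. v $ i = 0"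
  then obtain i where i: "v $ i = 0" by blast
  obtain j k where ijk: "distinct [i, j, k]" using other_indices by blast
  let ?w = "tvec 1 2 1 0 (cis (- pi / n))"
  have w: "?w \<noteq> 0" by (simp add: tvec_eq_0_iff[OF distinct_123])
  have nu: "cis (- pi / n) ^ n = -1" using n by (simp add: Complex.DeMoivre) (simp flip: cis_inverse)
  have sum: "(v $ j) ^ n + (v $ k) ^ n = 0"
    using assms i n by (simp add: proj_mem_fermat_iff sum_distinct3[OF ijk] zero_power)
  have vj: "v $ j \<noteq> 0"
    using assms(2) sum i n unfolding vec_eq_iff all_distinct3[OF ijk] by (auto simp: zero_power)
  have vk: "(v $ k) ^ n = - ((v $ j) ^ n)" using sum by (simp add: eq_neg_iff_add_eq_0 add.commute)
  let ?s = "tri i j 2 1 (3::3)"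
  have P: "\<forall>m. (v $ m) ^ n = (v $ j) ^ n * (?w $ ?s m) ^ n"
    unfolding all_distinct3[OF ijk] using ijk i vk n nu by (simp add: zero_power)
  have bs: "bij ?s" using ijk by (intro bij_tri[OF ijk]) simp
  have "(v $ j) ^ n  \<noteq> 0" using vj by simp
  then obtain h where h: "h \<in> rot_group n" "proj v = h (proj ?w)"
    using monomial_orbit[OF n assms(2) w bs _ P[rule_format]] by blast
  have "proj ?w \<in> fermat_curve n"
    using n nu by (subst proj_tvec_mem_fermat[OF distinct_123]) (auto simp: zero_power)
  then show "proj v \<in> vertices n"
    using h rot_stabilizer_vertex[OF assms(1)]
    unfolding vertices_def points_with_rotation_eq[OF n] by blast
qed

definition edge_norms :: "nat \<Rightarrow> complex ^ 3 \<Rightarrow> bool" where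
  "edge_norms n v \<longleftrightarrow> (\<exists>i j k. distinct [i, j, k] \<and> v $ i \<noteq> 0 \<and> cmod (v $ j) = cmod (v $ i) \<and>
     cmod (v $ k) ^ n = 2 * cmod (v $ i) ^ n)"

text \<open>Moduli suffice because the n-th powers sum to zero: if their lengths are 1, 1, 2, the
  triangle degenerates and the two short sides are equal as complex numbers. The n-th powers are
  then proportional to (1, 1, -2), which puts the point in the orbit of a fixed point of
  \<open>A\<close>.\<close>

lemma edge_centres_iff:
  assumes "n \<ge> 2" "v \<noteq> 0" "proj v \<in> fermat_curve n"
  shows "proj v \<in> edge_centres n \<longleftrightarrow> edge_norms n v"
proof
  have n: "n > 0" using assms(1) by simp
  let ?A = "proj_map (mat_A n)"
  assume "proj v \<in> edge_centres n"
  then obtain h q where h: "proj v = h q" "h \<in> rot_group n" "q \<in> fermat_curve n"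
       "rot_stabilizer n q = generate (BijGroup UNIV) {?A}"
    by (auto simp: edge_centres_def points_with_rotation_eq[OF n])
  obtain w where w: "w \<noteq> 0" "q = proj w" using cp2_cases by blast
  have "?A q = q"
    using generate_singleton_closed(1)[OF rot_group_closed(5), of n] h(4) by (auto simp: rot_stabilizer_def)
  then obtain c where c: "c \<noteq> 0"
      "\<And>i. tri 1 2 (lam n) (inverse (lam n)) 1 i * w $ tri 1 2 2 1 3 i = c * w $ i"
    using w by (auto simp: proj_map_mat_A monomial_map_fixes_iff)
  \<comment> \<open>For odd \<open>n\<close>, \<open>A\<close> also fixes a vertex with \<open>z = 0\<close>; its stabilizer contains a diagonal
    transformation outside \<open>\<langle>A\<rangle>\<close>.\<close>
  have w3: "w $ 3 \<noteq> 0"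
  proof
    assume w3: "w $ 3 = 0"
    have AA: "?A \<circ> ?A = id"
      using monomial3_id by (simp add: proj_map_mat_A monomial3_comp)
    then have invA: "inv_into UNIV ?A = ?A"
      by (simp add: inv_unique_comp)
    let ?D = "monomial_map id (tri 1 2 1 1 (lam n))"
    have "?D \<in> rot_stabilizer n q"
      using w w3 n lam_power[OF n]
      by (auto simp: rot_stabilizer_def tri_def forall_3 monomial_map_fixes_iff intro!: diagonal_mem_rot_group exI[of _ 1])
    then have "?D \<in> generate (BijGroup UNIV) {?A}" using h by simp
    then have "?D \<in> {id, ?A}"
    proof (rule generate_least[rotated 1])
      show "inv_into UNIV f \<in> {id, ?A}" if "f \<in> {id, ?A}" for f
        using that invA by auto
      show "f \<circ> g \<in> {id, ?A}" if "f \<in> {id, ?A}" "g \<in> {id, ?A}" for f g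
        using that AA by auto
    qed (auto simp: bij_mat)
    \<comment> \<open>The test points are [1:1:1], which \<open>?D\<close> moves, and [1:0:0], which
      \<open>?D\<close> fixes while \<open>A\<close> sends it to [0:1:0].\<close>
    then consider "?D = id" | "?D = ?A" by blast
    then show False
    proof cases
      case 1
      then have "?D (proj (tvec 1 2 1 1 1)) = proj (tvec 1 2 1 1 1)" by simp
      then show False using lam_neq_1[OF assms(1)]
        by (subst (asm) monomial_map_fixes_iff) (auto simp: forall_3 tvec_eq_0_iff[OF distinct_123])
    next
      case 2
      then have "?D (proj (tvec 1 2 1 0 0)) = ?A (proj (tvec 1 2 1 0 0))" by simp
      then show False unfolding proj_map_mat_A
        by (simp add: monomial_map_proj tvec_eq_0_iff[OF distinct_123], subst (asm) proj_eq_iff)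
          (auto simp: forall_3 vec_eq_iff)
    qed
  qed
  have "c = 1" using c(2)[of 3] w3 by simp
  then have w12: "lam n * w $ 2 = w $ 1" using c(2)[of 1] by simp
  have "(w $ 1) ^ n = (w $ 2) ^ n" using lam_power[OF n] by (simp flip: w12 add: power_mult_distrib)
  moreover have "(w $ 1) ^ n + (w $ 2) ^ n + (w $ 3) ^ n = 0"
    using h(3) w by (simp add: proj_mem_fermat_iff sum_3)
  ultimately have "(w $ 3) ^ n = - (2 * (w $ 1) ^ n)" by (simp add: eq_neg_iff_add_eq_0 add.commute)
  then have n3: "cmod (w $ 3) ^ n = 2 * cmod (w $ 1) ^ n" by (simp flip: norm_power add: norm_mult)
  have n12: "cmod (w $ 2) = cmod (w $ 1)" by (simp flip: w12 add: norm_mult)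
  have w1: "w $ 1 \<noteq> 0" using n3 w3 n by (auto simp: zero_power)
  obtain s r where s: "bij s" "r > 0" "\<And>i. cmod (v $ i) = r * cmod (w $ s i)"
    using rot_group_norms[OF n h(2) assms(2) w(1) h(1)[unfolded w(2)]] by blast
  obtain i where i: "s i = 1" using bij_hits[OF s(1), of 1] by blast
  obtain j where j: "s j = 2" using bij_hits[OF s(1), of 2] by blast
  obtain k where k: "s k = 3" using bij_hits[OF s(1), of 3] by blast
  from i j k have "distinct [i, j, k]" by auto
  moreover have "v $ i \<noteq> 0" using s(2) s(3)[of i] i w1 by auto
  ultimately show "edge_norms n v" unfolding edge_norms_def
    using s(3) i j k n12 n3 by (intro exI[of _ i] exI[of _ j] exI[of _ k]) (simp add: power_mult_distrib)
next
  have n: "n > 0" using assms(1) by simp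
  assume "edge_norms n v"
  then obtain i j k where ijk: "distinct [i, j, k]" and v: "v $ i \<noteq> 0" "cmod (v $ j) = cmod (v $ i)"
     "cmod (v $ k) ^ n = 2 * cmod (v $ i) ^ n" unfolding edge_norms_def by blast
  obtain c where c: "c ^ n = (-2 :: complex)" using exists_complex_root[OF n] by blast
  let ?w = "tvec 1 2 (lam n) 1 c"
  have w: "?w \<noteq> 0" by (simp add: tvec_eq_0_iff[OF distinct_123])
  have sum: "(v $ i) ^ n + (v $ j) ^ n + (v $ k) ^ n = 0"
    using assms by (simp add: proj_mem_fermat_iff sum_distinct3[OF ijk])
  define a where "a = (v $ j) ^ n / (v $ i) ^ n"
  have na: "cmod a = 1" using v by (simp add: a_def norm_divide norm_power)
  have "1 + a = - ((v $ k) ^ n / (v $ i) ^ n)"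
    using v(1) sum by (simp add: a_def field_simps eq_neg_iff_add_eq_0)
  then have "cmod (1 + a) = 2" using v by (simp add: norm_divide norm_power)
  then have "a = 1"
  proof -
    have *: "(Re a)\<^sup>2 + (Im a)\<^sup>2 = 1" using na by (simp add: cmod_def)
    have "sqrt ((1 + Re a)\<^sup>2 + (Im a)\<^sup>2) = sqrt 4"
      using \<open>cmod (1 + a) = 2\<close> by (simp add: cmod_def)
    then have "(1 + Re a)\<^sup>2 + (Im a)\<^sup>2 = 4" by (simp only: real_sqrt_eq_iff)
    with * have "Re a = 1" by (simp add: power2_eq_square algebra_simps)
    with * show ?thesis by (simp add: complex_eq_iff)
  qed
  then have vj: "(v $ j) ^ n = (v $ i) ^ n" using v by (simp add: a_def)
  then have vk: "(v $ k) ^ n = - 2 * (v $ i) ^ n" using sum by (simp add: eq_neg_iff_add_eq_0 add.commute)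
  let ?s = "tri i j 1 2 (3::3)"
  have P: "\<forall>m. (v $ m) ^ n = (v $ i) ^ n * (?w $ ?s m) ^ n"
    unfolding all_distinct3[OF ijk] using ijk vj vk lam_power[OF n] c by simp
  have bs: "bij ?s" using ijk by (intro bij_tri[OF ijk]) simp
  have "(v $ i) ^ n  \<noteq> 0" using v(1) by simp
  then obtain h where h: "h \<in> rot_group n" "proj v = h (proj ?w)"
    using monomial_orbit[OF n assms(2) w bs _ P[rule_format]] by blast
  have "proj ?w \<in> fermat_curve n"
    using lam_power[OF n] c by (subst proj_tvec_mem_fermat[OF distinct_123]) auto
  then show "proj v \<in> edge_centres n"
    using h rot_stabilizer_edge_centre[OF assms(1) c]
    unfolding edge_centres_def points_with_rotation_eq[OF n] by blast
qed

lemma unit_sum_zero: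
  assumes "1 + a + b = 0" "cmod a = 1" "cmod b = 1"
  shows "a = cis (2 * pi / 3) \<and> b = cnj (cis (2 * pi / 3)) \<or> a = cnj (cis (2 * pi / 3)) \<and> b = cis (2 * pi / 3)"
proof -
  have b: "Re b = - 1 - Re a" "Im b = - Im a" using assms(1) by (auto simp: complex_eq_iff)
  have ab: "(Re a)\<^sup>2 + (Im a)\<^sup>2 = 1" "(Re b)\<^sup>2 + (Im b)\<^sup>2 = 1" using assms by (auto simp: cmod_def)
  then have re: "Re a = - 1/2" using b by (simp add: power2_eq_square algebra_simps)
  then have "(Im a)\<^sup>2 = (sqrt 3 / 2)\<^sup>2" using ab by (simp add: power2_eq_square)
  then have "Im a = sqrt 3 / 2 \<or> Im a = - (sqrt 3 / 2)" by (simp only: power2_eq_iff)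
  then show ?thesis using re b unfolding cis_120 by (auto simp: complex_eq_iff)
qed

text \<open>For a fixed point of \<open>B\<close> the moduli are multiplied cyclically by the
  modulus of the eigenvalue, whose cube must be 1. Conversely three numbers of equal modulus with
  sum zero form an equilateral triangle; its two orientations correspond to the two permutations
  used to reach the standard point.\<close>

lemma face_centres_iff:
  assumes "n \<ge> 2" "v \<noteq> 0" "proj v \<in> fermat_curve n"
  shows "proj v \<in> face_centres n \<longleftrightarrow> (\<forall>i j. cmod (v $ i) = cmod (v $ j))"
proof
  have n: "n > 0" using assms(1) by simp
  assume "proj v \<in> face_centres n"
  then obtain h q where h: "proj v = h q" "h \<in> rot_group n" "q \<in> fermat_curve n"
       "rot_stabilizer n q = generate (BijGroup UNIV) {proj_map (mat_B n)}"
    by (auto simp: face_centres_def points_with_rotation_eq[OF n])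
  obtain w where w: "w \<noteq> 0" "q = proj w" using cp2_cases by blast
  have "proj_map (mat_B n) q = q"
    using generate_singleton_closed(1)[OF rot_group_closed(6), of n] h(4) by (auto simp: rot_stabilizer_def)
  then obtain c where c: "c \<noteq> 0" "\<And>i. tri 1 2 (lam n) 1 1 i * w $ tri 1 2 2 3 1 i = c * w $ i"
    using w by (auto simp: proj_map_mat_B monomial_map_fixes_iff)
  have e: "cmod (w $ 2) = cmod c * cmod (w $ 1)" "cmod (w $ 3) = cmod c * cmod (w $ 2)"
      "cmod (w $ 1) = cmod c * cmod (w $ 3)"
    using arg_cong[OF c(2)[of 1], of cmod] arg_cong[OF c(2)[of 2], of cmod]
      arg_cong[OF c(2)[of 3], of cmod] by (simp_all add: norm_mult)
  have "w $ 1 \<noteq> 0" using e c(1) w(1) by (auto simp: vec_eq_iff forall_3)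
  moreover have "cmod (w $ 1) = cmod c ^ 3 * cmod (w $ 1)"
    by (subst e(3), subst e(2), subst e(1)) (simp add: power3_eq_cube)
  ultimately have "cmod c ^ 3 = 1" by simp
  then have "cmod c = 1" using power_eq_iff_eq_base[of 3 "cmod c" 1] by simp
  then have "\<forall>i j. cmod (w $ i) = cmod (w $ j)" using e by (simp add: forall_3)
  moreover obtain s r where s: "bij s" "r > 0" "\<And>i. cmod (v $ i) = r * cmod (w $ s i)"
    using rot_group_norms[OF n h(2) assms(2) w(1) h(1)[unfolded w(2)]] by blast
  ultimately show "\<forall>i j. cmod (v $ i) = cmod (v $ j)" by auto
next
  have n: "n > 0" using assms(1) by simp
  assume v: "\<forall>i j. cmod (v $ i) = cmod (v $ j)"
  then have v1: "v $ i \<noteq> 0" for i using assms(2) by (metis norm_eq_zero vec_eq_iff zero_index)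
  let ?w = "tvec 1 2 1 (cis (- 4 * pi / (3 * n))) (cis (- 2 * pi / (3 * n)))"
  have w: "?w \<noteq> 0" by (simp add: tvec_eq_0_iff[OF distinct_123])
  note p = rot_stabilizer_face_centre(2,3)[OF assms(1)]
  let ?X = "(v $ 1) ^ n"
  have "(v $ 1) ^ n + (v $ 2) ^ n + (v $ 3) ^ n = 0"
    using assms by (simp add: proj_mem_fermat_iff sum_3)
  then have "1 + (v $ 2) ^ n / ?X + (v $ 3) ^ n / ?X = 0" using v1[of 1] by (simp add: field_simps)
  moreover have "cmod ((v $ i) ^ n / ?X) = 1" for i 
    using v1[of 1] v by (simp add: norm_divide norm_power) (metis norm_eq_zero right_inverse power_not_zero divide_inverse)
  ultimately consider 
      "(v $ 2) ^ n / ?X = cis (2 * pi / 3)" "(v $ 3) ^ n / ?X = cnj (cis (2 * pi / 3))"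
    | "(v $ 2) ^ n / ?X = cnj (cis (2 * pi / 3))" "(v $ 3) ^ n / ?X = cis (2 * pi / 3)"
    using unit_sum_zero by blast
  then obtain s where s: "bij s" "\<forall>m. (v $ m) ^ n = ?X * (?w $ s m) ^ n"
  proof cases
    case 1
    show ?thesis
      by (rule that[of "tri 1 2 1 2 3"]) (use 1 p v1[of 1] in \<open>auto simp: forall_3 field_simps\<close>)
  next
    case 2
    show ?thesis
      by (rule that[of "tri 1 2 1 3 2"]) (use 2 p v1[of 1] in \<open>auto simp: forall_3 field_simps\<close>)
  qed
  have "?X \<noteq> 0" using v1 by simp
  then obtain h where h: "h \<in> rot_group n" "proj v = h (proj ?w)"
    using monomial_orbit[OF n assms(2) w s(1) _ s(2)[rule_format]] by blast
  have "proj ?w \<in> fermat_curve n"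
    by (subst proj_tvec_mem_fermat[OF distinct_123], simp, subst p, subst p) (simp add: cis_120 complex_eq_iff)
  then show "proj v \<in> face_centres n"
    using h rot_stabilizer_face_centre(1)[OF assms(1)]
    unfolding face_centres_def points_with_rotation_eq[OF n] by blast
qed

lemma continuous_on_tvec:
  assumes "continuous_on A x" "continuous_on A y" "continuous_on A z"
  shows "continuous_on A (\<lambda>s. tvec i j (x s) (y s) (z s))"
proof (rule continuous_on_vec_lambda)
  show "continuous_on A (\<lambda>s. tri i j (x s) (y s) (z s) m)" for m
    using assms by (cases "m = i"; cases "m = j") (simp_all add: tri_def)
qed

text \<open>A phase takes finitely many values on the part of the graph without vertices, so it is constant on
  edges; on a vertex it recovers the ratio of the two nonzero coordinates.\<close>

definition phase :: "3 \<Rightarrow> 3 \<Rightarrow> cp2 \<Rightarrow> complex" where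
  "phase j k p = sgn (hcoords p $ j / hcoords p $ k)"

lemma phase_proj:
  assumes "v \<noteq> 0" shows "phase j k (proj v) = sgn (v $ j / v $ k)"
proof -
  obtain c where c: "c \<noteq> 0" "\<And>i. hcoords (proj v) $ i = c * v $ i"
    using hcoords_proj[OF assms] by blast
  then show ?thesis by (simp add: phase_def)
qed

lemma open_nonzero_coords: "open {p. hcoords p $ j \<noteq> 0 \<and> hcoords p $ k \<noteq> 0}"
    and nonzero_coords_proj: "v \<noteq> 0 \<Longrightarrow>
      proj v \<in> {p. hcoords p $ j \<noteq> 0 \<and> hcoords p $ k \<noteq> 0} \<longleftrightarrow> v $ j \<noteq> 0 \<and> v $ k \<noteq> 0"
proof -
  show *: "proj v \<in> {p. hcoords p $ j \<noteq> 0 \<and> hcoords p $ k \<noteq> 0} \<longleftrightarrow> v $ j \<noteq> 0 \<and> v $ k \<noteq> 0" if v: "v \<noteq> 0" for v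
  proof -
    obtain c where c: "c \<noteq> 0" "\<And>i. hcoords (proj v) $ i = c * v $ i"
      using hcoords_proj[OF v] by blast
    then show ?thesis by simp
  qed
  have "v \<noteq> 0 \<and> proj v \<in> {p. hcoords p $ j \<noteq> 0 \<and> hcoords p $ k \<noteq> 0} \<longleftrightarrow> v $ j \<noteq> 0 \<and> v $ k \<noteq> 0" for v
    using *[of v] by (cases "v = 0") simp_all
  then have "{v. v \<noteq> 0 \<and> proj v \<in> {p. hcoords p $ j \<noteq> 0 \<and> hcoords p $ k \<noteq> 0}} =
      {v. v $ j \<noteq> 0 \<and> v $ k \<noteq> 0}"
    by (intro Collect_cong)
  moreover have "open {v :: complex ^ 3. v $ m \<noteq> 0}" for m
    by (intro open_Collect_neq continuous_intros)
  ultimately show "open {p. hcoords p $ j \<noteq> 0 \<and> hcoords p $ k \<noteq> 0}"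
    unfolding open_cp2_def by (simp only: open_Collect_conj)
qed

lemma continuous_on_phase:
  "continuous_on {p. hcoords p $ j \<noteq> 0 \<and> hcoords p $ k \<noteq> 0} (phase j k)"
proof (rule continuous_on_cp2I[OF open_nonzero_coords])
  let ?S = "{v. v \<noteq> 0 \<and> proj v \<in> {p. hcoords p $ j \<noteq> 0 \<and> hcoords p $ k \<noteq> 0}}"
  have "continuous_on ?S (\<lambda>v. sgn (v $ j / v $ k))"
    by (intro continuous_intros) (use nonzero_coords_proj in auto)
  then show "continuous_on ?S (\<lambda>v. phase j k (proj v))"
    by (rule continuous_on_eq) (auto simp: phase_proj)
qed

subsection \<open>Reflections of the map\<close>

lemma antiprojective_proj:
  assumes "invertible M" "v \<noteq> 0"
  shows "(proj_map M \<circ> proj_cnj) (proj v) = proj (M *v (\<chi> i. cnj (v $ i)))"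
    and "M *v (\<chi> i. cnj (v $ i)) \<noteq> 0"
proof -
  have v: "(\<chi> i. cnj (v $ i)) \<noteq> 0" using assms(2) by (simp add: vec_eq_iff)
  then show "(proj_map M \<circ> proj_cnj) (proj v) = proj (M *v (\<chi> i. cnj (v $ i)))"
    using assms by (simp add: proj_cnj_proj proj_map_proj)
  show "M *v (\<chi> i. cnj (v $ i)) \<noteq> 0"
    using assms(1) v by (metis invertible_def matrix_left_invertible_ker)
qed

lemma continuous_on_antiprojective:
  assumes "invertible M"
  shows "continuous_on UNIV (proj_map M \<circ> proj_cnj)"
proof (rule continuous_on_cp2I)
  have "continuous_on {v. v \<noteq> 0} (\<lambda>v. proj (M *v (\<chi> i. cnj (v $ i))))"
  proof (rule continuous_on_proj)
    show "continuous_on {v. v \<noteq> 0} (\<lambda>v. M *v (\<chi> i. cnj (v $ i)))"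
      unfolding matrix_vector_mult_def by (auto intro!: continuous_intros continuous_on_vec_lambda)
  qed (use antiprojective_proj(2)[OF assms] in auto)
  then show "continuous_on {v. v \<noteq> 0 \<and> proj v \<in> UNIV} (\<lambda>v. (proj_map M \<circ> proj_cnj) (proj v))"
    by (rule continuous_on_eq[OF continuous_on_subset]) (auto simp: antiprojective_proj[OF assms] simp del: o_apply)
qed simp

lemma proj_mem_map_graph_iff:
  assumes "v \<noteq> 0"
  shows "proj v \<in> map_graph n \<longleftrightarrow> proj v \<in> fermat_curve n \<and> (\<exists>c. c \<noteq> 0 \<and> (\<forall>i. c * (v $ i) ^ n \<in> \<real>))"
proof -
  obtain c where c: "c \<noteq> 0" "\<And>i. hcoords (proj v) $ i = c * v $ i"
    using hcoords_proj[OF assms] by blast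
  have "(\<exists>k. k \<noteq> 0 \<and> (\<forall>i. k * (c * v $ i) ^ n \<in> \<real>)) \<longleftrightarrow> (\<exists>k. k \<noteq> 0 \<and> (\<forall>i. k * (v $ i) ^ n \<in> \<real>))"
  proof (intro iffI; elim exE conjE)
    fix k assume "k \<noteq> 0" "\<forall>i. k * (c * v $ i) ^ n \<in> \<real>"
    then show "\<exists>k. k \<noteq> 0 \<and> (\<forall>i. k * (v $ i) ^ n \<in> \<real>)"
      using c by (intro exI[of _ "k * c ^ n"]) (simp add: power_mult_distrib mult.assoc)
  next
    fix k assume "k \<noteq> 0" "\<forall>i. k * (v $ i) ^ n \<in> \<real>"
    then show "\<exists>k. k \<noteq> 0 \<and> (\<forall>i. k * (c * v $ i) ^ n \<in> \<real>)"
      using c by (intro exI[of _ "k / c ^ n"]) (simp add: power_mult_distrib)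
  qed
  then show ?thesis unfolding map_graph_def using c(2) by simp
qed

section \<open>Edges and the vertices in their closures\<close>

lemma vertex_coords:
  assumes "n > 0" "distinct [i, j, k]" "v \<noteq> 0" "proj v \<in> fermat_curve n" "v $ i = 0"
  shows "v $ j \<noteq> 0" "v $ k \<noteq> 0" "(v $ j) ^ n = - ((v $ k) ^ n)" "cmod (v $ j) = cmod (v $ k)"
proof -
  have sum: "(v $ j) ^ n + (v $ k) ^ n = 0"
    using assms by (simp add: proj_mem_fermat_iff sum_distinct3[OF assms(2)] zero_power)
  then show eq: "(v $ j) ^ n = - ((v $ k) ^ n)" by (simp add: eq_neg_iff_add_eq_0)
  show "v $ j \<noteq> 0" "v $ k \<noteq> 0"
    using assms(1,3,5) sum unfolding vec_eq_iff all_distinct3[OF assms(2)] by (auto simp: zero_power)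
  have "cmod (v $ j) ^ n = cmod (v $ k) ^ n" using eq by (metis norm_minus_cancel norm_power)
  then show "cmod (v $ j) = cmod (v $ k)" using assms(1) by (simp add: power_eq_iff_eq_base)
qed

text \<open>The arc lies over the real segment with n-th powers (-s, s - 1, 1) of the line X + Y + Z
  = 0. Its phases are those of the nonzero coordinate ratios of the two vertices, so it starts at
  \<open>proj v\<close> for s = 0 and ends at \<open>proj w\<close> for s = 1. Its interior avoids
  the vertices and hence lies in one edge.\<close>

lemma edge_joining_vertices:
  assumes "n \<ge> 2" "v \<noteq> 0" "w \<noteq> 0" "proj v \<in> fermat_curve n" "proj w \<in> fermat_curve n"
    "v $ j = 0" "w $ k = 0" "j \<noteq> k"
  shows "\<exists>e\<in>edges n. proj v \<in> closure e \<and> proj w \<in> closure e"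
proof -
  have n: "n > 0" using assms(1) by simp
  obtain i where jki: "distinct [j, k, i]" using third_index[OF assms(8)] by blast
  then have kji: "distinct [k, j, i]" by auto
  note v = vertex_coords[OF n jki assms(2,4,6)]
  note w = vertex_coords[OF n kji assms(3,5,7)]
  define a b where "a = v $ k / v $ i" and "b = w $ j / w $ i"
  have ab: "a ^ n = -1" "b ^ n = -1" "a \<noteq> 0" "b \<noteq> 0"
    using v w by (simp_all add: a_def b_def power_divide)
  define c where "c s = tvec j k (b * of_real (root n s)) (a * of_real (root n (1 - s))) 1" for s
  have c0: "c s \<noteq> 0" for s by (simp add: c_def tvec_eq_0_iff[OF jki])
  have cont: "continuous_on A c" for A
    unfolding c_def by (intro continuous_on_tvec continuous_intros)
  have contp: "continuous_on A (\<lambda>s. proj (c s))" for A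
    by (intro continuous_on_proj cont c0)
  let ?T = "(\<lambda>s. proj (c s)) ` {0<..<1}"
  have "?T \<subseteq> map_graph n - vertices n"
  proof safe
    fix s :: real assume s: "s \<in> {0<..<1}"
    have rt: "complex_of_real (root n s) ^ n = of_real s" "complex_of_real (root n (1 - s)) ^ n = of_real (1 - s)"
      using s n by (simp_all flip: of_real_power)
    have F: "proj (c s) \<in> fermat_curve n"
      unfolding c_def by (subst proj_tvec_mem_fermat[OF jki]) (auto simp: power_mult_distrib rt ab)
    have "\<forall>m. 1 * (c s $ m) ^ n \<in> \<real>"
      unfolding all_distinct3[OF jki] using jki by (simp add: c_def power_mult_distrib rt ab)
    then show "proj (c s) \<in> map_graph n"
      unfolding proj_mem_map_graph_iff[OF c0] using F by (intro conjI exI[of _ 1]) simp_all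
    have "\<forall>m. c s $ m \<noteq> 0"
      unfolding all_distinct3[OF jki] using jki s n ab by (simp add: c_def)
    then show False if "proj (c s) \<in> vertices n"
      using that vertices_iff[OF assms(1) c0 F] by blast
  qed
  moreover have "connected ?T"
    by (rule connected_continuous_image[OF contp]) simp
  moreover have "?T \<noteq> {}" by simp
  ultimately obtain e where e: "e \<in> edges n" "?T \<subseteq> e"
    unfolding edges_def using exists_component_superset[of ?T "map_graph n - vertices n"] by blast
  have "(\<lambda>s. proj (c s)) ` closure {0<..<1} \<subseteq> closure e"
    using e(2) closure_subset by (intro image_closure_subset contp) auto
  then have "proj (c 0) \<in> closure e" "proj (c 1) \<in> closure e" by auto
  moreover have "proj v = proj (c 0)"
    unfolding proj_eq_iff[OF assms(2) c0] all_distinct3[OF jki]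
    by (intro exI[of _ "v $ i"]) (use v jki n assms(6,7) in \<open>simp add: c_def a_def\<close>)
  moreover have "proj w = proj (c 1)"
    unfolding proj_eq_iff[OF assms(3) c0] all_distinct3[OF jki]
    by (intro exI[of _ "w $ i"]) (use w jki n assms(6,7) in \<open>simp add: c_def b_def\<close>)
  ultimately show ?thesis using e(1) by auto
qed

lemma edge_closure_vertex_unique:
  assumes "n \<ge> 2" "v \<noteq> 0" "w \<noteq> 0" "proj v \<in> fermat_curve n" "proj w \<in> fermat_curve n"
    "v $ i = 0" "w $ i = 0" "e \<in> edges n" "proj v \<in> closure e" "proj w \<in> closure e"
  shows "proj v = proj w"
proof -
  have n: "n > 0" using assms(1) by simp
  obtain j k where ijk: "distinct [i, j, k]" using other_indices by blast
  note v = vertex_coords[OF n ijk assms(2,4,6)]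
  note w = vertex_coords[OF n ijk assms(3,5,7)]
  let ?U = "{p. hcoords p $ j \<noteq> 0 \<and> hcoords p $ k \<noteq> 0}"
  have e: "e \<subseteq> map_graph n - vertices n" "connected e" "e \<noteq> {}"
    using assms(8) unfolding edges_def
    by (auto dest: in_components_subset in_components_connected in_components_nonempty)
  have eU: "e \<subseteq> ?U \<and> phase j k ` e \<subseteq> {z. z ^ (2 * n) = 1}"
  proof -
    have "p \<in> ?U \<and> phase j k p ^ (2 * n) = 1" if "p \<in> e" for p
    proof -
      obtain u where u: "u \<noteq> 0" "p = proj u" using cp2_cases by blast
      have p: "p \<in> map_graph n" "p \<notin> vertices n" using that e by auto
      then have F: "proj u \<in> fermat_curve n" using u by (auto simp: map_graph_def)
      then have nz: "u $ m \<noteq> 0" for m using p u vertices_iff[OF assms(1) u(1)] by auto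
      obtain c where c: "c \<noteq> 0" "\<And>m. c * (u $ m) ^ n \<in> \<real>"
        using p u proj_mem_map_graph_iff by blast
      have "(u $ j / u $ k) ^ n = (c * (u $ j) ^ n) / (c * (u $ k) ^ n)" using c by (simp add: power_divide)
      also have "\<dots> \<in> \<real>" using c by (intro Reals_divide) auto
      finally obtain x where x: "(u $ j / u $ k) ^ n = of_real x" by (auto elim: Reals_cases)
      have "x \<noteq> 0" using x nz[of j] nz[of k] by auto
      \<comment> \<open>On the graph the n-th power of the ratio is real and nonzero, so its sign is
        1 or -1; squaring explains the exponent \<open>2 * n\<close>.\<close>
      have "phase j k p ^ (2 * n) = (sgn ((u $ j / u $ k) ^ n)) ^ 2"
        using u by (simp add: phase_proj power_mult power_mult_distrib mult.commute[of 2] sgn_eq norm_power power_divide norm_divide)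
      also have "\<dots> = 1" unfolding x using \<open>x \<noteq> 0\<close> by (simp add: sgn_of_real sgn_if)
      finally show ?thesis using nz u nonzero_coords_proj[OF u(1)] by blast
    qed
    then show ?thesis by auto
  qed
  have "finite {z :: complex. z ^ (2 * n) = 1}" using n by (intro finite_roots_unity) simp
  then have fin: "finite (phase j k ` e)" using eU finite_subset by blast
  have "connected (phase j k ` e)"
    using eU by (intro connected_continuous_image continuous_on_subset[OF continuous_on_phase] e) auto
  then have "phase j k ` e = {} \<or> (\<exists>a. phase j k ` e = {a})"
    using connected_finite_iff_sing[of "phase j k ` e"] fin by blast
  then obtain a where a: "phase j k ` e = {a}"
    using e(3) by blast
  \<comment> \<open>Constancy passes to those limit points where the phase is defined. Both vertices
    are such points, as their only zero coordinate is the one with index \<open>i\<close>.\<close>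
  have cl: "phase j k p = a" if "p \<in> closure e" "p \<in> ?U" for p
  proof (rule ccontr)
    assume "phase j k p \<noteq> a"
    have "open (phase j k -` (- {a}) \<inter> ?U)"
      using continuous_on_phase unfolding continuous_on_open_vimage[OF open_nonzero_coords] by blast
    moreover have "phase j k -` (- {a}) \<inter> ?U \<inter> e = {}" using a by auto
    ultimately have "phase j k -` (- {a}) \<inter> ?U \<inter> closure e = {}"
      by (simp add: open_Int_closure_eq_empty)
    then show False using that \<open>phase j k p \<noteq> a\<close> by auto
  qed
  have "sgn (v $ j / v $ k) = a" "sgn (w $ j / w $ k) = a"
    using cl[OF assms(9)] cl[OF assms(10)] nonzero_coords_proj[OF assms(2), of j k] nonzero_coords_proj[OF assms(3), of j k] v w
    by (simp_all add: phase_proj assms(2,3))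
  then have "v $ j / v $ k = w $ j / w $ k"
    using v w by (simp add: sgn_eq norm_divide)
  then show ?thesis
    unfolding proj_eq_iff[OF assms(2,3)] all_distinct3[OF ijk]
    by (intro exI[of _ "v $ k / w $ k"]) (use v w assms(6,7) in \<open>simp add: field_simps\<close>)
qed

section \<open>Antiprojective maps that preserve the map are monomial\<close>

lemma vertex_vec:
  assumes "n \<ge> 2" "distinct [i, j, k]" "z ^ n = -1"
  shows "proj (tvec i j 0 1 z) \<in> fermat_curve n" "proj (tvec i j 0 1 z) \<in> vertices n"
    "tvec i j 0 1 z \<noteq> 0"
proof -
  show F: "proj (tvec i j 0 1 z) \<in> fermat_curve n"
    using assms by (subst proj_tvec_mem_fermat[OF assms(2)]) (auto simp: zero_power)
  show v: "tvec i j 0 1 z \<noteq> 0" by (simp add: tvec_eq_0_iff[OF assms(2)])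
  have "tvec i j 0 1 z $ i = 0" by simp
  then show "proj (tvec i j 0 1 z) \<in> vertices n"
    using vertices_iff[OF assms(1) v F] by blast
qed

lemma cis_pi_div_power: "n > 0 \<Longrightarrow> cis (pi / n) ^ n = - 1"
  by (simp add: Complex.DeMoivre)

text \<open>Let P and Q be two vertices with vanishing i-th coordinate. If their preimages lay on
  different coordinate lines, some edge would have both in its closure, and by continuity its image
  would be an edge with both P and Q in its closure, which forces P = Q. So the preimages share a
  zero coordinate \<open>a\<close>. Row \<open>i\<close> annihilates their conjugates, which are
  independent in the other two coordinates, so its entries there vanish.\<close>

lemma matrix_row_single:
  assumes n: "n \<ge> 2" and M: "invertible M" and pres: "preserves_map n (proj_map M \<circ> proj_cnj)"
  shows "\<exists>a. \<forall>m. m \<noteq> a \<longrightarrow> M $ i $ m = 0"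
proof -
  define f where "f = proj_map M \<circ> proj_cnj"
  note pres = pres[folded f_def] and anti = antiprojective_proj[OF M, folded f_def]
  have n0: "n > 0" using n by simp
  obtain j k where ijk: "distinct [i, j, k]" using other_indices by blast
  have z1: "cis (pi / n) ^ n = -1" using cis_pi_div_power[OF n0] .
  \<comment> \<open>Multiplication by \<open>lam n\<close>, which is not 1, yields a second vertex
    on the same coordinate line.\<close>
  have z2: "(lam n * cis (pi / n)) ^ n = -1" using z1 lam_power[OF n0] by (simp add: power_mult_distrib)
  let ?P = "tvec i j 0 1 (cis (pi / n))" and ?Q = "tvec i j 0 1 (lam n * cis (pi / n))"
  note P = vertex_vec[OF n ijk z1] and Q = vertex_vec[OF n ijk z2]
  have PQ: "proj ?P \<noteq> proj ?Q"
    unfolding proj_eq_iff[OF P(3) Q(3)] all_distinct3[OF ijk] using ijk lam_neq_1[OF n] by auto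
  have V: "f ` vertices n = vertices n" and EE: "(`) f ` edges n = edges n"
    using pres by (simp_all add: preserves_map_def)
  have E: "f ` e \<in> edges n" if "e \<in> edges n" for e
    using that by (subst EE[symmetric]) (rule imageI)
  have "proj ?P \<in> f ` vertices n" "proj ?Q \<in> f ` vertices n" by (simp_all only: V P(2) Q(2))
  then obtain p q where p: "p \<in> vertices n" "f p = proj ?P" and q: "q \<in> vertices n" "f q = proj ?Q"
    by (elim imageE) metis
  obtain v where v: "v \<noteq> 0" "p = proj v" using cp2_cases by blast
  obtain w where w: "w \<noteq> 0" "q = proj w" using cp2_cases by blast
  have F: "proj v \<in> fermat_curve n" "proj w \<in> fermat_curve n"
    using p(1) q(1) v w by (auto simp: vertices_def points_with_rotation_def)
  obtain a where a: "v $ a = 0" using p(1) v vertices_iff[OF n v(1) F(1)] by auto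
  obtain a' where a': "w $ a' = 0" using q(1) w vertices_iff[OF n w(1) F(2)] by auto
  have "a = a'"
  proof (rule ccontr)
    assume "a \<noteq> a'"
    then obtain e where e: "e \<in> edges n" "p \<in> closure e" "q \<in> closure e"
      using edge_joining_vertices[OF n v(1) w(1) F a a'] v(2) w(2) by blast
    have "f ` closure e \<subseteq> closure (f ` e)"
      by (intro image_closure_subset continuous_on_subset[OF continuous_on_antiprojective[OF M, folded f_def]])
        (auto simp: closure_subset)
    then have "proj ?P \<in> closure (f ` e)" "proj ?Q \<in> closure (f ` e)"
      using e p q by (metis imageI subsetD)+
    then have "proj ?P = proj ?Q"
      using edge_closure_vertex_unique[OF n P(3) Q(3) P(1) Q(1), of i] E[OF e(1)] by simp
    then show False using PQ by simp
  qed
  obtain b c where abc: "distinct [a, b, c]" using other_indices by blast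
  have row: "M $ i $ b * cnj (u $ b) + M $ i $ c * cnj (u $ c) = 0"
    if u: "u \<noteq> 0" "u $ a = 0" "f (proj u) = proj (tvec i j 0 1 z)" for u z
  proof -
    have "proj (M *v (\<chi> i. cnj (u $ i))) = proj (tvec i j 0 1 z)"
      using u(1,3) anti(1)[OF u(1)] by simp
    moreover have "tvec i j 0 1 z \<noteq> 0" by (simp add: tvec_eq_0_iff[OF ijk])
    ultimately obtain r where "\<And>m. (M *v (\<chi> i. cnj (u $ i))) $ m = r * tvec i j 0 1 z $ m"
      using proj_eq_iff[OF anti(2)[OF u(1)]] by blast
    from this[of i] show ?thesis
      using u(2) by (simp add: matrix_vector_mult_def sum_distinct3[OF abc])
  qed
  have r1: "M $ i $ b * cnj (v $ b) + M $ i $ c * cnj (v $ c) = 0"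
    by (rule row[OF v(1) a p(2)[unfolded v(2)]])
  have wa: "w $ a = 0" using a' \<open>a = a'\<close> by simp
  have r2: "M $ i $ b * cnj (w $ b) + M $ i $ c * cnj (w $ c) = 0"
    by (rule row[OF w(1) wa q(2)[unfolded w(2)]])
  note v' = vertex_coords[OF n0 abc v(1) F(1) a]
  note w' = vertex_coords[OF n0 abc w(1) F(2) wa]
  have "v $ b * w $ c \<noteq> v $ c * w $ b"
  proof
    assume "v $ b * w $ c = v $ c * w $ b"
    then have "proj v = proj w"
      unfolding proj_eq_iff[OF v(1) w(1)] all_distinct3[OF abc]
      by (intro exI[of _ "v $ c / w $ c"]) (use v' w' a wa in \<open>simp add: field_simps\<close>)
    then show False using p q v w PQ by simp
  qed
  then have D: "cnj (v $ b) * cnj (w $ c) - cnj (v $ c) * cnj (w $ b) \<noteq> 0"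
    by (metis complex_cnj_cancel_iff complex_cnj_mult right_minus_eq)
  have "M $ i $ b * (cnj (v $ b) * cnj (w $ c) - cnj (v $ c) * cnj (w $ b)) =
     (M $ i $ b * cnj (v $ b) + M $ i $ c * cnj (v $ c)) * cnj (w $ c) -
     (M $ i $ b * cnj (w $ b) + M $ i $ c * cnj (w $ c)) * cnj (v $ c)"
    by (simp add: algebra_simps)
  then have Mb: "M $ i $ b = 0" using r1 r2 D by simp
  have "M $ i $ c = 0" using r1 Mb v' by simp
  then have "\<forall>m. m \<noteq> a \<longrightarrow> M $ i $ m = 0" using Mb unfolding all_distinct3[OF abc] by simp
  then show ?thesis by blast
qed

lemma antiprojective_preserving_monomial:
  assumes n: "n \<ge> 2" and M: "invertible M" and pres: "preserves_map n (proj_map M \<circ> proj_cnj)"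
  obtains s d where "bij s" "\<And>i. d i ^ n = 1"
    "\<And>v. v \<noteq> 0 \<Longrightarrow> (proj_map M \<circ> proj_cnj) (proj v) = proj (\<chi> i. d i * cnj (v $ s i))"
proof -
  have n0: "n > 0" using n by simp
  have "\<forall>i. \<exists>a. \<forall>m. m \<noteq> a \<longrightarrow> M $ i $ m = 0" using matrix_row_single[OF assms] by blast
  then obtain s where s: "\<And>i m. m \<noteq> s i \<Longrightarrow> M $ i $ m = 0" by metis
  define d where "d i = M $ i $ s i" for i
  have Mv: "(M *v x) $ i = d i * x $ s i" for x i
  proof -
    have "(\<Sum>m\<in>UNIV. M $ i $ m * x $ m) = (\<Sum>m\<in>{s i}. M $ i $ m * x $ m)"
      by (intro sum.mono_neutral_right) (use s in auto)
    then show ?thesis by (simp add: matrix_vector_mult_def d_def)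
  qed
  obtain N where N: "M ** N = mat 1" using M by (auto simp: invertible_def)
  have onto: "\<exists>x. \<forall>i. d i * x $ s i = y $ i" for y
  proof -
    have "M *v (N *v y) = y" by (simp add: matrix_vector_mul_assoc N)
    then show ?thesis using Mv by metis
  qed
  have d0: "d i \<noteq> 0" for i
    using onto[of "axis i 1"] by (metis axis_nth mult_zero_left zero_neq_one)
  have "inj s"
  proof (rule injI, rule ccontr)
    fix i j assume ij: "s i = s j" "i \<noteq> j"
    obtain x where x: "\<And>m. d m * x $ s m = axis i 1 $ m" using onto by blast
    have "d i * x $ s i = 1" "d j * x $ s j = 0" using x[of i] x[of j] ij by (auto simp: axis_def)
    then show False using ij d0[of j] by auto
  qed
  then have bs: "bij s" by (metis bij_betw_def finite_UNIV_inj_surj finite_class.finite_UNIV)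
  have f: "(proj_map M \<circ> proj_cnj) (proj v) = proj (\<chi> i. d i * cnj (v $ s i))"
      "(\<chi> i. d i * cnj (v $ s i)) \<noteq> 0" if "v \<noteq> 0" for v
  proof -
    have "M *v (\<chi> i. cnj (v $ i)) = (\<chi> i. d i * cnj (v $ s i))" by (simp add: vec_eq_iff Mv)
    then show "(proj_map M \<circ> proj_cnj) (proj v) = proj (\<chi> i. d i * cnj (v $ s i))"
      "(\<chi> i. d i * cnj (v $ s i)) \<noteq> 0"
      using antiprojective_proj[OF M that] by (simp_all del: o_apply)
  qed
  \<comment> \<open>The image of the vertex whose zero coordinate is \<open>s k\<close> must lie on
    the curve, and its equation there reads \<open>d i ^ n - d j ^ n = 0\<close>. Dividing by
    \<open>d 1\<close> afterwards makes all coefficients n-th roots of unity.\<close>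
  have dn: "d i ^ n = d j ^ n" if "i \<noteq> j" for i j
  proof -
    obtain k where ijk: "distinct [i, j, k]" using third_index[OF \<open>i \<noteq> j\<close>] by blast
    then have sijk: "distinct [s k, s i, s j]" using \<open>inj s\<close> by (auto simp: inj_eq)
    have z1: "cis (pi / n) ^ n = -1" using cis_pi_div_power[OF n0] .
    note v = vertex_vec[OF n sijk z1]
    have "(proj_map M \<circ> proj_cnj) (proj (tvec (s k) (s i) 0 1 (cis (pi / n)))) \<in> fermat_curve n"
      using pres v(1) unfolding preserves_map_def by (metis bij_betwE)
    then have "(\<Sum>m\<in>UNIV. (d m * cnj (tvec (s k) (s i) 0 1 (cis (pi / n)) $ s m)) ^ n) = 0"
      unfolding f(1)[OF v(3)] by (subst (asm) proj_mem_fermat_iff[OF f(2)[OF v(3)]]) simp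
    then have "d i ^ n + d j ^ n * cnj (cis (pi / n) ^ n) = 0"
      using sijk n0 by (simp add: sum_distinct3[OF ijk] power_mult_distrib zero_power)
    then show ?thesis unfolding z1 by simp
  qed
  have dn1: "(d i / d 1) ^ n = 1" for i
    using dn[of i 1] d0[of 1] by (cases "i = 1") (simp_all add: power_divide)
  have "(proj_map M \<circ> proj_cnj) (proj v) = proj (\<chi> i. d i / d 1 * cnj (v $ s i))" if "v \<noteq> 0" for v
  proof -
    have nz: "(\<chi> i. d i / d 1 * cnj (v $ s i)) \<noteq> 0"
    proof
      assume "(\<chi> i. d i / d 1 * cnj (v $ s i)) = 0"
      then have "(\<chi> i. d i * cnj (v $ s i)) = 0" using d0 by (simp add: vec_eq_iff)
      then show False using f(2)[OF that] by simp
    qed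
    show ?thesis unfolding f(1)[OF that] proj_eq_iff[OF f(2)[OF that] nz]
      using d0[of 1] by (intro exI[of _ "d 1"]) simp
  qed
  then show ?thesis using that[of s "\<lambda>i. d i / d 1"] bs dn1 by blast
qed

lemma involution_3_cases:
  fixes s :: "3 \<Rightarrow> 3"
  assumes "\<And>m. s (s m) = m" "s \<noteq> id"
  obtains i j k where "distinct [i, j, k]" "s i = j" "s j = i" "s k = k"
proof -
  obtain i where i: "s i \<noteq> i" using assms(2) by (auto simp: fun_eq_iff)
  then obtain k where k: "distinct [i, s i, k]" using third_index[of i "s i"] by metis
  have "s k = k"
  proof -
    have "s k \<in> {i, s i, k}" using distinct3_UNIV[OF k] by (metis UNIV_I)
    moreover have "s k \<noteq> i" "s k \<noteq> s i" using k assms(1) by auto metis+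
    ultimately show ?thesis by blast
  qed
  then show ?thesis using that[OF k] assms(1) by blast
qed

text \<open>That \<open>f\<close> is an involution is known only on the curve, so it is exploited at
  two kinds of test points: vertices show that the permutation is an involution, and an edge-centre
  shows that the two exchanged coordinates have the same coefficient.\<close>

lemma reflection_cases:
  assumes n: "n \<ge> 2" and f: "map_reflection n f"
  obtains (diag) d where "\<And>i. d i ^ n = 1"
      "\<And>v. v \<noteq> 0 \<Longrightarrow> f (proj v) = proj (\<chi> i. d i * cnj (v $ i))"
  | (swap) i j k a where "distinct [i, j, k]" "a ^ n = 1"
      "\<And>v. v \<noteq> 0 \<Longrightarrow> f (proj v) = proj (tvec i j (a * cnj (v $ j)) (a * cnj (v $ i)) (cnj (v $ k)))"
proof -
  have n0: "n > 0" using n by simp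
  obtain M where M: "invertible M" "f = proj_map M \<circ> proj_cnj"
    using f unfolding map_reflection_def antiprojective_def by blast
  have pres: "preserves_map n (proj_map M \<circ> proj_cnj)" using f M by (simp add: map_reflection_def)
  obtain s d where s: "bij s" and d: "\<And>i. d i ^ n = 1"
    and fv: "\<And>v. v \<noteq> 0 \<Longrightarrow> f (proj v) = proj (\<chi> i. d i * cnj (v $ s i))"
    using antiprojective_preserving_monomial[OF n M(1) pres] unfolding M(2) by blast
  have d0: "d i \<noteq> 0" for i using root_of_unity_nonzero[OF n0 d] .
  have nd: "cmod (d i) = 1" for i using norm_root_of_unity[OF n0 d] .
  have nz: "(\<chi> i. d i * cnj (v $ s i)) \<noteq> 0" if "v \<noteq> 0" for v
    using monomial_vec_nonzero[OF s d0, of "\<chi> i. cnj (v $ i)"] that by (simp add: vec_eq_iff)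
  have ff: "\<exists>c. c \<noteq> 0 \<and> (\<forall>i. d i * cnj (d (s i)) * v $ s (s i) = c * v $ i)"
    if v: "v \<noteq> 0" "proj v \<in> fermat_curve n" for v
  proof -
    have "f (f (proj v)) = proj (\<chi> i. d i * cnj ((\<chi> i. d i * cnj (v $ s i)) $ s i))"
      by (simp only: fv[OF v(1)] fv[OF nz[OF v(1)]])
    moreover have "f (f (proj v)) = proj v" using f v(2) by (simp add: map_reflection_def)
    ultimately have "proj (\<chi> i. d i * cnj ((\<chi> i. d i * cnj (v $ s i)) $ s i)) = proj v" by simp
    then show ?thesis
      unfolding proj_eq_iff[OF nz[OF nz[OF v(1)]] v(1)] by (simp add: mult.assoc)
  qed
  \<comment> \<open>The vertex has its only zero at \<open>m\<close>, and applying \<open>f\<close>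
    twice must leave the zero there.\<close>
  have ss: "s (s m) = m" for m
  proof -
    obtain j k where mjk: "distinct [m, j, k]" using other_indices by blast
    note v = vertex_vec[OF n mjk cis_pi_div_power[OF n0]]
    obtain c where "\<And>i. d i * cnj (d (s i)) * tvec m j 0 1 (cis (pi / n)) $ s (s i) = c * tvec m j 0 1 (cis (pi / n)) $ i"
      using ff[OF v(3,1)] by blast
    from this[of m] have "tri m j 0 1 (cis (pi / n)) (s (s m)) = 0" using d0 by simp
    then show ?thesis by (auto simp: tri_def split: if_splits)
  qed
  show ?thesis
  proof (cases "s = id")
    case True
    then show ?thesis using diag[of d] d fv by simp
  next
    case False
    then obtain i j k where ijk: "distinct [i, j, k]" "s i = j" "s j = i" "s k = k"
      using involution_3_cases[OF ss] by metis
    obtain c where c: "c ^ n = (-2 :: complex)" using exists_complex_root[OF n0] by blast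
    then have c0: "c \<noteq> 0" using n0 by (auto simp: zero_power)
    \<comment> \<open>The fixed coordinate \<open>k\<close> is nonzero here and shows that the
      proportionality factor is 1; coordinate \<open>i\<close> then gives
      \<open>d i * cnj (d j) = 1\<close>.\<close>
    let ?v = "tvec i j 1 1 c"
    have v: "?v \<noteq> 0" by (simp add: tvec_eq_0_iff[OF ijk(1)])
    have "proj ?v \<in> fermat_curve n"
      using c by (subst proj_tvec_mem_fermat[OF ijk(1)]) auto
    then obtain r where r: "\<And>i. d i * cnj (d (s i)) * ?v $ s (s i) = r * ?v $ i" using ff[OF v] by blast
    have "r = 1" using r[of k] ijk c0 nd[of k] by (simp add: complex_norm_square[symmetric])
    then have "d i * cnj (d j) = 1" using r[of i] ijk by simp
    moreover have "d j * cnj (d j) = 1" using nd[of j] by (simp add: complex_norm_square[symmetric])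
    ultimately have dij: "d i = d j" by (metis mult_cancel_right mult_zero_right zero_neq_one)
    define a where "a = d i / d k"
    have "a ^ n = 1" using d by (simp add: a_def power_divide)
    moreover have "f (proj v) = proj (tvec i j (a * cnj (v $ j)) (a * cnj (v $ i)) (cnj (v $ k)))" if "v \<noteq> 0" for v
    proof -
      have nz2: "tvec i j (a * cnj (v $ j)) (a * cnj (v $ i)) (cnj (v $ k)) \<noteq> 0"
        using that d0 ijk(1) unfolding vec_eq_iff all_distinct3[OF ijk(1)] by (auto simp: a_def)
      show ?thesis
        unfolding fv[OF that] proj_eq_iff[OF nz[OF that] nz2] all_distinct3[OF ijk(1)]
        using ijk d0 dij by (intro exI[of _ "d k"]) (simp add: a_def)
    qed
    ultimately show ?thesis using swap[OF ijk(1)] by blast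
  qed
qed

subsection \<open>Patterns of parametrised curves\<close>

lemma concat_replicate_conv_map_nth:
  assumes "l \<noteq> []"
  shows "concat (replicate K l) = map (\<lambda>m. l ! (m mod length l)) [0..<K * length l]"
proof (induction K)
  case (Suc K)
  have "concat (replicate (Suc K) l) = concat (replicate K l) @ l"
    by (simp flip: replicate_append_same)
  also have "\<dots> = map (\<lambda>m. l ! (m mod length l)) [0..<K * length l] @
      map (\<lambda>m. l ! (m mod length l)) [K * length l..<Suc K * length l]"
  proof -
    have "map (\<lambda>m. l ! (m mod length l)) [K * length l..<Suc K * length l] = l"
      by (intro nth_equalityI) (auto simp: add.commute)
    then show ?thesis by (simp only: Suc)
  qed
  also have "\<dots> = map (\<lambda>m. l ! (m mod length l)) ([0..<K * length l] @ [K * length l..<Suc K * length l])"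
    by (simp only: map_append)
  also have "[0..<K * length l] @ [K * length l..<Suc K * length l] = [0..<Suc K * length l]"
    using upt_add_eq_append[of 0 "K * length l" "length l"] by (simp add: add.commute)
  finally show ?case .
qed simp

text \<open>In a proper power of a word every letter recurs, so a first letter occurring only once
  rules it out.\<close>

lemma primitive_wordI:
  assumes "l \<noteq> []" "count_list l (hd l) = 1"
  shows "primitive_word l"
  unfolding primitive_word_def
proof
  assume "\<exists>u k. 2 \<le> k \<and> l = concat (replicate k u)"
  then obtain u k where k: "2 \<le> k" "l = concat (replicate k u)" by blast
  then obtain k' where k': "k = Suc (Suc k')" by (metis add_2_eq_Suc le_Suc_ex)
  have "u \<noteq> []" using assms(1) k by auto
  then obtain x u' where "u = x # u'" by (cases u) auto
  then show False using assms(2) unfolding k(2) k' by simp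
qed

text \<open>The order of the tests is that of \<open>geometric_type\<close>; the value 3 marks a
  point that is not geometric, which the default 2 of \<open>geometric_type\<close> cannot
  distinguish.\<close>

definition norm_type :: "nat \<Rightarrow> complex ^ 3 \<Rightarrow> nat" where
  "norm_type n v = (if \<exists>i. v $ i = 0 then 0 else if edge_norms n v then 1
     else if \<forall>i j. cmod (v $ i) = cmod (v $ j) then 2 else 3)"

lemma geometric_type_norm_type:
  assumes "n \<ge> 2" "v \<noteq> 0" "proj v \<in> fermat_curve n"
  shows "proj v \<in> geometric_points n \<longleftrightarrow> norm_type n v \<noteq> 3"
    and "norm_type n v \<noteq> 3 \<Longrightarrow> geometric_type n (proj v) = norm_type n v"
  unfolding geometric_points_def geometric_type_def norm_type_def Un_iff
    vertices_iff[OF assms] edge_centres_iff[OF assms] face_centres_iff[OF assms]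
  by (auto split: if_splits)

lemma ex_distinct3:
  fixes i j k :: 3
  assumes "distinct [i, j, k]"
  shows "(\<exists>m. P m) \<longleftrightarrow> P i \<or> P j \<or> P k"
proof -
  have "(\<forall>m. \<not> P m) \<longleftrightarrow> \<not> P i \<and> \<not> P j \<and> \<not> P k" by (rule all_distinct3[OF assms])
  then show ?thesis by metis
qed

lemma norm_type_tvec:
  assumes "distinct [i, j, k]" "n > 0" "A = cmod x ^ n" "B = cmod y ^ n" "C = cmod z ^ n"
  shows "norm_type n (tvec i j x y z) = (if A = 0 \<or> B = 0 \<or> C = 0 then 0
    else if A = B \<and> C = 2 * A \<or> B = C \<and> A = 2 * B \<or> A = C \<and> B = 2 * A then 1
    else if A = B \<and> B = C then 2 else 3)"
proof -
  have eq: "cmod x = cmod y \<longleftrightarrow> A = B" "cmod y = cmod z \<longleftrightarrow> B = C" "cmod x = cmod z \<longleftrightarrow> A = C"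
    using assms(2-) by (auto simp: power_eq_iff_eq_base)
  have z: "x = 0 \<longleftrightarrow> A = 0" "y = 0 \<longleftrightarrow> B = 0" "z = 0 \<longleftrightarrow> C = 0"
    using assms(2-) by auto
  have d: "i \<noteq> j" "i \<noteq> k" "j \<noteq> k" "j \<noteq> i" "k \<noteq> i" "k \<noteq> j" using assms(1) by auto
  have "edge_norms n (tvec i j x y z) \<longleftrightarrow> (x \<noteq> 0 \<and> cmod x = cmod y \<and> C = 2 * A) \<or>
      (y \<noteq> 0 \<and> cmod y = cmod z \<and> A = 2 * B) \<or> (x \<noteq> 0 \<and> cmod x = cmod z \<and> B = 2 * A)"
    (is "?L \<longleftrightarrow> ?R")
  proof
    assume ?L
    then obtain p q r where pqr: "distinct [p, q, r]" "tri i j x y z p \<noteq> 0"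
        "cmod (tri i j x y z q) = cmod (tri i j x y z p)"
        "cmod (tri i j x y z r) ^ n = 2 * cmod (tri i j x y z p) ^ n"
      unfolding edge_norms_def vec_lambda_beta by blast
    have mem: "m = i \<or> m = j \<or> m = k" for m
      using all_distinct3[OF assms(1), of "\<lambda>m. m = i \<or> m = j \<or> m = k"] by simp
    have "p = i \<and> q = j \<and> r = k \<or> p = i \<and> q = k \<and> r = j \<or> p = j \<and> q = i \<and> r = k \<or>
        p = j \<and> q = k \<and> r = i \<or> p = k \<and> q = i \<and> r = j \<or> p = k \<and> q = j \<and> r = i"
      using mem[of p] mem[of q] mem[of r] pqr(1) by auto
    then show ?R
      using pqr(2-) unfolding assms(3-) by (elim disjE conjE) (simp_all add: d, auto)
  next
    assume ?R
    then show ?L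
    proof (elim disjE conjE)
      assume "x \<noteq> 0" "cmod x = cmod y" "C = 2 * A"
      then show ?L unfolding edge_norms_def
        by (intro exI[of _ i] exI[of _ j] exI[of _ k]) (simp add: d assms(3-))
    next
      assume "y \<noteq> 0" "cmod y = cmod z" "A = 2 * B"
      then show ?L unfolding edge_norms_def
        by (intro exI[of _ j] exI[of _ k] exI[of _ i]) (simp add: d assms(3-))
    next
      assume "x \<noteq> 0" "cmod x = cmod z" "B = 2 * A"
      then show ?L unfolding edge_norms_def
        by (intro exI[of _ i] exI[of _ k] exI[of _ j]) (simp add: d assms(3-))
    qed
  qed
  moreover have "(\<forall>p q. cmod (tvec i j x y z $ p) = cmod (tvec i j x y z $ q)) \<longleftrightarrow>
      cmod x = cmod y \<and> cmod y = cmod z"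
    unfolding all_distinct3[OF assms(1)] by (simp add: d) auto
  moreover have "(\<exists>p. tvec i j x y z $ p = 0) \<longleftrightarrow> x = 0 \<or> y = 0 \<or> z = 0"
    unfolding ex_distinct3[OF assms(1)] by (simp add: d)
  ultimately show ?thesis unfolding norm_type_def by (auto simp: eq z)
qed

text \<open>Everything is expressed on coordinate vectors: coincidence of points is proportionality,
  and types are read from moduli. Since \<open>\<tau>\<close> increases and its first
  \<open>K * length l\<close> values are the meeting times, their sorted list is the image of an
  interval of indices, and the word can be read off position by position.\<close>

lemma has_pattern_curve:
  fixes w :: "real \<Rightarrow> complex ^ 3"
  assumes n: "n \<ge> 2" and l: "l \<noteq> []" "count_list l (hd l) = 1" "set l \<subseteq> {0, 1, 2}"
    and cont: "continuous_on {0..1} w" and nz: "\<And>t. w t \<noteq> 0"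
    and F: "\<And>t. proj (w t) \<in> fermat_curve n"
    and closed: "proj (w 1) = proj (w 0)" and S: "S = (\<lambda>t. proj (w t)) ` {0..1}"
    and inj: "\<And>s t c. \<lbrakk>s \<in> {0..1}; t \<in> {0..1}; c \<noteq> 0; \<And>i. w s $ i = c * w t $ i\<rbrakk>
        \<Longrightarrow> s = t \<or> s = 0 \<and> t = 1 \<or> s = 1 \<and> t = 0"
    and mono: "strict_mono \<tau>" and \<tau>: "\<And>m. m < K * length l \<Longrightarrow> \<tau> m \<in> {0..<1}"
    and types: "\<And>m. m < K * length l \<Longrightarrow> norm_type n (w (\<tau> m)) = l ! (m mod length l)"
    and meets: "\<And>t. t \<in> {0..<1} \<Longrightarrow> norm_type n (w t) \<noteq> 3 \<Longrightarrow> \<exists>m < K * length l. t = \<tau> m"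
  shows "has_pattern n S l K"
proof -
  define \<gamma> where "\<gamma> t = proj (w t)" for t
  have "path \<gamma>" unfolding path_def \<gamma>_def by (intro continuous_on_proj cont nz)
  moreover have "loop_free \<gamma>"
    unfolding loop_free_def
  proof (intro ballI impI)
    fix s t :: real assume st: "s \<in> {0..1}" "t \<in> {0..1}" "\<gamma> s = \<gamma> t"
    then obtain c where "c \<noteq> 0" "\<And>i. w s $ i = c * w t $ i"
      using proj_eq_iff[OF nz nz] unfolding \<gamma>_def by blast
    then show "s = t \<or> s = 0 \<and> t = 1 \<or> s = 1 \<and> t = 0" using inj st by blast
  qed
  ultimately have sp: "simple_path \<gamma>" by (simp add: simple_path_def)
  have len: "l ! (m mod length l) \<in> set l" for m using l(1) by simp
  have not3: "norm_type n (w (\<tau> m)) \<noteq> 3" if "m < K * length l" for m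
    using types[OF that] len[of m] l(3) by auto
  have mt: "meeting_times n \<gamma> = \<tau> ` {..<K * length l}"
    unfolding meeting_times_def \<gamma>_def geometric_type_norm_type(1)[OF n nz F]
    using meets \<tau> not3 by blast
  have "sorted_list_of_set (\<tau> ` {..<K * length l}) = map \<tau> [0..<K * length l]"
  proof -
    have "sorted (map \<tau> [0..<K * length l])"
      using strict_mono_mono[OF mono] by (simp add: sorted_iff_nth_mono monoD)
    moreover have "distinct (map \<tau> [0..<K * length l])"
      using strict_mono_imp_inj_on[OF mono] by (simp add: distinct_map inj_on_subset)
    moreover have "set (map \<tau> [0..<K * length l]) = \<tau> ` {..<K * length l}" by auto
    ultimately show ?thesis by (metis sorted_list_of_set.idem_if_sorted_distinct)
  qed
  then have "map (geometric_type n \<circ> \<gamma>) (sorted_list_of_set (meeting_times n \<gamma>)) =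
      map (\<lambda>m. l ! (m mod length l)) [0..<K * length l]"
    unfolding mt \<gamma>_def using geometric_type_norm_type(2)[OF n nz F not3] types by simp
  then have "map (geometric_type n \<circ> \<gamma>) (sorted_list_of_set (meeting_times n \<gamma>)) = concat (replicate K l)"
    by (simp add: concat_replicate_conv_map_nth[OF l(1)])
  moreover have "pathfinish \<gamma> = pathstart \<gamma>" "path_image \<gamma> = S"
    using closed S by (simp_all add: pathfinish_def pathstart_def path_image_def \<gamma>_def)
  moreover have "finite (meeting_times n \<gamma>)" by (simp add: mt)
  ultimately show ?thesis
    unfolding has_pattern_def using sp primitive_wordI[OF l(1,2)] by blast
qed

section \<open>Meeting times governed by a sine\<close>

lemma sin_pi_eq_cases:
  assumes "0 \<le> y" "y \<le> 1" "0 \<le> u" "u \<le> 1/2" "sin (pi * y) = sin (pi * u)"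
  shows "y = u \<or> y = 1 - u"
proof -
  have *: "y' = u" if "0 \<le> y'" "y' \<le> 1/2" "sin (pi * y') = sin (pi * u)" for y'
  proof -
    have "0 \<le> pi * y'" "pi * y' \<le> pi / 2" "0 \<le> pi * u" "pi * u \<le> pi / 2"
      using that(1,2) assms(3,4) mult_left_mono[of y' "1/2" pi] mult_left_mono[of u "1/2" pi] by simp_all
    then have "pi * y' = pi * u"
      using that(3) pi_gt_zero by - (rule sin_inj_pi, linarith+)
    then show ?thesis by simp
  qed
  show ?thesis
  proof (cases "y \<le> 1/2")
    case False
    have "sin (pi * (1 - y)) = sin (pi * y)" by (simp add: right_diff_distrib)
    then have "1 - y = u" using False assms by (intro *) auto
    then show ?thesis by auto
  qed (use * assms in auto)
qed

lemma abs_sin_pi_frac: "\<bar>sin (pi * x)\<bar> = sin (pi * frac x)"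
proof -
  have "sin (pi * x) = sin (pi * frac x + pi * of_int \<lfloor>x\<rfloor>)"
    by (simp add: frac_def algebra_simps)
  moreover have s0: "sin (pi * of_int \<lfloor>x\<rfloor>) = 0"
    by (auto simp: sin_zero_iff_int2)
  moreover from s0 have "sin (pi * frac x + pi * of_int \<lfloor>x\<rfloor>) = sin (pi * frac x) * cos (pi * of_int \<lfloor>x\<rfloor>)"
    by (simp add: sin_add)
  ultimately have "\<bar>sin (pi * x)\<bar> = \<bar>sin (pi * frac x)\<bar> * \<bar>cos (pi * of_int \<lfloor>x\<rfloor>)\<bar>" by (simp add: abs_mult)
  moreover have "\<bar>cos (pi * of_int \<lfloor>x\<rfloor>)\<bar> = 1"
    using sin_cos_squared_add[of "pi * of_int \<lfloor>x\<rfloor>"] s0 by (simp add: power2_eq_1_iff abs_if)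
  moreover have "sin (pi * frac x) \<ge> 0"
    using frac_ge_0[of x] frac_lt_1[of x] by (intro sin_ge_zero) auto
  ultimately show ?thesis by simp
qed

text \<open>The fractions of a half period of the sine at which \<open>2 |sin|\<close> takes the values 0, 1, 2, 1.\<close>

definition quarter_offset :: "nat \<Rightarrow> real" where
  "quarter_offset r = [0, 1/6, 1/2, 5/6] ! r"

text \<open>The unit interval is divided into \<open>K\<close> half periods with four meetings each;
  \<open>m div 4\<close> counts the half periods already completed.\<close>

definition quarter_time :: "nat \<Rightarrow> nat \<Rightarrow> real" where
  "quarter_time K m = (real (m div 4) + quarter_offset (m mod 4)) / real K"

lemma mod_4_cases: "m mod 4 = 0 \<or> m mod 4 = 1 \<or> m mod 4 = 2 \<or> m mod 4 = (3::nat)"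
  by auto

lemma quarter_offset_simps [simp]:
  "quarter_offset 0 = 0" "quarter_offset 1 = 1/6" "quarter_offset (Suc 0) = 1/6"
  "quarter_offset 2 = 1/2" "quarter_offset (Suc (Suc 0)) = 1/2" "quarter_offset 3 = 5/6"
  by (simp_all add: quarter_offset_def)

lemma quarter_offset_range: "quarter_offset (m mod 4) \<in> {0..<1}"
  using mod_4_cases[of m] by auto

lemma strict_mono_quarter_time:
  assumes "K > 0" shows "strict_mono (quarter_time K)"
  unfolding strict_mono_Suc_iff
proof
  fix m
  have "real (m div 4) + quarter_offset (m mod 4) < real (Suc m div 4) + quarter_offset (Suc m mod 4)"
    using mod_4_cases[of m] by (elim disjE) (simp_all add: div_Suc mod_Suc)
  then show "quarter_time K m < quarter_time K (Suc m)"
    using assms by (simp add: quarter_time_def divide_strict_right_mono)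
qed

lemma quarter_time_range:
  assumes "m < K * 4" shows "quarter_time K m \<in> {0..<1}"
proof -
  have "m div 4 < K" using assms by (simp add: less_mult_imp_div_less)
  then have "real (m div 4) + 1 \<le> real K" by linarith
  then show ?thesis using quarter_offset_range[of m] assms by (auto simp: quarter_time_def field_simps)
qed

lemma abs_sin_quarter_time:
  assumes "K > 0"
  shows "\<bar>sin (pi * (K * quarter_time K m))\<bar> = sin (pi * quarter_offset (m mod 4))"
proof -
  have "frac (real K * quarter_time K m) = quarter_offset (m mod 4)"
    using assms quarter_offset_range[of m] by (simp add: quarter_time_def frac_unique_iff)
  then show ?thesis by (simp add: abs_sin_pi_frac)
qed

lemma sin_pi_5_6: "sin (pi * 5 / 6) = 1/2"
proof -
  have "pi * 5 / 6 = pi - pi / 6" by simp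
  then show ?thesis by (simp only: sin_pi_minus sin_30)
qed

lemma norm_type_swap:
  assumes "distinct [i, j, k]" "n > 0" "cmod x = 1" "cmod y = 1"
  shows "norm_type n (tvec i j x y z) = (if cmod z ^ n = 0 then 0 else if cmod z ^ n = 2 then 1
    else if cmod z ^ n = 1 then 2 else 3)"
  unfolding norm_type_tvec[OF assms(1,2) refl refl refl] assms(3,4) by simp

lemma norm_type_swap_quarter_time:
  assumes "distinct [i, j, k]" "n > 0" "K > 0" "cmod x = 1" "cmod y = 1"
    "cmod z ^ n = 2 * \<bar>sin (pi * (real K * quarter_time K m))\<bar>"
  shows "norm_type n (tvec i j x y z) = [0, 2, 1, 2] ! (m mod 4)"
  unfolding norm_type_swap[OF assms(1,2,4,5)] assms(6) abs_sin_quarter_time[OF assms(3)]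
  using mod_4_cases[of m] by (elim disjE) (simp_all add: sin_30 sin_pi_5_6)

lemma norm_type_swap_meets:
  assumes "distinct [i, j, k]" "n > 0" "K > 0" "cmod x = 1" "cmod y = 1"
    "cmod z ^ n = 2 * \<bar>sin (pi * (real K * t))\<bar>" "t \<in> {0..<1}" "norm_type n (tvec i j x y z) \<noteq> 3"
  shows "\<exists>m < K * 4. t = quarter_time K m"
proof -
  let ?y = "frac (real K * t)"
  define q where "q = nat \<lfloor>real K * t\<rfloor>"
  have q: "real q = of_int \<lfloor>real K * t\<rfloor>" using assms by (simp add: q_def)
  have "real q < real K"
    unfolding q using assms(3,7) by (intro order.strict_trans1[OF of_int_floor_le]) auto
  then have qK: "q < K" by simp
  have y: "0 \<le> ?y" "?y \<le> 1" using frac_ge_0 frac_lt_1 less_imp_le by blast+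
  have "sin (pi * ?y) \<in> {0, 1, 1/2}"
    using assms(8) unfolding norm_type_swap[OF assms(1,2,4,5)] assms(6) abs_sin_pi_frac
    by (auto split: if_splits)
  moreover have "sin (pi * 0) = 0" "sin (pi * (1/2)) = 1" "sin (pi * (1/6)) = 1/2"
    by (simp_all add: sin_30)
  ultimately have "?y \<in> {0, 1, 1/2, 1/6, 5/6}"
    using sin_pi_eq_cases[OF y, of 0] sin_pi_eq_cases[OF y, of "1/2"] sin_pi_eq_cases[OF y, of "1/6"] by auto
  \<comment> \<open>The value 1, the mirror image of 0 under y -> 1 - y, is excluded because a
    fractional part is less than 1; it would be the start of the next half period.\<close>
  then have "?y \<in> {0, 1/6, 1/2, 5/6}" using frac_lt_1[of "real K * t"] by auto
  then have "?y \<in> quarter_offset ` {0, 1, 2, 3}" by simp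
  then obtain r where r': "r \<in> {0, 1, 2, 3}" and r2: "?y = quarter_offset r" by blast
  have r: "r < 4" "?y = quarter_offset r" using r' r2 by auto
  have "real K * t = real q + ?y" unfolding q by (simp add: frac_def)
  then have "t = quarter_time K (4 * q + r)"
    using r assms(3) by (simp add: quarter_time_def field_simps)
  moreover have "4 * q + r < K * 4" using r(1) qK by simp
  ultimately show ?thesis by blast
qed

text \<open>With two unimodular coordinates the type depends only on the n-th power of the modulus
  of the third: 0 is a vertex, 1 a face-centre, 2 an edge-centre. In each half period the function 2
  |sin| takes these values in the order 0, 1, 2, 1, which reads 0, 2, 1, 2.\<close>

lemma has_pattern_swap_curve:
  fixes x y :: "real \<Rightarrow> complex" and z :: "real \<Rightarrow> real"
  assumes ijk: "distinct [i, j, k]" and n: "n \<ge> 2" and K: "K > 0"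
    and cont: "continuous_on {0..1} x" "continuous_on {0..1} y" "continuous_on {0..1} z"
    and norms: "\<And>t. cmod (x t) = 1" "\<And>t. cmod (y t) = 1" "\<And>t. \<bar>z t\<bar> ^ n = 2 * \<bar>sin (pi * (real K * t))\<bar>"
    and F: "\<And>t. x t ^ n + y t ^ n + of_real (z t) ^ n = 0"
    and closed: "\<exists>c. c \<noteq> 0 \<and> x 1 = c * x 0 \<and> y 1 = c * y 0 \<and> of_real (z 1) = c * of_real (z 0)"
    and inj: "\<And>s t c. \<lbrakk>s \<in> {0..1}; t \<in> {0..1}; c \<noteq> 0; x s = c * x t; y s = c * y t;
        of_real (z s) = c * of_real (z t)\<rbrakk> \<Longrightarrow> s = t \<or> s = 0 \<and> t = 1 \<or> s = 1 \<and> t = 0"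
  shows "has_pattern n ((\<lambda>t. proj (tvec i j (x t) (y t) (of_real (z t)))) ` {0..1}) [0, 2, 1, 2] K"
proof -
  have n0: "n > 0" using n by simp
  have x0: "x t \<noteq> 0" for t using norms(1)[of t] by auto
  have nz: "tvec i j (x t) (y t) (of_real (z t)) \<noteq> 0" for t
    using x0 by (simp add: tvec_eq_0_iff[OF ijk])
  have zn: "cmod (of_real (z t)) ^ n = 2 * \<bar>sin (pi * (real K * t))\<bar>" for t
    using norms(3) by simp
  have len: "K * length [0, 2, 1, 2 :: nat] = K * 4" by simp
  show ?thesis
  proof (rule has_pattern_curve[where \<tau> = "quarter_time K"])
    show "continuous_on {0..1} (\<lambda>t. tvec i j (x t) (y t) (of_real (z t)))"
      by (intro continuous_on_tvec cont continuous_on_of_real)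
    show "proj (tvec i j (x t) (y t) (of_real (z t))) \<in> fermat_curve n" for t
      using F x0 by (subst proj_tvec_mem_fermat[OF ijk]) auto
    show "proj (tvec i j (x 1) (y 1) (of_real (z 1))) = proj (tvec i j (x 0) (y 0) (of_real (z 0)))"
      unfolding proj_eq_iff[OF nz nz] all_distinct3[OF ijk] using closed ijk by simp
    show "strict_mono (quarter_time K)" by (rule strict_mono_quarter_time[OF K])
    show "norm_type n (tvec i j (x (quarter_time K m)) (y (quarter_time K m)) (of_real (z (quarter_time K m)))) =
        [0, 2, 1, 2] ! (m mod length [0, 2, 1, 2])" for m
      using norm_type_swap_quarter_time[OF ijk n0 K norms(1,2) zn] by simp
    show "\<exists>m<K * length [0, 2, 1, 2 :: nat]. t = quarter_time K m"
      if "t \<in> {0..<1}" "norm_type n (tvec i j (x t) (y t) (of_real (z t))) \<noteq> 3" for t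
      using norm_type_swap_meets[OF ijk n0 K norms(1,2) zn that] unfolding len .
    show "quarter_time K m \<in> {0..<1}" if "m < K * length [0, 2, 1, 2 :: nat]" for m
      using quarter_time_range[of m K] that unfolding len .
    fix s t :: real and c
    assume st: "s \<in> {0..1}" "t \<in> {0..1}" "c \<noteq> 0"
       and eq: "\<And>m. tvec i j (x s) (y s) (of_real (z s)) $ m = c * tvec i j (x t) (y t) (of_real (z t)) $ m"
    have "x s = c * x t" "y s = c * y t" "of_real (z s) = c * of_real (z t)"
      using eq[of i] eq[of j] eq[of k] ijk by simp_all
    then show "s = t \<or> s = 0 \<and> t = 1 \<or> s = 1 \<and> t = 0" using inj st by blast
  qed (use n nz in auto)
qed

subsection \<open>Mirrors of the reflections exchanging two coordinates\<close>

lemma unit_polar: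
  assumes "cmod w = 1"
  obtains \<delta> where "\<bar>\<delta>\<bar> \<le> pi" "w = cis \<delta>"
proof -
  have "w \<noteq> 0" using assms by auto
  then have "w = cis (Arg w)" using assms by (simp add: cis_Arg sgn_eq)
  moreover have "\<bar>Arg w\<bar> \<le> pi" using Arg_bounded[of w] by (simp add: abs_le_iff)
  ultimately show ?thesis using that by blast
qed

lemma abs_le_pi_half:
  assumes "\<bar>u\<bar> \<le> pi" "cos u \<ge> 0"
  shows "\<bar>u\<bar> \<le> pi / 2"
proof (rule ccontr)
  assume "\<not> \<bar>u\<bar> \<le> pi / 2"
  then have "cos \<bar>u\<bar> < cos (pi / 2)" using assms(1) by (intro cos_monotone_0_pi) auto
  then show False using assms(2) by simp
qed

lemma cis_2pi_eq_iff:
  assumes "s \<in> {0..1}" "t \<in> {0..1}" "cis (2 * pi * s) = cis (2 * pi * t)"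
  shows "s = t \<or> s = 0 \<and> t = 1 \<or> s = 1 \<and> t = (0::real)"
proof -
  have "cis (2 * pi * (s - t)) = 1"
    using assms(3) by (simp add: right_diff_distrib flip: cis_divide)
  then have "cos (2 * pi * (s - t)) = 1" by (simp add: complex_eq_iff)
  then obtain k :: int where "2 * pi * (s - t) = of_int k * 2 * pi" using cos_one_2pi_int by auto
  then have k: "s - t = of_int k" by simp
  then have "real_of_int k \<le> 1" "-1 \<le> real_of_int k" using assms(1,2) by auto
  then have "k = -1 \<or> k = 0 \<or> k = 1" by linarith
  then show ?thesis using k assms(1,2) by auto
qed

lemma Re_sum_cnj:
  "x ^ n + cnj x ^ n = of_real (2 * Re (x ^ n))"
  by (simp add: complex_eq_iff flip: complex_cnj_power)

text \<open>A fixed point only has coordinates fixed up to a unimodular factor. A suitable rescaling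
  makes the vector itself fixed, so that its k-th coordinate is real and the other two determine
  each other; a positive factor then normalises \<open>x\<close>.\<close>

lemma swap_fixed_points:
  assumes n: "n > 0" and ijk: "distinct [i, j, k]" and a: "a ^ n = 1"
    and f: "\<And>v. v \<noteq> 0 \<Longrightarrow> f (proj v) = proj (tvec i j (a * cnj (v $ j)) (a * cnj (v $ i)) (cnj (v $ k)))"
  shows "{p \<in> fermat_curve n. f p = p} =
    {proj (tvec i j x (a * cnj x) (of_real r)) | x r. cmod x = 1 \<and> 2 * Re (x ^ n) + r ^ n = 0}"
proof (intro equalityI subsetI)
  have na: "cmod a = 1" using norm_root_of_unity[OF n a] .
  then have aa: "a * cnj a = 1" by (simp add: complex_norm_square[symmetric])
  have a0: "a \<noteq> 0" using na by auto
  have curve: "proj (tvec i j x (a * cnj x) (of_real r)) \<in> fermat_curve n \<longleftrightarrow> 2 * Re (x ^ n) + r ^ n = 0"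
    if "x \<noteq> 0 \<or> r \<noteq> 0" for x r
  proof -
    have "x ^ n + (a * cnj x) ^ n + of_real r ^ n = of_real (2 * Re (x ^ n) + r ^ n)"
      using Re_sum_cnj[of x n] a by (simp add: power_mult_distrib)
    moreover have "of_real (2 * Re (x ^ n) + r ^ n) = (0 :: complex) \<longleftrightarrow> 2 * Re (x ^ n) + r ^ n = 0"
      by (rule of_real_eq_0_iff)
    ultimately show ?thesis using that by (subst proj_tvec_mem_fermat[OF ijk]) auto
  qed
  {
    fix p assume "p \<in> {proj (tvec i j x (a * cnj x) (of_real r)) | x r. cmod x = 1 \<and> 2 * Re (x ^ n) + r ^ n = 0}"
    then obtain x r where p: "p = proj (tvec i j x (a * cnj x) (of_real r))" "cmod x = 1" "2 * Re (x ^ n) + r ^ n = 0"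
      by blast
    have x0: "x \<noteq> 0" using p(2) by auto
    then have "p \<in> fermat_curve n" using curve[of x r] p by simp
    moreover have "f p = p"
    proof -
      have "f p = proj (tvec i j (a * cnj (a * cnj x)) (a * cnj x) (cnj (of_real r)))"
        unfolding p(1) using x0 ijk by (subst f) (auto simp: tvec_eq_0_iff[OF ijk])
      also have "a * cnj (a * cnj x) = x" using aa by (simp add: mult.assoc[symmetric])
      finally show ?thesis using p(1) by simp
    qed
    ultimately show "p \<in> {p \<in> fermat_curve n. f p = p}" by simp
  }
  fix p assume "p \<in> {p \<in> fermat_curve n. f p = p}"
  then have p: "p \<in> fermat_curve n" "f p = p" by auto
  obtain v where v: "v \<noteq> 0" "p = proj v" using cp2_cases by blast
  have nz: "tvec i j (a * cnj (v $ j)) (a * cnj (v $ i)) (cnj (v $ k)) \<noteq> 0"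
    using v(1) a0 ijk unfolding vec_eq_iff all_distinct3[OF ijk] by auto
  have "proj (tvec i j (a * cnj (v $ j)) (a * cnj (v $ i)) (cnj (v $ k))) = proj v"
    using p(2) v f[OF v(1)] by simp
  then obtain c where c: "c \<noteq> 0" "a * cnj (v $ j) = c * v $ i" "a * cnj (v $ i) = c * v $ j" "cnj (v $ k) = c * v $ k"
    unfolding proj_eq_iff[OF nz v(1)] all_distinct3[OF ijk] using ijk by auto
  have norms: "cmod (v $ j) = cmod c * cmod (v $ i)" "cmod (v $ i) = cmod c * cmod (v $ j)" "cmod (v $ k) = cmod c * cmod (v $ k)"
    using arg_cong[OF c(2), of cmod] arg_cong[OF c(3), of cmod] arg_cong[OF c(4), of cmod] na
    by (simp_all add: norm_mult)
  have "cmod c = 1"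
  proof (cases "v $ k = 0")
    case True
    have "v $ i \<noteq> 0"
      using v(1) norms(1) True unfolding vec_eq_iff all_distinct3[OF ijk] by auto
    moreover have "cmod (v $ i) = (cmod c)\<^sup>2 * cmod (v $ i)"
      by (subst norms(2), subst norms(1)) (simp add: power2_eq_square)
    ultimately have "(cmod c)\<^sup>2 = 1" by simp
    then show ?thesis by (simp add: power2_eq_1_iff) (metis norm_ge_zero not_one_le_zero neg_0_le_iff_le)
  qed (use norms(3) in simp)
  \<comment> \<open>The map is antilinear, so passing from v to s v replaces the factor
    \<open>c\<close> by \<open>c * cnj s / s\<close>, which is 1 for a unimodular square root of
    \<open>c\<close>.\<close>
  define s where "s = csqrt c"
  have s2: "s * s = c" using power2_csqrt[of c] by (simp add: s_def power2_eq_square)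
  have "cmod s = 1" using \<open>cmod c = 1\<close> by (simp add: s_def norm_csqrt)
  then have ss: "cnj s * s = 1" by (simp add: complex_norm_square[symmetric] mult.commute)
  then have s0: "s \<noteq> 0" by auto
  have cs: "cnj s * c = s" using ss by (simp flip: s2 mult.assoc)
  define x where "x = s * v $ i"
  have "cnj (s * v $ k) = s * v $ k"
    using c(4) cs by (simp add: mult.assoc[symmetric])
  then have "s * v $ k \<in> \<real>" by (simp add: Reals_cnj_iff)
  then obtain r where r: "s * v $ k = of_real r" by (auto elim: Reals_cases)
  have xj: "a * cnj x = s * v $ j"
  proof -
    have "a * cnj x = cnj s * (a * cnj (v $ i))" by (simp add: x_def)
    also have "\<dots> = s * v $ j" using c(3) cs by (simp add: mult.assoc[symmetric])
    finally show ?thesis .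
  qed
  have xr: "x \<noteq> 0 \<or> r \<noteq> 0"
    using v(1) s0 xj r x_def a0 unfolding vec_eq_iff all_distinct3[OF ijk] by auto
  have px: "p = proj (tvec i j x (a * cnj x) (of_real r))"
  proof -
    have "tvec i j x (a * cnj x) (of_real r) \<noteq> 0" using xr by (simp add: tvec_eq_0_iff[OF ijk])
    moreover have "v $ i = inverse s * x" "v $ j = inverse s * (a * cnj x)" "v $ k = inverse s * of_real r"
      unfolding xj r[symmetric] using s0 by (simp_all add: x_def)
    ultimately show ?thesis
      unfolding v(2) using ijk s0 v(1)
      by (subst proj_eq_iff) (auto simp: all_distinct3[OF ijk] intro!: exI[of _ "inverse s"])
  qed
  then have rel: "2 * Re (x ^ n) + r ^ n = 0" using p(1) curve[OF xr] by simp
  \<comment> \<open>The relation on n-th powers would turn x = 0 into r = 0 as well.\<close>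
  have x0: "x \<noteq> 0" using rel xr n by (auto simp: zero_power)
  let ?m = "cmod x"
  have m: "?m > 0" using x0 by simp
  have "2 * Re ((x / of_real ?m) ^ n) + (r / ?m) ^ n = (2 * Re (x ^ n) + r ^ n) / ?m ^ n"
    by (simp add: power_divide add_divide_distrib flip: of_real_power)
  then have "2 * Re ((x / of_real ?m) ^ n) + (r / ?m) ^ n = 0" using rel by simp
  moreover have "cmod (x / of_real ?m) = 1" using x0 by (simp add: norm_divide)
  moreover have "p = proj (tvec i j (x / of_real ?m) (a * cnj (x / of_real ?m)) (of_real (r / ?m)))"
  proof -
    have nz1: "tvec i j x (a * cnj x) (of_real r) \<noteq> 0"
      and nz2: "tvec i j (x / of_real ?m) (a * cnj (x / of_real ?m)) (of_real (r / ?m)) \<noteq> 0"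
      using x0 by (auto simp: tvec_eq_0_iff[OF ijk])
    show ?thesis
      unfolding px proj_eq_iff[OF nz1 nz2] all_distinct3[OF ijk]
      using ijk m by (intro exI[of _ "of_real ?m"]) simp
  qed
  ultimately show "p \<in> {proj (tvec i j x (a * cnj x) (of_real r)) | x r. cmod x = 1 \<and> 2 * Re (x ^ n) + r ^ n = 0}"
    by blast
qed

text \<open>The normal form still allows a simultaneous change of sign and nothing more: conjugate
  coordinates scale by the same factor only if it is real, and the moduli make it
  unimodular.\<close>

lemma swap_scalar_sign:
  assumes "cmod x = 1" "cmod x' = 1" "a \<noteq> 0" "x = c * x'" "a * cnj x = c * (a * cnj x')"
  shows "c = 1 \<or> c = -1"
proof -
  have "cnj x = c * cnj x'" using assms(3,5) by simp
  then have "cnj c * cnj x' = c * cnj x'" using assms(4) by simp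
  moreover have "cnj x' \<noteq> 0" using assms(2) by auto
  ultimately have "cnj c = c" by simp
  then have "Im c = 0" by (simp add: complex_eq_iff)
  moreover have "cmod c = 1" using arg_cong[OF assms(4), of cmod] assms(1,2) by (simp add: norm_mult)
  ultimately have "\<bar>Re c\<bar> = 1" by (simp add: cmod_def)
  then show ?thesis using \<open>Im c = 0\<close> by (auto simp: complex_eq_iff abs_if split: if_splits)
qed

lemma minus_tvec_proj:
  assumes "distinct [i, j, k]" "x \<noteq> 0"
  shows "proj (tvec i j (- x) (- y) (- z)) = proj (tvec i j x y z)"
proof -
  have nz: "tvec i j (- x) (- y) (- z) \<noteq> 0" "tvec i j x y z \<noteq> 0"
    using assms by (auto simp: tvec_eq_0_iff[OF assms(1)])
  show ?thesis
    unfolding proj_eq_iff[OF nz] all_distinct3[OF assms(1)]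
    using assms by (intro exI[of _ "-1"]) simp
qed

lemma mirror_pattern_swap_odd:
  assumes n: "n \<ge> 2" and odd: "odd n" and ijk: "distinct [i, j, k]" and a: "a ^ n = 1"
    and f: "\<And>v. v \<noteq> 0 \<Longrightarrow> f (proj v) = proj (tvec i j (a * cnj (v $ j)) (a * cnj (v $ i)) (cnj (v $ k)))"
    and S: "S \<in> components {p \<in> fermat_curve n. f p = p}"
  shows "has_pattern n S [0, 2, 1, 2] n"
proof -
  have n0: "n > 0" using n by simp
  have na: "cmod a = 1" and a0: "a \<noteq> 0" using norm_root_of_unity[OF n0 a] by auto
  define x where "x t = cis (pi / (2 * n) + pi * t)" for t :: real
  define z where "z t = root n (2 * sin (pi * (real n * t)))" for t :: real
  let ?w = "\<lambda>t. proj (tvec i j (x t) (a * cnj (x t)) (of_real (z t)))"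
  have x1: "cmod (x t) = 1" for t by (simp add: x_def)
  have zn: "z t ^ n = 2 * sin (pi * (real n * t))" for t
    unfolding z_def using odd_real_root_pow[OF odd] .
  have xn: "x t ^ n = cis (pi / 2 + pi * (real n * t))" for t
  proof -
    have "real n * (pi / (2 * n) + pi * t) = pi / 2 + pi * (real n * t)"
      using n0 by (simp add: field_simps)
    then show ?thesis unfolding x_def Complex.DeMoivre by (rule arg_cong)
  qed
  have rel: "2 * Re (x t ^ n) + z t ^ n = 0" for t
    unfolding xn zn by (simp add: cos_add)
  have pat: "has_pattern n (?w ` {0..1}) [0, 2, 1, 2] n"
  proof (rule has_pattern_swap_curve[OF ijk n n0])
    show "continuous_on {0..1} x" "continuous_on {0..1} (\<lambda>t. a * cnj (x t))" "continuous_on {0..1} z"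
      unfolding x_def z_def by (intro continuous_intros)+
    show "cmod (x t) = 1" "cmod (a * cnj (x t)) = 1" for t using x1 na by (simp_all add: norm_mult)
    show "\<bar>z t\<bar> ^ n = 2 * \<bar>sin (pi * (real n * t))\<bar>" for t
      using zn[of t] by (simp flip: power_abs add: abs_mult)
    show "x t ^ n + (a * cnj (x t)) ^ n + of_real (z t) ^ n = 0" for t
    proof -
      have "x t ^ n + (a * cnj (x t)) ^ n + of_real (z t) ^ n = of_real (2 * Re (x t ^ n) + z t ^ n)"
        using Re_sum_cnj[of "x t" n] a by (simp add: power_mult_distrib)
      then show ?thesis by (simp only: rel of_real_0)
    qed
    have "x 1 = - x 0" by (simp add: x_def flip: cis_mult)
    moreover have "z 1 = 0" "z 0 = 0" by (simp_all add: z_def mult.commute[of pi])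
    ultimately show "\<exists>c. c \<noteq> 0 \<and> x 1 = c * x 0 \<and> a * cnj (x 1) = c * (a * cnj (x 0)) \<and> of_real (z 1) = c * of_real (z 0)"
      by (intro exI[of _ "-1"]) simp
    show "s = t \<or> s = 0 \<and> t = 1 \<or> s = 1 \<and> t = 0"
      if st: "s \<in> {0..1}" "t \<in> {0..1}" and "c \<noteq> 0"
        and c: "x s = c * x t" "a * cnj (x s) = c * (a * cnj (x t))"
        and "complex_of_real (z s) = c * of_real (z t)" for s t c
    proof -
      have "c = 1 \<or> c = -1" using swap_scalar_sign[OF x1 x1 a0 c] .
      then have "x s ^ 2 = x t ^ 2" using c(1) by auto
      then have "cis (pi / n) * cis (2 * pi * s) = cis (pi / n) * cis (2 * pi * t)"
        unfolding x_def Complex.DeMoivre by (simp add: cis_mult algebra_simps)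
      then have "cis (2 * pi * s) = cis (2 * pi * t)" by simp
      then show ?thesis using cis_2pi_eq_iff st by blast
    qed
  qed
  have fixed: "{p \<in> fermat_curve n. f p = p} =
      {proj (tvec i j x (a * cnj x) (of_real r)) | x r. cmod x = 1 \<and> 2 * Re (x ^ n) + r ^ n = 0}"
    by (rule swap_fixed_points[OF n0 ijk a]) (rule f)
  have F: "{p \<in> fermat_curve n. f p = p} = ?w ` {0..1}"
  proof (intro equalityI subsetI)
    fix p assume "p \<in> ?w ` {0..1}"
    then show "p \<in> {p \<in> fermat_curve n. f p = p}"
      unfolding fixed using x1 rel by blast
  next
    fix p assume "p \<in> {p \<in> fermat_curve n. f p = p}"
    then obtain y r where p: "p = proj (tvec i j y (a * cnj y) (of_real r))" "cmod y = 1" "2 * Re (y ^ n) + r ^ n = 0"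
      unfolding fixed by blast
    obtain \<psi> where psi: "y = cis \<psi>" using unit_polar[OF p(2)] by blast
    \<comment> \<open>\<open>u\<close> is the time at which \<open>x\<close> would reach
      \<open>y\<close>; its integer part counts half turns, each of which changes the sign of
      \<open>x\<close>, and for odd n that of the real root too.\<close>
    define u where "u = (\<psi> - pi / (2 * n)) / pi"
    have t: "frac u \<in> {0..1}" using frac_ge_0[of u] frac_lt_1[of u] by simp
    have "\<psi> = pi / (2 * n) + pi * frac u + pi * of_int \<lfloor>u\<rfloor>"
      by (simp add: u_def frac_def field_simps)
    then have y: "y = x (frac u) * cis (pi * of_int \<lfloor>u\<rfloor>)" by (simp add: psi x_def cis_mult)
    have sgn: "cis (pi * of_int m) = 1 \<or> cis (pi * of_int m) = -1" for m :: int
      by (cases "even m") (auto elim!: evenE oddE simp: complex_eq_iff algebra_simps cos_add sin_add)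
    have r: "r ^ n = - 2 * Re (y ^ n)" using p(3) by simp
    from sgn[of "\<lfloor>u\<rfloor>"] show "p \<in> ?w ` {0..1}"
    proof
      assume "cis (pi * of_int \<lfloor>u\<rfloor>) = 1"
      then have y': "y = x (frac u)" using y by simp
      then have "r ^ n = z (frac u) ^ n" using r rel[of "frac u"] by simp
      then have "r = z (frac u)" by (metis odd_real_root_power_cancel[OF odd])
      then show ?thesis using t p(1) y' by blast
    next
      assume "cis (pi * of_int \<lfloor>u\<rfloor>) = -1"
      then have y': "y = - x (frac u)" using y by simp
      then have "r ^ n = (- z (frac u)) ^ n" using r rel[of "frac u"] odd by (simp add: power_minus_odd)
      then have "r = - z (frac u)" by (metis odd_real_root_power_cancel[OF odd])
      moreover have "x (frac u) \<noteq> 0" using x1[of "frac u"] by auto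
      ultimately have "p = ?w (frac u)"
        using p(1) y' minus_tvec_proj[OF ijk, of "x (frac u)" "a * cnj (x (frac u))" "of_real (z (frac u))"] by simp
      then show ?thesis using t by blast
    qed
  qed
  have "connected (?w ` {0..1})"
  proof (rule connected_continuous_image)
    have "x t \<noteq> 0" for t using x1[of t] by auto
    then show "continuous_on {0..1} ?w"
      unfolding z_def x_def
      by (intro continuous_on_proj continuous_on_tvec continuous_intros) (auto simp: tvec_eq_0_iff[OF ijk])
  qed simp
  then show ?thesis
    using S F pat connected_eq_components_subset_sing[of "?w ` {0..1}"] by auto
qed

lemma mirror_pattern_swap_even:
  assumes n: "n \<ge> 2" and even: "even n" and ijk: "distinct [i, j, k]" and a: "a ^ n = 1"
    and f: "\<And>v. v \<noteq> 0 \<Longrightarrow> f (proj v) = proj (tvec i j (a * cnj (v $ j)) (a * cnj (v $ i)) (cnj (v $ k)))"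
    and S: "S \<in> components {p \<in> fermat_curve n. f p = p}"
  shows "has_pattern n S [0, 2, 1, 2] 2"
proof -
  have n0: "n > 0" using n by simp
  have na: "cmod a = 1" and a0: "a \<noteq> 0" using norm_root_of_unity[OF n0 a] by auto
  let ?F = "{p \<in> fermat_curve n. f p = p}"
  have fixed: "?F =
      {proj (tvec i j x (a * cnj x) (of_real r)) | x r. cmod x = 1 \<and> 2 * Re (x ^ n) + r ^ n = 0}"
    by (rule swap_fixed_points[OF n0 ijk a]) (rule f)
  have S_sub: "S \<subseteq> ?F" and S_conn: "connected S" and "S \<noteq> {}"
    using S by (auto dest: in_components_subset in_components_connected in_components_nonempty)
  then obtain p where p: "p \<in> S" "p \<in> ?F" by blast
  then obtain x0 r0 where p0: "p = proj (tvec i j x0 (a * cnj x0) (of_real r0))" "cmod x0 = 1"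
      "2 * Re (x0 ^ n) + r0 ^ n = 0"
    unfolding fixed by blast
  have "cmod (- (x0 ^ n)) = 1" using p0(2) by (simp add: norm_power)
  then obtain \<phi>0 where phi0: "\<bar>\<phi>0\<bar> \<le> pi" "- (x0 ^ n) = cis \<phi>0" using unit_polar by blast
  have "cos \<phi>0 = - Re (x0 ^ n)" using arg_cong[OF phi0(2), of Re] by simp
  also have "\<dots> \<ge> 0" using p0(3) zero_le_even_power[OF even, of r0] by simp
  finally have phi0h: "\<bar>\<phi>0\<bar> \<le> pi / 2" using abs_le_pi_half[OF phi0(1)] by simp
  \<comment> \<open>For even n the relation forces Re (x^n) to be at most 0, so x^n = - cis \<phi>
    with |\<phi>| at most pi / 2. Removing the angle leaves an n-th root \<open>\<zeta>\<close> of
    -1, the middle of the arc that contains \<open>x0\<close>.\<close>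
  define \<zeta> where "\<zeta> = x0 * cis (- \<phi>0 / n)"
  have z1: "cmod \<zeta> = 1" using p0(2) by (simp add: \<zeta>_def norm_mult)
  have z0: "\<zeta> \<noteq> 0" using z1 by auto
  have zn: "\<zeta> ^ n = -1"
  proof -
    have "\<zeta> ^ n = x0 ^ n * cis (- \<phi>0)" using n0 by (simp add: \<zeta>_def power_mult_distrib Complex.DeMoivre)
    also have "x0 ^ n = - cis \<phi>0" using phi0(2) by (metis minus_minus)
    finally show ?thesis by (simp add: cis_mult)
  qed
  have x0: "x0 = \<zeta> * cis (\<phi>0 / n)" by (simp add: \<zeta>_def mult.assoc cis_mult)

  \<comment> \<open>Once around the oval, the angle \<open>\<phi>\<close> runs back and forth through \<open>[- pi / 2, pi / 2]\<close>, while \<open>z\<close>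
    changes sign at the two ends.\<close>
  define \<phi> where "\<phi> t = arcsin (- cos (2 * pi * t))" for t
  define x where "x t = \<zeta> * cis (\<phi> t / n)" for t
  define z where "z t = root n (2 * sin (2 * pi * t))" for t
  let ?w = "\<lambda>t. proj (tvec i j (x t) (a * cnj (x t)) (of_real (z t)))"
  have x1: "cmod (x t) = 1" for t using z1 by (simp add: x_def norm_mult)
  have phih: "\<bar>\<phi> t\<bar> \<le> pi / 2" for t
  proof -
    have "- (pi / 2) \<le> \<phi> t \<and> \<phi> t \<le> pi / 2" unfolding \<phi>_def by (rule arcsin_bounded) simp_all
    then show ?thesis by linarith
  qed
  have sinphi: "sin (\<phi> t) = - cos (2 * pi * t)" for t by (simp add: \<phi>_def)
  have cosphi: "cos (\<phi> t) = \<bar>sin (2 * pi * t)\<bar>" for t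
  proof -
    have "cos (\<phi> t) = sqrt (1 - (cos (2 * pi * t))\<^sup>2)"
      unfolding \<phi>_def by (subst cos_arcsin) simp_all
    also have "1 - (cos (2 * pi * t))\<^sup>2 = (sin (2 * pi * t))\<^sup>2" by (simp add: sin_squared_eq)
    finally show ?thesis by simp
  qed
  have xn: "x t ^ n = - cis (\<phi> t)" for t
    using n0 by (simp add: x_def power_mult_distrib zn Complex.DeMoivre)
  have absz: "\<bar>z t\<bar> ^ n = 2 * \<bar>sin (2 * pi * t)\<bar>" for t
    using n0 by (simp add: z_def abs_mult flip: real_root_abs)
  have zpow: "z t ^ n = 2 * \<bar>sin (2 * pi * t)\<bar>" for t
    using absz[of t] even by (simp add: power_even_abs)
  have rel: "2 * Re (x t ^ n) + z t ^ n = 0" for t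
    unfolding xn zpow by (simp add: cosphi)
  have cont: "continuous_on {0..1} x" "continuous_on {0..1} (\<lambda>t. a * cnj (x t))" "continuous_on {0..1} z"
    unfolding x_def z_def \<phi>_def using n0 by (intro continuous_intros; simp)+
  have pat: "has_pattern n (?w ` {0..1}) [0, 2, 1, 2] 2"
  proof (rule has_pattern_swap_curve[OF ijk n])
    show "0 < (2::nat)" by simp
    show "continuous_on {0..1} x" "continuous_on {0..1} (\<lambda>t. a * cnj (x t))" "continuous_on {0..1} z"
      by (rule cont)+
    show "cmod (x t) = 1" "cmod (a * cnj (x t)) = 1" for t using x1 na by (simp_all add: norm_mult)
    show "\<bar>z t\<bar> ^ n = 2 * \<bar>sin (pi * (real 2 * t))\<bar>" for t
      using absz[of t] by (simp add: mult_ac)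
    show "x t ^ n + (a * cnj (x t)) ^ n + of_real (z t) ^ n = 0" for t
    proof -
      have "x t ^ n + (a * cnj (x t)) ^ n + of_real (z t) ^ n = of_real (2 * Re (x t ^ n) + z t ^ n)"
        using Re_sum_cnj[of "x t" n] a by (simp add: power_mult_distrib)
      then show ?thesis by (simp only: rel of_real_0)
    qed
    show "\<exists>c. c \<noteq> 0 \<and> x 1 = c * x 0 \<and> a * cnj (x 1) = c * (a * cnj (x 0)) \<and> of_real (z 1) = c * of_real (z 0)"
      by (intro exI[of _ 1]) (simp add: x_def z_def \<phi>_def)
    show "s = t \<or> s = 0 \<and> t = 1 \<or> s = 1 \<and> t = 0"
      if st: "s \<in> {0..1}" "t \<in> {0..1}" and "c \<noteq> 0"
        and c: "x s = c * x t" "a * cnj (x s) = c * (a * cnj (x t))"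
        and cz: "complex_of_real (z s) = c * of_real (z t)" for s t c
    proof -
      \<comment> \<open>Both points lie on an arc of angle at most pi / 2, so the sign c = -1 is
        impossible. With c = 1, \<open>\<phi>\<close> recovers the cosine and \<open>z\<close> the
        sine of the running angle.\<close>
      let ?d = "(\<phi> s - \<phi> t) / n"
      have "\<bar>\<phi> s - \<phi> t\<bar> \<le> pi" using phih[of s] phih[of t] by linarith
      then have "\<bar>?d\<bar> \<le> pi / n" using n0 by (simp add: divide_right_mono)
      also have "\<dots> \<le> pi / 2" using n by (intro divide_left_mono) auto
      finally have d: "\<bar>?d\<bar> \<le> pi / 2" .
      have "cis ?d = c"
      proof -
        have "\<zeta> * cis (\<phi> s / n) = \<zeta> * (c * cis (\<phi> t / n))" using c(1) by (simp add: x_def mult_ac)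
        then have "cis (\<phi> s / n) = c * cis (\<phi> t / n)" using z0 by simp
        then show ?thesis by (simp add: diff_divide_distrib flip: cis_divide)
      qed
      moreover have "cos ?d \<ge> 0" using d by (intro cos_ge_zero) linarith+
      ultimately have "Re c \<ge> 0" by auto
      moreover have "c = 1 \<or> c = -1" using swap_scalar_sign[OF x1 x1 a0 c] .
      ultimately have c1: "c = 1" by auto
      then have "sin ?d = 0" using \<open>cis ?d = c\<close> by (auto simp: complex_eq_iff)
      moreover have "- pi < ?d" "?d < pi" using d pi_gt_zero unfolding abs_le_iff by linarith+
      ultimately have "?d = 0" using sin_eq_0_pi by blast
      then have "\<phi> s = \<phi> t" using n0 by simp
      then have "cos (2 * pi * s) = cos (2 * pi * t)" using sinphi[of s] sinphi[of t] by simp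
      moreover have "sin (2 * pi * s) = sin (2 * pi * t)"
        using cz c1 n0 by (simp add: z_def)
      ultimately have "cis (2 * pi * s) = cis (2 * pi * t)" by (simp add: complex_eq_iff)
      then show ?thesis using cis_2pi_eq_iff st by blast
    qed
  qed
  have oval: "proj (tvec i j y (a * cnj y) (of_real r)) \<in> ?w ` {0..1}"
    if y: "y = \<zeta> * cis (\<psi> / n)" "\<bar>\<psi>\<bar> \<le> pi / 2" "2 * Re (y ^ n) + r ^ n = 0" for y r \<psi>
  proof -
    have rn: "r ^ n = 2 * cos \<psi>"
      using y(3) n0 by (simp add: y(1) power_mult_distrib zn Complex.DeMoivre)
    \<comment> \<open>The two halves of the oval carry the same angles \<psi> and differ in the sign
      of \<open>r\<close>; this sign selects the half, and thereby the sign of the sine of the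
      parameter.\<close>
    define \<epsilon> :: real where "\<epsilon> = (if r \<ge> 0 then 1 else -1)"
    have e: "\<epsilon> * \<epsilon> = 1" "\<epsilon> * \<bar>r\<bar> = r" by (auto simp: \<epsilon>_def)
    have "(- sin \<psi>)\<^sup>2 + (\<epsilon> * cos \<psi>)\<^sup>2 = 1" using e(1) by (simp add: power_mult_distrib power2_eq_square[of \<epsilon>])
    then obtain \<theta> where th: "0 \<le> \<theta>" "\<theta> < 2 * pi" "- sin \<psi> = cos \<theta>" "\<epsilon> * cos \<psi> = sin \<theta>"
      using sincos_total_2pi by metis
    define t where "t = \<theta> / (2 * pi)"
    have t: "t \<in> {0..1}" and tt: "2 * pi * t = \<theta>" using th by (auto simp: t_def)
    have "\<phi> t = arcsin (sin \<psi>)" unfolding \<phi>_def tt by (simp flip: th(3))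
    also have "\<dots> = \<psi>" using y(2) by (intro arcsin_sin) auto
    finally have "x t = y" by (simp add: x_def y(1))
    moreover have "z t = r"
    proof -
      have "root n (2 * cos \<psi>) = \<bar>r\<bar>"
        using rn n0 even by (metis power_even_abs real_root_power_cancel abs_ge_zero)
      moreover have "root n (2 * (\<epsilon> * cos \<psi>)) = \<epsilon> * root n (2 * cos \<psi>)"
        by (simp add: \<epsilon>_def real_root_minus)
      ultimately show ?thesis unfolding z_def tt th(4)[symmetric] using e(2) by simp
    qed
    ultimately show ?thesis using t by auto
  qed
  have cont_w: "continuous_on {0..1} ?w"
  proof -
    have "x t \<noteq> 0" for t using x1[of t] by auto
    then have "tvec i j (x t) (a * cnj (x t)) (of_real (z t)) \<noteq> 0" for t
      by (simp add: tvec_eq_0_iff[OF ijk])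
    then show ?thesis
      by (intro continuous_on_proj continuous_on_tvec continuous_on_of_real cont)
  qed
  have "?w ` {0..1} \<subseteq> S"
  proof (rule components_maximal[OF S])
    show "connected (?w ` {0..1})" by (rule connected_continuous_image[OF cont_w]) simp
    show "?w ` {0..1} \<subseteq> ?F" unfolding fixed using x1 rel by blast
    have "p \<in> ?w ` {0..1}" unfolding p0(1) using oval[OF x0 phi0h p0(3)] .
    then show "S \<inter> ?w ` {0..1} \<noteq> {}" using p(1) by blast
  qed
  moreover have "S \<subseteq> ?w ` {0..1}"
  proof
    let ?U = "{p. hcoords p $ i \<noteq> 0 \<and> hcoords p $ j \<noteq> 0}"
    \<comment> \<open>Writing \<open>x = \<zeta> cis \<delta>\<close>, \<open>g\<close> is \<open>cos (2 \<delta>)\<close>; on the fixed point set it never takes the value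
      \<open>cos (2 pi / n)\<close>, which separates the oval around \<open>\<zeta>\<close> from the others.\<close>
    define g where "g q = Re ((phase i j q) * a / \<zeta>\<^sup>2)" for q
    have g: "g (proj (tvec i j y (a * cnj y) (of_real r))) = cos (2 * \<delta>)" "proj (tvec i j y (a * cnj y) (of_real r)) \<in> ?U"
      if "y = \<zeta> * cis \<delta>" for y r \<delta>
    proof -
      have y1: "cmod y = 1" using z1 that by (simp add: norm_mult)
      then have y0: "y \<noteq> 0" by auto
      then have nz: "tvec i j y (a * cnj y) (of_real r) \<noteq> 0" by (simp add: tvec_eq_0_iff[OF ijk])
      show "proj (tvec i j y (a * cnj y) (of_real r)) \<in> ?U"
        unfolding nonzero_coords_proj[OF nz] using ijk y0 a0 by simp
      have "cmod (y / (a * cnj y)) = 1" using y1 na by (simp add: norm_divide norm_mult)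
      then have "phase i j (proj (tvec i j y (a * cnj y) (of_real r))) = y / (a * cnj y)"
        unfolding phase_proj[OF nz] using ijk by (simp add: sgn_eq)
      then have "g (proj (tvec i j y (a * cnj y) (of_real r))) = Re (y / cnj y / \<zeta>\<^sup>2)"
        using a0 by (simp add: g_def)
      also have "y / cnj y = y\<^sup>2"
      proof -
        have "y * cnj y = 1" using y1 by (simp add: complex_norm_square[symmetric])
        then show ?thesis using y0 by (simp add: field_simps power2_eq_square)
      qed
      also have "y\<^sup>2 / \<zeta>\<^sup>2 = cis (2 * \<delta>)"
        using z0 by (simp add: that power_mult_distrib Complex.DeMoivre)
      finally show "g (proj (tvec i j y (a * cnj y) (of_real r))) = cos (2 * \<delta>)" by simp
    qed
    have polar: "\<exists>\<delta>. \<bar>\<delta>\<bar> \<le> pi \<and> y = \<zeta> * cis \<delta>" if "cmod y = 1" for y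
    proof -
      have "cmod (y / \<zeta>) = 1" using that z1 by (simp add: norm_divide)
      then obtain \<delta> where "\<bar>\<delta>\<bar> \<le> pi" "y / \<zeta> = cis \<delta>" using unit_polar by blast
      then show ?thesis using z0 by (intro exI[of _ \<delta>]) (simp add: field_simps)
    qed
    have ndelta: "cos (real n * \<delta>) \<ge> 0" if "y = \<zeta> * cis \<delta>" "2 * Re (y ^ n) + r ^ n = 0" for y r \<delta>
      using that(2) zero_le_even_power[OF even, of r]
      by (simp add: that(1) power_mult_distrib zn Complex.DeMoivre)
    have gF: "q \<in> ?U \<and> g q \<noteq> cos (2 * pi / n)" if qF: "q \<in> ?F" for q
    proof -
      obtain y r where q: "q = proj (tvec i j y (a * cnj y) (of_real r))" "cmod y = 1" "2 * Re (y ^ n) + r ^ n = 0"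
        using qF unfolding fixed by blast
      obtain \<delta> where d: "\<bar>\<delta>\<bar> \<le> pi" "y = \<zeta> * cis \<delta>" using polar[OF q(2)] by blast
      \<comment> \<open>Equality would make n \<delta> differ from pi or - pi by a multiple of n pi,
        hence of 2 pi as n is even. Then cos (n \<delta>) = -1, whereas it is nonnegative at fixed
        points.\<close>
      have "cos (2 * \<delta>) \<noteq> cos (2 * pi / n)"
      proof
        assume "cos (2 * \<delta>) = cos (2 * pi / n)"
        then obtain l where "l \<in> \<int>"
            and l: "2 * \<delta> = 2 * pi / n + 2 * l * pi \<or> 2 * \<delta> = - (2 * pi / n) + 2 * l * pi"
          unfolding cos_eq by blast
        then obtain m where m: "l = of_int m" by (auto elim: Ints_cases)
        note l = l[unfolded m]
        from l have "real n * \<delta> = pi + n * (of_int m * pi) \<or> real n * \<delta> = - pi + n * (of_int m * pi)"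
          using n0 by (auto simp: field_simps)
        moreover obtain h where h: "n = 2 * h" using even by (auto elim: evenE)
        have "real n * (of_int m * pi) = of_int (int h * m) * (2 * pi)" by (simp add: h)
        then have "cis (real n * (of_int m * pi)) = 1"
          by (metis cis_multiple_2pi Ints_of_int mult.commute)
        then have "cos (pi + n * (of_int m * pi)) = -1" "cos (- pi + n * (of_int m * pi)) = -1"
          by (simp_all add: cos_add complex_eq_iff)
        ultimately have "cos (real n * \<delta>) = -1" by metis
        then show False using ndelta[OF d(2) q(3)] by simp
      qed
      then show ?thesis using g[OF d(2), of r] q(1) by simp
    qed
    have contg: "continuous_on S g"
      unfolding g_def using S_sub gF z0
      by (intro continuous_intros continuous_on_subset[OF continuous_on_phase[of i j]]) auto
    have gp: "g p > cos (2 * pi / n)"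
    proof -
      have "g p = cos \<bar>2 * (\<phi>0 / n)\<bar>"
        unfolding p0(1) cos_abs_real by (rule g(1)[OF x0])
      also have "\<dots> > cos (2 * pi / n)"
      proof (rule cos_monotone_0_pi)
        have "\<bar>2 * (\<phi>0 / n)\<bar> = 2 * \<bar>\<phi>0\<bar> / n" by (simp add: abs_mult)
        also have "2 * \<bar>\<phi>0\<bar> < 2 * pi" using phi0h pi_gt_zero by linarith
        then have "2 * \<bar>\<phi>0\<bar> / n < 2 * pi / n" using n0 by (intro divide_strict_right_mono) auto
        finally show "\<bar>2 * (\<phi>0 / n)\<bar> < 2 * pi / n" .
        show "2 * pi / n \<le> pi" using n pi_gt_zero by (simp add: field_simps)
      qed simp
      finally show ?thesis .
    qed
    fix q assume q: "q \<in> S"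
    have gq: "g q > cos (2 * pi / n)"
    proof (rule ccontr)
      assume "\<not> g q > cos (2 * pi / n)"
      then have "cos (2 * pi / n) \<in> {g q..g p}" using gp by simp
      moreover have "{g q..g p} \<subseteq> g ` S"
        using q p(1) connected_continuous_image[OF contg S_conn] by (intro connected_contains_Icc) auto
      ultimately have "cos (2 * pi / n) \<in> g ` S" by (rule subsetD[rotated])
      then obtain q1 where "q1 \<in> S" "g q1 = cos (2 * pi / n)" by (metis imageE)
      then show False using gF[OF subsetD[OF S_sub]] by simp
    qed
    obtain y' r' where q': "q = proj (tvec i j y' (a * cnj y') (of_real r'))" "cmod y' = 1" "2 * Re (y' ^ n) + r' ^ n = 0"
      using subsetD[OF S_sub q] unfolding fixed by blast
    have y'0: "y' \<noteq> 0" using q'(2) by auto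
    \<comment> \<open>\<open>g\<close> does not see the common sign of \<open>y\<close> and
      \<open>r\<close>. Choosing the representative nearer to \<open>\<zeta>\<close> gives
      |\<delta>| at most pi / 2, the range on which cos (2 \<delta>) determines |\<delta>|.\<close>
    have "\<exists>y r. q = proj (tvec i j y (a * cnj y) (of_real r)) \<and> cmod y = 1 \<and> 2 * Re (y ^ n) + r ^ n = 0 \<and> Re (y / \<zeta>) \<ge> 0"
    proof (cases "Re (y' / \<zeta>) \<ge> 0")
      case False
      have "q = proj (tvec i j (- y') (a * cnj (- y')) (of_real (- r')))"
        using minus_tvec_proj[OF ijk y'0, of "a * cnj y'" "of_real r'"] q'(1) by simp
      moreover have "2 * Re ((- y') ^ n) + (- r') ^ n = 0" using q'(3) even by simp
      moreover have "Re (- y' / \<zeta>) \<ge> 0" using False by simp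
      ultimately show ?thesis using q'(2)
        by (intro exI[of _ "- y'"] exI[of _ "- r'"] conjI) simp_all
    qed (use q' in blast)
    then obtain y r where Q: "q = proj (tvec i j y (a * cnj y) (of_real r))" "cmod y = 1"
        "2 * Re (y ^ n) + r ^ n = 0" "Re (y / \<zeta>) \<ge> 0"
      by blast
    obtain \<delta> where d: "\<bar>\<delta>\<bar> \<le> pi" "y = \<zeta> * cis \<delta>" using polar[OF Q(2)] by blast
    have "cos \<delta> \<ge> 0" using Q(4) z0 by (simp add: d(2))
    then have dh: "\<bar>\<delta>\<bar> \<le> pi / 2" using abs_le_pi_half[OF d(1)] by blast
    have d2: "\<bar>2 * \<delta>\<bar> \<le> pi" using dh by linarith
    have cd: "cos \<bar>2 * \<delta>\<bar> > cos (2 * pi / n)" using gq g(1)[OF d(2), of r] unfolding Q(1) cos_abs_real by simp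
    have "\<bar>2 * \<delta>\<bar> < 2 * pi / n"
    proof (rule ccontr)
      assume "\<not> \<bar>2 * \<delta>\<bar> < 2 * pi / n"
      then have "cos \<bar>2 * \<delta>\<bar> \<le> cos (2 * pi / n)"
        using d2 by (intro cos_monotone_0_pi_le) simp_all
      then show False using cd by simp
    qed
    then have "\<bar>real n * \<delta>\<bar> < pi" using n0 by (simp add: abs_mult field_simps)
    \<comment> \<open>Being below pi, the angle is cut down to pi / 2 by the nonnegative cosine, so
      it belongs to the arc around \<open>\<zeta>\<close>.\<close>
    then have "\<bar>real n * \<delta>\<bar> \<le> pi / 2"
      using abs_le_pi_half ndelta[OF d(2) Q(3)] by simp
    then show "q \<in> ?w ` {0..1}"
      unfolding Q(1) using oval[of y "real n * \<delta>" r] d(2) Q(3) n0 by simp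
  qed
  ultimately have "S = ?w ` {0..1}" by blast
  then show ?thesis using pat by simp
qed

subsection \<open>Mirrors of the reflections preserving the coordinates\<close>

text \<open>Since \<open>\<beta> i\<close> is unimodular with square \<open>d i\<close>, the
  reflection becomes plain complex conjugation in the coordinates v_i / \<open>\<beta> i\<close>,
  and its fixed points are the real ones.\<close>

lemma diag_fixed_points:
  assumes n: "n > 0" and d: "\<And>i. d i ^ n = 1" and \<beta>: "\<And>i. \<beta> i * \<beta> i = d i"
    and f: "\<And>v. v \<noteq> 0 \<Longrightarrow> f (proj v) = proj (\<chi> i. d i * cnj (v $ i))"
  shows "{p \<in> fermat_curve n. f p = p} =
    {proj (\<chi> i. \<beta> i * of_real (r i)) | r. (\<exists>i. r i \<noteq> 0) \<and> (\<Sum>i\<in>UNIV. \<beta> i ^ n * of_real (r i ^ n)) = 0}"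
proof (intro equalityI subsetI)
  have nd: "cmod (d i) = 1" for i using norm_root_of_unity[OF n d] .
  have nb: "cmod (\<beta> i) = 1" for i
  proof -
    have "cmod (\<beta> i) * cmod (\<beta> i) = 1" using \<beta>[of i] nd[of i] by (metis norm_mult)
    then have "(cmod (\<beta> i))\<^sup>2 = 1" by (simp add: power2_eq_square)
    then show ?thesis by (simp add: power2_eq_1_iff) (metis norm_ge_zero not_one_le_zero neg_0_le_iff_le)
  qed
  have b0: "\<beta> i \<noteq> 0" for i using nb[of i] by auto
  have bc: "\<beta> i * cnj (\<beta> i) = 1" for i using nb[of i] by (simp add: complex_norm_square[symmetric])
  have d0: "d i \<noteq> 0" for i using nd[of i] by auto
  have vec0: "(\<chi> i. \<beta> i * of_real (r i)) \<noteq> 0 \<longleftrightarrow> (\<exists>i. r i \<noteq> 0)" for r using b0 by (simp add: vec_eq_iff)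
  have curve: "proj (\<chi> i. \<beta> i * of_real (r i)) \<in> fermat_curve n \<longleftrightarrow> (\<Sum>i\<in>UNIV. \<beta> i ^ n * of_real (r i ^ n)) = 0"
    if "\<exists>i. r i \<noteq> 0" for r
    using vec0[of r] that by (subst proj_mem_fermat_iff) (auto simp: power_mult_distrib)
  {
    fix p assume "p \<in> {proj (\<chi> i. \<beta> i * of_real (r i)) | r. (\<exists>i. r i \<noteq> 0) \<and> (\<Sum>i\<in>UNIV. \<beta> i ^ n * of_real (r i ^ n)) = 0}"
    then obtain r where r: "p = proj (\<chi> i. \<beta> i * of_real (r i))" "\<exists>i. r i \<noteq> 0"
      "(\<Sum>i\<in>UNIV. \<beta> i ^ n * of_real (r i ^ n)) = 0" by blast
    have "f p = proj (\<chi> i. d i * cnj ((\<chi> i. \<beta> i * of_real (r i)) $ i))"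
      unfolding r(1) by (rule f) (use vec0[of r] r(2) in blast)
    also have "(\<chi> i. d i * cnj ((\<chi> i. \<beta> i * of_real (r i)) $ i)) = (\<chi> i. \<beta> i * of_real (r i))"
    proof -
      have "d i * cnj (\<beta> i) = \<beta> i" for i
        unfolding \<beta>[symmetric] using bc[of i] by (simp add: mult.assoc)
      then show ?thesis by (simp add: vec_eq_iff mult.assoc[symmetric])
    qed
    finally have "f p = p" using r(1) by simp
    then show "p \<in> {p \<in> fermat_curve n. f p = p}" using curve[OF r(2)] r by simp
  }
  fix p assume "p \<in> {p \<in> fermat_curve n. f p = p}"
  then have p: "p \<in> fermat_curve n" "f p = p" by auto
  obtain v where v: "v \<noteq> 0" "p = proj v" using cp2_cases by blast
  have nz: "(\<chi> i. d i * cnj (v $ i)) \<noteq> 0" using v(1) d0 by (simp add: vec_eq_iff)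
  have "proj (\<chi> i. d i * cnj (v $ i)) = proj v" using p(2) v f[OF v(1)] by simp
  then obtain c where c: "c \<noteq> 0" "\<And>i. d i * cnj (v $ i) = c * v $ i"
    unfolding proj_eq_iff[OF nz v(1)] by auto
  have "cmod c = 1"
  proof -
    obtain i where i: "v $ i \<noteq> 0" using v(1) by (auto simp: vec_eq_iff)
    have "cmod (v $ i) = cmod c * cmod (v $ i)"
      using arg_cong[OF c(2)[of i], of cmod] nd[of i] by (simp add: norm_mult)
    then show ?thesis using i by simp
  qed
  define s where "s = csqrt c"
  have s2: "s * s = c" using power2_csqrt[of c] by (simp add: s_def power2_eq_square)
  have "cmod s = 1" using \<open>cmod c = 1\<close> by (simp add: s_def norm_csqrt)
  then have ss: "cnj s * s = 1" by (simp add: complex_norm_square[symmetric] mult.commute)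
  then have s0: "s \<noteq> 0" by auto
  have cs: "cnj s * c = s" using ss by (simp flip: s2 mult.assoc)
  have "\<exists>r. s * v $ i = \<beta> i * of_real r" for i
  proof -
    have "cnj (cnj (\<beta> i) * (s * v $ i)) = cnj (\<beta> i) * (s * v $ i)"
    proof -
      have "cnj (cnj (\<beta> i) * (s * v $ i)) = \<beta> i * (cnj s * cnj (v $ i))" by simp
      also have "\<dots> = (\<beta> i * cnj (\<beta> i)) * (\<beta> i * (cnj s * cnj (v $ i)))" by (simp add: bc)
      also have "\<dots> = cnj (\<beta> i) * (cnj s * (\<beta> i * \<beta> i * cnj (v $ i)))" by (simp add: mult_ac)
      also have "\<dots> = cnj (\<beta> i) * (s * v $ i)" unfolding \<beta> c(2) using cs by (simp add: mult.assoc[symmetric])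
      finally show ?thesis .
    qed
    then have "cnj (\<beta> i) * (s * v $ i) \<in> \<real>" by (simp add: Reals_cnj_iff)
    then obtain r where "cnj (\<beta> i) * (s * v $ i) = of_real r" by (auto elim: Reals_cases)
    then have "\<beta> i * (cnj (\<beta> i) * (s * v $ i)) = \<beta> i * of_real r" by simp
    then have "s * v $ i = \<beta> i * of_real r" using bc[of i] by (simp add: mult.assoc[symmetric])
    then show ?thesis by blast
  qed
  then obtain r where r: "\<And>i. s * v $ i = \<beta> i * of_real (r i)" by metis
  have r0: "\<exists>i. r i \<noteq> 0"
  proof -
    obtain i where i: "v $ i \<noteq> 0" using v(1) by (auto simp: vec_eq_iff)
    then have "r i \<noteq> 0" using r[of i] s0 by auto
    then show ?thesis by blast
  qed
  have pr: "proj (\<chi> i. \<beta> i * of_real (r i)) = proj v"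
  proof -
    have "(\<chi> i. \<beta> i * of_real (r i)) \<noteq> 0" using vec0 r0 by blast
    then show ?thesis using v(1) s0 by (subst proj_eq_iff) (auto simp flip: r)
  qed
  have "(\<Sum>i\<in>UNIV. \<beta> i ^ n * of_real (r i ^ n)) = 0"
    using curve[OF r0] p(1) unfolding v(2) pr by blast
  then show "p \<in> {proj (\<chi> i. \<beta> i * of_real (r i)) | r. (\<exists>i. r i \<noteq> 0) \<and> (\<Sum>i\<in>UNIV. \<beta> i ^ n * of_real (r i ^ n)) = 0}"
    unfolding v(2) pr[symmetric] using r0 by blast
qed

lemma components_image_Icc:
  fixes w :: "real \<Rightarrow> 'a::topological_space"
  assumes "continuous_on {0..1} w" "S \<in> components (w ` {0..1})"
  shows "S = w ` {0..1}"
proof -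
  have "connected (w ` {0..1})" by (rule connected_continuous_image[OF assms(1)]) simp
  then show ?thesis using assms(2) connected_eq_components_subset_sing by blast
qed

lemma sin_pi_eq_0:
  assumes "sin (pi * u) = 0" "\<bar>u\<bar> < 1"
  shows "u = 0"
proof -
  have "- pi < pi * u" "pi * u < pi"
    using assms(2) mult_strict_left_mono[of u 1 pi] mult_strict_left_mono[of "-1" u pi] by auto
  then have "pi * u = 0" using assms(1) sin_eq_0_pi by blast
  then show ?thesis by simp
qed

lemma mirror_pattern_diag_odd:
  assumes n: "n \<ge> 2" and odd: "odd n" and d: "\<And>i. d i ^ n = 1"
    and f: "\<And>v. v \<noteq> 0 \<Longrightarrow> f (proj v) = proj (\<chi> i. d i * cnj (v $ i))"
    and S: "S \<in> components {p \<in> fermat_curve n. f p = p}"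
  shows "has_pattern n S [0, 1] 3"
proof -
  have n0: "n > 0" using n by simp
  obtain h where h: "n = 2 * h + 1" using odd by (auto elim: oddE)
  \<comment> \<open>For odd \<open>n\<close> there is a square root of \<open>d i\<close> that is again an \<open>n\<close>-th root of unity.\<close>
  define \<beta> where "\<beta> i = d i ^ Suc h" for i
  have b2: "\<beta> i * \<beta> i = d i" for i
  proof -
    have "\<beta> i * \<beta> i = d i ^ n * d i" unfolding \<beta>_def h by (simp add: power_add mult_2)
    then show ?thesis by (simp add: d)
  qed
  have bn: "\<beta> i ^ n = 1" for i
  proof -
    have "\<beta> i ^ n = (d i ^ n) ^ Suc h" by (simp only: \<beta>_def mult.commute flip: power_mult)
    then show ?thesis by (simp add: d)
  qed
  have nb: "cmod (\<beta> i) = 1" for i using norm_root_of_unity[OF n0 bn] .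
  have b0: "\<beta> i \<noteq> 0" for i using nb[of i] by auto
  have fixed: "{p \<in> fermat_curve n. f p = p} =
    {proj (\<chi> i. \<beta> i * of_real (r i)) | r. (\<exists>i. r i \<noteq> 0) \<and> (\<Sum>i\<in>UNIV. \<beta> i ^ n * of_real (r i ^ n)) = 0}"
    by (rule diag_fixed_points[OF n0 d b2]) (rule f)

  \<comment> \<open>Half of an ellipse around the origin in the real plane X + Y + Z = 0: up to sign
    the three functions are one sine shifted by thirds. Their zeros and their pairwise coincidences
    therefore alternate at the multiples of 1/6. The opposite half gives the same points, as the odd
    root commutes with the sign.\<close>
  define X where "X t = 2 * sin (pi * t)" for t :: real
  define Y where "Y t = sqrt 3 * cos (pi * t) - sin (pi * t)" for t :: real
  define Z where "Z t = - sqrt 3 * cos (pi * t) - sin (pi * t)" for t :: real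
  have XYZ: "X t + Y t + Z t = 0" for t by (simp add: X_def Y_def Z_def)
  have s3: "sqrt 3 * sqrt 3 = 3" by simp
  have XY0: "X t \<noteq> 0 \<or> Y t \<noteq> 0" for t
  proof -
    have "sin (pi * t) \<noteq> 0 \<or> cos (pi * t) \<noteq> 0"
      by (metis sin_cos_squared_add zero_power2 add_0 zero_neq_one)
    then show ?thesis by (auto simp: X_def Y_def)
  qed
  define w where "w t = tvec 1 2 (\<beta> 1 * of_real (root n (X t))) (\<beta> 2 * of_real (root n (Y t)))
    (\<beta> 3 * of_real (root n (Z t)))" for t
  have wr: "w t = (\<chi> i. \<beta> i * of_real (tri 1 2 (root n (X t)) (root n (Y t)) (root n (Z t)) i))" for t
    by (simp add: w_def vec_eq_iff forall_3)
  have nz: "w t \<noteq> 0" for t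
    using XY0[of t] b0 n0 by (auto simp: w_def tvec_eq_0_iff[OF distinct_123])
  have cont: "continuous_on A w" for A
    unfolding w_def X_def Y_def Z_def by (intro continuous_on_tvec continuous_intros)
  have rp: "complex_of_real (root n u) ^ n = of_real u" for u
    by (simp add: odd_real_root_pow[OF odd] flip: of_real_power)
  have F: "proj (w t) \<in> fermat_curve n" for t
    using nz[of t] XYZ[of t] unfolding w_def
    by (subst proj_mem_fermat_iff) (simp_all add: sum_3 power_mult_distrib bn rp flip: of_real_add)
  have wn: "cmod (\<beta> i * of_real (root n u)) ^ n = \<bar>u\<bar>" for i u
    using nb n0 by (simp add: norm_mult power_mult_distrib flip: real_root_abs)
  have nt: "norm_type n (w t) = (if X t = 0 \<or> Y t = 0 \<or> Z t = 0 then 0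
    else if \<bar>X t\<bar> = \<bar>Y t\<bar> \<and> \<bar>Z t\<bar> = 2 * \<bar>X t\<bar> \<or> \<bar>Y t\<bar> = \<bar>Z t\<bar> \<and> \<bar>X t\<bar> = 2 * \<bar>Y t\<bar> \<or>
      \<bar>X t\<bar> = \<bar>Z t\<bar> \<and> \<bar>Y t\<bar> = 2 * \<bar>X t\<bar> then 1
    else if \<bar>X t\<bar> = \<bar>Y t\<bar> \<and> \<bar>Y t\<bar> = \<bar>Z t\<bar> then 2 else 3)" for t
    unfolding w_def norm_type_tvec[OF distinct_123 n0 wn[symmetric] wn[symmetric] wn[symmetric]] by simp
  have trig: "sin (pi * (5 / 6)) = 1 / 2" "cos (pi * (5 / 6)) = - sqrt 3 / 2"
    "sin (pi * (2 / 3)) = sqrt 3 / 2" "cos (pi * (2 / 3)) = - 1 / 2"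
    "sin (pi * (1 / 2)) = 1" "cos (pi * (1 / 2)) = 0"
    "sin (pi * (1 / 3)) = sqrt 3 / 2" "cos (pi * (1 / 3)) = 1 / 2"
    "sin (pi * (1 / 6)) = 1 / 2" "cos (pi * (1 / 6)) = sqrt 3 / 2"
  proof -
    have e: "pi * (5 / 6) = pi - pi / 6" "pi * (2 / 3) = pi - pi / 3" by simp_all
    show "sin (pi * (5 / 6)) = 1 / 2" "cos (pi * (5 / 6)) = - sqrt 3 / 2"
      "sin (pi * (2 / 3)) = sqrt 3 / 2" "cos (pi * (2 / 3)) = - 1 / 2"
      unfolding e sin_pi_minus cos_pi_minus by (simp_all add: sin_30 cos_30 sin_60 cos_60)
  qed (simp_all add: sin_30 cos_30 sin_60 cos_60)
  have len2: "length [0, 1 :: nat] = 2" by simp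
  have pat: "has_pattern n ((\<lambda>t. proj (w t)) ` {0..1}) [0, 1] 3"
  proof (rule has_pattern_curve[where w = w and \<tau> = "\<lambda>m. real m / 6"])
    have "X 1 = - X 0" "Y 1 = - Y 0" "Z 1 = - Z 0" by (simp_all add: X_def Y_def Z_def)
    then have "\<forall>i. w 1 $ i = - 1 * w 0 $ i" by (simp add: w_def forall_3 real_root_minus)
    then show "proj (w 1) = proj (w 0)"
      unfolding proj_eq_iff[OF nz nz] by (intro exI[of _ "-1"]) simp
    show "s = t \<or> s = 0 \<and> t = 1 \<or> s = 1 \<and> t = 0"
      if st: "s \<in> {0..1}" "t \<in> {0..1}" and "c \<noteq> 0" and c: "\<And>i. w s $ i = c * w t $ i" for s t c
    proof -
      have "complex_of_real (root n (X s)) = c * of_real (root n (X t))"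
        "complex_of_real (root n (Y s)) = c * of_real (root n (Y t))"
        using c[of 1] c[of 2] b0 by (simp_all add: w_def)
      then have "of_real (X s) = c ^ n * of_real (X t)" "of_real (Y s) = c ^ n * of_real (Y t)"
        by (metis power_mult_distrib rp)+
      then have "complex_of_real (X s) * of_real (Y t) = of_real (X t) * of_real (Y s)" by simp
      then have "X s * Y t = X t * Y s" by (metis of_real_eq_iff of_real_mult)
      then have "sin (pi * s) * cos (pi * t) = sin (pi * t) * cos (pi * s)"
        by (simp add: X_def Y_def algebra_simps)
      then have "sin (pi * (s - t)) = 0" by (simp add: right_diff_distrib sin_diff mult.commute)
      moreover have "\<bar>s - t\<bar> < 1 \<or> s = 0 \<and> t = 1 \<or> s = 1 \<and> t = 0" using st by auto
      ultimately show ?thesis using sin_pi_eq_0[of "s - t"] by auto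
    qed
    show "strict_mono (\<lambda>m. real m / 6)" by (simp add: strict_mono_def divide_strict_right_mono)
    show "real m / 6 \<in> {0..<1}" if "m < 3 * length [0, 1 :: nat]" for m using that by simp
    show "norm_type n (w (real m / 6)) = [0, 1] ! (m mod length [0, 1 :: nat])"
      if "m < 3 * length [0, 1 :: nat]" for m
    proof -
      have m: "m = 0 \<or> m = 1 \<or> m = 2 \<or> m = 3 \<or> m = 4 \<or> m = 5" using that by auto
      have v0: "norm_type n (w 0) = 0" "norm_type n (w (1/3)) = 0" "norm_type n (w (2/3)) = 0"
        unfolding nt X_def Y_def Z_def trig by simp_all
      have v1: "norm_type n (w (1/6)) = 1" "norm_type n (w (1/2)) = 1" "norm_type n (w (5/6)) = 1"
        unfolding nt X_def Y_def Z_def trig by (simp_all add: s3)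
      show ?thesis
        unfolding len2 using m v0 v1 by (elim disjE) simp_all
    qed
    show "\<exists>m<3 * length [0, 1 :: nat]. t = real m / 6"
      if t: "t \<in> {0..<1}" and nt3: "norm_type n (w t) \<noteq> 3" for t
    proof -
      have "X t = 0 \<or> Y t = 0 \<or> Z t = 0 \<or> \<bar>X t\<bar> = \<bar>Y t\<bar> \<or> \<bar>Y t\<bar> = \<bar>Z t\<bar> \<or> \<bar>X t\<bar> = \<bar>Z t\<bar>"
        using nt3 unfolding nt by (auto split: if_splits)
      \<comment> \<open>Two opposite values would make the third one zero, so equal moduli mean
        equal values or a vertex.\<close>
      then have "X t = 0 \<or> Y t = 0 \<or> Z t = 0 \<or> X t = Y t \<or> Y t = Z t \<or> X t = Z t"
        using XYZ[of t] unfolding abs_eq_iff by auto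
      moreover have "X t = 2 * sin (pi * (t - 0))" 
        "Y t = - 2 * sin (pi * (t - 1/3))" "Z t = 2 * sin (pi * (t - 2/3))"
        "X t - Y t = 2 * sqrt 3 * sin (pi * (t - 1/6))" "Y t - Z t = - 2 * sqrt 3 * sin (pi * (t - 1/2))"
        "X t - Z t = - 2 * sqrt 3 * sin (pi * (t - 5/6))"
        unfolding right_diff_distrib sin_diff trig X_def Y_def Z_def
        using s3 by (simp_all add: algebra_simps)
      ultimately have "sin (pi * (t - 0)) = 0 \<or> sin (pi * (t - 1/6)) = 0 \<or> sin (pi * (t - 1/3)) = 0 \<or>
          sin (pi * (t - 1/2)) = 0 \<or> sin (pi * (t - 2/3)) = 0 \<or> sin (pi * (t - 5/6)) = 0"
        by (elim disjE) simp_all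
      then have "t - 0 = 0 \<or> t - 1/6 = 0 \<or> t - 1/3 = 0 \<or> t - 1/2 = 0 \<or> t - 2/3 = 0 \<or> t - 5/6 = 0"
        using t by (elim disjE; drule_tac sin_pi_eq_0) auto
      then have "t = real 0 / 6 \<or> t = real 1 / 6 \<or> t = real 2 / 6 \<or> t = real 3 / 6 \<or> t = real 4 / 6 \<or> t = real 5 / 6"
        by auto
      then show ?thesis by (elim disjE) (rule exI, rule conjI[rotated], assumption, simp)+
    qed
  qed (use n nz F cont in auto)
  have img: "{p \<in> fermat_curve n. f p = p} = (\<lambda>t. proj (w t)) ` {0..1}"
  proof (intro equalityI subsetI)
    fix p assume "p \<in> (\<lambda>t. proj (w t)) ` {0..1}"
    then obtain t where t: "p = proj (w t)" by blast
    let ?r = "tri 1 2 (root n (X t)) (root n (Y t)) (root n (Z t))"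
    have "\<exists>i. ?r i \<noteq> 0" using nz[of t] unfolding wr by (auto simp: vec_eq_iff)
    moreover have "(\<Sum>i\<in>UNIV. \<beta> i ^ n * of_real (?r i ^ n)) = 0"
      using XYZ[of t] by (simp add: sum_3 bn rp flip: of_real_add)
    ultimately show "p \<in> {p \<in> fermat_curve n. f p = p}" unfolding fixed t wr by blast
  next
    fix p assume "p \<in> {p \<in> fermat_curve n. f p = p}"
    then obtain r where r: "p = proj (\<chi> i. \<beta> i * of_real (r i))" "\<exists>i. r i \<noteq> 0"
        "(\<Sum>i\<in>UNIV. \<beta> i ^ n * complex_of_real (r i ^ n)) = 0"
      unfolding fixed by blast
    have "complex_of_real (r 1 ^ n + r 2 ^ n + r 3 ^ n) = 0" using r(3) by (simp add: sum_3 bn)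
    then have sum: "r 1 ^ n + r 2 ^ n + r 3 ^ n = 0" by (simp only: of_real_eq_0_iff)
    \<comment> \<open>\<open>P\<close> and \<open>Q\<close> are the coefficients that stand in the
      place of sin and cos in \<open>X\<close>, \<open>Y\<close>, \<open>Z\<close>; the formulas
      invert that linear parametrisation of the plane.\<close>
    define P Q where "P = r 1 ^ n / 2" and "Q = (r 1 ^ n + 2 * r 2 ^ n) / (2 * sqrt 3)"
    define A where "A = sqrt (P\<^sup>2 + Q\<^sup>2)"
    have r12: "r 1 ^ n = 2 * P" "r 2 ^ n = sqrt 3 * Q - P" "r 3 ^ n = - sqrt 3 * Q - P"
    proof -
      have q: "sqrt 3 * Q = (r 1 ^ n + 2 * r 2 ^ n) / 2" by (simp add: Q_def)
      have r3: "r 3 ^ n = - (r 1 ^ n) - r 2 ^ n" using sum by linarith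
      show "r 1 ^ n = 2 * P" "r 2 ^ n = sqrt 3 * Q - P" "r 3 ^ n = - sqrt 3 * Q - P"
        unfolding P_def mult_minus_left q r3 by (simp_all add: field_simps)
    qed
    have PQ: "P\<^sup>2 + Q\<^sup>2 \<noteq> 0"
    proof
      assume "P\<^sup>2 + Q\<^sup>2 = 0"
      then have "P = 0" "Q = 0" by (simp_all only: sum_power2_eq_zero_iff)
      then have "r 1 ^ n = 0" "r 2 ^ n = 0" "r 3 ^ n = 0" unfolding r12 by simp_all
      then have "\<forall>i. r i = 0" using n0 by (simp add: forall_3)
      then show False using r(2) by blast
    qed
    then have A0: "A \<noteq> 0" by (simp add: A_def)
    have A2: "A\<^sup>2 = P\<^sup>2 + Q\<^sup>2" by (simp add: A_def)
    have "(Q / A)\<^sup>2 + (P / A)\<^sup>2 = (P\<^sup>2 + Q\<^sup>2) / A\<^sup>2" by (simp add: power_divide add_divide_distrib)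
    also have "\<dots> = 1" using A0 by (simp flip: A2)
    finally obtain \<theta> where th: "0 \<le> \<theta>" "\<theta> < 2 * pi" "Q / A = cos \<theta>" "P / A = sin \<theta>"
      using sincos_total_2pi by blast
    have QA: "Q = A * cos \<theta>" "P = A * sin \<theta>" using A0 by (simp_all flip: th(3,4))
    \<comment> \<open>Angles beyond pi are reached with a negative amplitude, which does not change
      the projective point.\<close>
    have "\<exists>B t. B \<noteq> 0 \<and> t \<in> {0..1} \<and> Q = B * cos (pi * t) \<and> P = B * sin (pi * t)"
    proof (cases "\<theta> \<le> pi")
      case True
      have e: "pi * (\<theta> / pi) = \<theta>" by simp
      show ?thesis
        by (rule exI[of _ A], rule exI[of _ "\<theta> / pi"], unfold e) (use True th(1) A0 QA in simp)
    next
      case False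
      have e: "pi * ((\<theta> - pi) / pi) = \<theta> - pi" by simp
      show ?thesis
        by (rule exI[of _ "- A"], rule exI[of _ "(\<theta> - pi) / pi"], unfold e)
          (use False th(2) A0 QA in simp)
    qed
    then obtain B t where B: "B \<noteq> 0" "t \<in> {0..1}" "Q = B * cos (pi * t)" "P = B * sin (pi * t)" by blast
    have "r 1 ^ n = B * X t" "r 2 ^ n = B * Y t" "r 3 ^ n = B * Z t"
      unfolding r12 X_def Y_def Z_def B(3,4) by (simp_all add: algebra_simps)
    moreover have "u = root n B * root n v" if "u ^ n = B * v" for u v
      using odd_real_root_power_cancel[OF odd, of u] that by (simp add: real_root_mult)
    ultimately have "r 1 = root n B * root n (X t)" "r 2 = root n B * root n (Y t)" "r 3 = root n B * root n (Z t)"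
      by simp_all
    then have "\<forall>i. (\<chi> i. \<beta> i * complex_of_real (r i)) $ i = of_real (root n B) * w t $ i"
      by (simp add: w_def forall_3 mult_ac)
    moreover have "(\<chi> i. \<beta> i * complex_of_real (r i)) \<noteq> 0" using r(2) b0 by (simp add: vec_eq_iff)
    ultimately have "p = proj (w t)"
      unfolding r(1) using nz B(1) n0 by (subst proj_eq_iff) (auto intro!: exI[of _ "of_real (root n B)"])
    then show "p \<in> (\<lambda>t. proj (w t)) ` {0..1}" using B(2) by blast
  qed
  have "S = (\<lambda>t. proj (w t)) ` {0..1}"
    by (rule components_image_Icc[OF continuous_on_proj[OF cont nz] S[unfolded img]])
  then show ?thesis using pat by (simp only:)
qed

lemma signs_not_all_equal:
  fixes e :: "3 \<Rightarrow> complex"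
  assumes "\<And>i. e i = 1 \<or> e i = -1" "\<not> (e 1 = e 2 \<and> e 2 = e 3)"
  obtains i j k where "distinct [i, j, k]" "e i = e j" "e k = - e i"
proof (cases "e 1 = e 2")
  case True
  then have "e 3 = - e 1" using assms(1)[of 1] assms(1)[of 3] assms(2) by auto
  then show ?thesis using that[of 1 2 3] True by simp
next
  case False
  show ?thesis
  proof (cases "e 1 = e 3")
    case True
    then show ?thesis using that[of 1 3 2] False assms(1)[of 1] assms(1)[of 2] by auto
  next
    case False
    then show ?thesis using that[of 2 3 1] \<open>e 1 \<noteq> e 2\<close> assms(1)[of 1] assms(1)[of 2] assms(1)[of 3] by auto
  qed
qed

lemma mirror_pattern_diag_even:
  assumes n: "n \<ge> 2" and even: "even n" and d: "\<And>i. d i ^ n = 1"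
    and f: "\<And>v. v \<noteq> 0 \<Longrightarrow> f (proj v) = proj (\<chi> i. d i * cnj (v $ i))"
    and S: "S \<in> components {p \<in> fermat_curve n. f p = p}"
  shows "has_pattern n S [0, 1] 4"
proof -
  have n0: "n > 0" using n by simp
  define \<beta> where "\<beta> i = csqrt (d i)" for i
  have b2: "\<beta> i * \<beta> i = d i" for i using power2_csqrt[of "d i"] by (simp add: \<beta>_def power2_eq_square)
  have bn: "\<beta> i ^ n = 1 \<or> \<beta> i ^ n = -1" for i
  proof -
    have "(\<beta> i ^ n)\<^sup>2 = d i ^ n" by (simp add: power2_eq_square power_mult_distrib flip: b2)
    then show ?thesis by (simp add: d power2_eq_1_iff)
  qed
  have nb: "cmod (\<beta> i) = 1" for i
    using norm_root_of_unity[OF n0 d[of i]] by (simp add: \<beta>_def norm_csqrt)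
  have b0: "\<beta> i \<noteq> 0" for i using nb[of i] by auto
  have fixed: "{p \<in> fermat_curve n. f p = p} =
    {proj (\<chi> i. \<beta> i * of_real (r i)) | r. (\<exists>i. r i \<noteq> 0) \<and> (\<Sum>i\<in>UNIV. \<beta> i ^ n * of_real (r i ^ n)) = 0}"
    by (rule diag_fixed_points[OF n0 d b2]) (rule f)
  have "S \<noteq> {}" "S \<subseteq> {p \<in> fermat_curve n. f p = p}"
    using S by (auto dest: in_components_subset in_components_nonempty)
  then obtain p0 where "p0 \<in> {p \<in> fermat_curve n. f p = p}" by blast
  then obtain r0 where r0: "\<exists>i. r0 i \<noteq> 0" "(\<Sum>i\<in>UNIV. \<beta> i ^ n * complex_of_real (r0 i ^ n)) = 0"
    unfolding fixed by blast
  \<comment> \<open>For even n three equal signs would give a definite form without nonzero real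
    solutions, but \<open>S\<close> contains a point. So exactly one sign differs, and it singles
    out the index \<open>k\<close>.\<close>
  have "\<not> (\<beta> 1 ^ n = \<beta> 2 ^ n \<and> \<beta> 2 ^ n = \<beta> 3 ^ n)"
  proof
    assume eq: "\<beta> 1 ^ n = \<beta> 2 ^ n \<and> \<beta> 2 ^ n = \<beta> 3 ^ n"
    have "\<beta> 3 ^ n * complex_of_real (r0 1 ^ n + r0 2 ^ n + r0 3 ^ n) = 0"
      using r0(2) eq by (simp add: sum_3 distrib_left)
    then have "complex_of_real (r0 1 ^ n + r0 2 ^ n + r0 3 ^ n) = 0" using b0[of 3] by simp
    then have "r0 1 ^ n + r0 2 ^ n + r0 3 ^ n = 0" by (simp only: of_real_eq_0_iff)
    then have "r0 1 ^ n = 0 \<and> r0 2 ^ n = 0 \<and> r0 3 ^ n = 0"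
      using zero_le_even_power[OF even, of "r0 1"] zero_le_even_power[OF even, of "r0 2"]
        zero_le_even_power[OF even, of "r0 3"] by linarith
    then have "\<forall>i. r0 i = 0" by (simp add: forall_3)
    then show False using r0(1) by blast
  qed
  then obtain i j k where ijk: "distinct [i, j, k]" and eps: "\<beta> i ^ n = \<beta> j ^ n" "\<beta> k ^ n = - (\<beta> i ^ n)"
    using signs_not_all_equal[of "\<lambda>i. \<beta> i ^ n"] bn by metis
  have rel: "(\<Sum>m\<in>UNIV. \<beta> m ^ n * complex_of_real (r m ^ n)) = 0 \<longleftrightarrow> r i ^ n + r j ^ n = r k ^ n" for r
  proof -
    have "(\<Sum>m\<in>UNIV. \<beta> m ^ n * complex_of_real (r m ^ n)) = \<beta> i ^ n * complex_of_real (r i ^ n + r j ^ n - r k ^ n)"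
      by (simp add: sum_distinct3[OF ijk] eps algebra_simps)
    moreover have "complex_of_real (r i ^ n + r j ^ n - r k ^ n) = 0 \<longleftrightarrow> r i ^ n + r j ^ n - r k ^ n = 0"
      by (rule of_real_eq_0_iff)
    ultimately show ?thesis using b0[of i] by auto
  qed
  \<comment> \<open>The n-th power of \<open>X\<close> is to be the squared cosine while
    \<open>X\<close> keeps the sign of the cosine; the signed square u |u| achieves this and remains
    invertible. The curve x^n + y^n = 1 is then traversed once like a circle.\<close>
  define X where "X t = root n (cos (2 * pi * t) * \<bar>cos (2 * pi * t)\<bar>)" for t :: real
  define Y where "Y t = root n (sin (2 * pi * t) * \<bar>sin (2 * pi * t)\<bar>)" for t :: real
  have absroot: "\<bar>root n (u * \<bar>u\<bar>)\<bar> ^ n = u\<^sup>2" for u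
    using n0 by (simp add: abs_mult power2_eq_square flip: real_root_abs)
  have Xn: "X t ^ n = (cos (2 * pi * t))\<^sup>2" and Yn: "Y t ^ n = (sin (2 * pi * t))\<^sup>2" for t
    unfolding X_def Y_def using absroot[unfolded power_even_abs[OF even]] by blast+
  define w where "w t = tvec i j (\<beta> i * of_real (X t)) (\<beta> j * of_real (Y t)) (\<beta> k)" for t
  have wr: "w t = (\<chi> m. \<beta> m * of_real (tri i j (X t) (Y t) 1 m))" for t
    using ijk by (simp add: w_def vec_eq_iff all_distinct3[OF ijk])
  have nz: "w t \<noteq> 0" for t using b0 by (simp add: w_def tvec_eq_0_iff[OF ijk])
  have cont: "continuous_on A w" for A
    unfolding w_def X_def Y_def by (intro continuous_on_tvec continuous_intros)
  have wF: "proj (w t) \<in> {p \<in> fermat_curve n. f p = p}" for t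
  proof -
    let ?r = "tri i j (X t) (Y t) 1"
    have "?r k \<noteq> 0" "?r i ^ n + ?r j ^ n = ?r k ^ n" using ijk by (simp_all add: Xn Yn)
    then show ?thesis unfolding fixed wr using rel[of ?r] by blast
  qed
  have nt: "norm_type n (w t) = (if (cos (2 * pi * t))\<^sup>2 = 0 \<or> (sin (2 * pi * t))\<^sup>2 = 0 then 0
      else if (cos (2 * pi * t))\<^sup>2 = (sin (2 * pi * t))\<^sup>2 then 1 else 3)" for t
  proof -
    let ?C = "(cos (2 * pi * t))\<^sup>2" and ?S = "(sin (2 * pi * t))\<^sup>2"
    have A: "?C = cmod (\<beta> i * of_real (X t)) ^ n" "?S = cmod (\<beta> j * of_real (Y t)) ^ n" "1 = cmod (\<beta> k) ^ n"
      using nb absroot by (simp_all add: norm_mult X_def Y_def)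
    have cs: "?S + ?C = 1" by simp
    have e: "?C = ?S \<and> 1 = 2 * ?C \<longleftrightarrow> ?C = ?S" using cs by linarith
    have e': "\<not> (?S = 1 \<and> ?C = 2 * ?S)" "\<not> (?C = 1 \<and> ?S = 2 * ?C)" "\<not> (?C = ?S \<and> ?S = 1)"
      using cs by linarith+
    show ?thesis
      unfolding w_def norm_type_tvec[OF ijk n0 A] by (simp only: e e' simp_thms one_neq_zero if_False)
  qed
  have len2: "length [0, 1 :: nat] = 2" by simp
  have pat: "has_pattern n ((\<lambda>t. proj (w t)) ` {0..1}) [0, 1] 4"
  proof (rule has_pattern_curve[where w = w and \<tau> = "\<lambda>m. real m / 8"])
    show "proj (w 1) = proj (w 0)" by (simp add: w_def X_def Y_def)
    show "s = t \<or> s = 0 \<and> t = 1 \<or> s = 1 \<and> t = 0"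
      if st: "s \<in> {0..1}" "t \<in> {0..1}" and "c \<noteq> 0" and c: "\<And>i. w s $ i = c * w t $ i" for s t c
    proof -
      have "c = 1" using c[of k] ijk b0 by (simp add: w_def)
      then have XY: "X s = X t" "Y s = Y t" using c[of i] c[of j] ijk b0 by (simp_all add: w_def)
      have root2: "root 2 (u * \<bar>u\<bar>) = u" for u :: real
      proof -
        have "u * \<bar>u\<bar> = sgn u * \<bar>u\<bar>\<^sup>2" by (cases "u \<ge> 0") (auto simp: sgn_if power2_eq_square)
        then show ?thesis using root_sgn_power[of 2 u] by simp
      qed
      have "cos (2 * pi * s) * \<bar>cos (2 * pi * s)\<bar> = cos (2 * pi * t) * \<bar>cos (2 * pi * t)\<bar>"
        "sin (2 * pi * s) * \<bar>sin (2 * pi * s)\<bar> = sin (2 * pi * t) * \<bar>sin (2 * pi * t)\<bar>"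
        using XY n0 by (simp_all add: X_def Y_def)
      then have "cos (2 * pi * s) = cos (2 * pi * t)" "sin (2 * pi * s) = sin (2 * pi * t)"
        by (metis root2)+
      then have "cis (2 * pi * s) = cis (2 * pi * t)" by (simp add: complex_eq_iff)
      then show ?thesis using cis_2pi_eq_iff st by blast
    qed
    show "strict_mono (\<lambda>m. real m / 8)" by (simp add: strict_mono_def divide_strict_right_mono)
    show "real m / 8 \<in> {0..<1}" if "m < 4 * length [0, 1 :: nat]" for m using that by simp
    \<comment> \<open>Vertices are the zeros of the sine of the doubled angle and edge-centres those
      of its cosine, which places the two types at the even and the odd multiples of 1/8.\<close>
    have s2: "sin (2 * (2 * pi * t)) = 2 * sin (2 * pi * t) * cos (2 * pi * t)"
      "cos (2 * (2 * pi * t)) = (cos (2 * pi * t))\<^sup>2 - (sin (2 * pi * t))\<^sup>2" for t :: real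
      by (rule sin_double, rule cos_double)
    show "norm_type n (w (real m / 8)) = [0, 1] ! (m mod length [0, 1 :: nat])" for m
    proof (cases "even m")
      case True
      then obtain q where q: "m = 2 * q" by (auto elim: evenE)
      have "2 * (2 * pi * (real m / 8)) = real q * pi" by (simp add: q)
      then have "sin (2 * (2 * pi * (real m / 8))) = 0" by simp
      then have "(cos (2 * pi * (real m / 8)))\<^sup>2 = 0 \<or> (sin (2 * pi * (real m / 8)))\<^sup>2 = 0"
        unfolding s2 by auto
      then show ?thesis using True unfolding nt len2 by simp
    next
      case False
      then obtain q where q: "m = 2 * q + 1" by (auto elim: oddE)
      have e: "2 * (2 * pi * (real m / 8)) = real q * pi + pi / 2" by (simp add: q field_simps)
      have "cos (2 * (2 * pi * (real m / 8))) = 0" unfolding e cos_add by simp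
      then have eq: "(cos (2 * pi * (real m / 8)))\<^sup>2 = (sin (2 * pi * (real m / 8)))\<^sup>2"
        unfolding s2 by simp
      moreover have "(sin (2 * pi * (real m / 8)))\<^sup>2 \<noteq> 0"
        using eq sin_cos_squared_add[of "2 * pi * (real m / 8)"] by linarith
      moreover have "m mod 2 = 1" using False by (simp add: odd_iff_mod_2_eq_one)
      ultimately show ?thesis unfolding nt len2 by simp
    qed
    show "\<exists>m<4 * length [0, 1 :: nat]. t = real m / 8"
      if t: "t \<in> {0..<1}" and nt3: "norm_type n (w t) \<noteq> 3" for t
    proof -
      have "sin (2 * pi * t) = 0 \<or> cos (2 * pi * t) = 0 \<or> (cos (2 * pi * t))\<^sup>2 = (sin (2 * pi * t))\<^sup>2"
        using nt3 unfolding nt by (auto split: if_splits)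
      then have "sin (2 * (2 * pi * t)) = 0 \<or> cos (2 * (2 * pi * t)) = 0" unfolding s2 by auto
      \<comment> \<open>Doubling once more collects both types into the zeros of a single sine, so 8
        t is an integer.\<close>
      then have "sin (2 * (2 * (2 * pi * t))) = 0" unfolding sin_double by auto
      then obtain l :: int where "2 * (2 * (2 * pi * t)) = of_int l * pi" by (auto simp: sin_zero_iff_int2)
      then have l: "8 * t = of_int l" by simp
      have "0 \<le> real_of_int l" "real_of_int l < 8" unfolding l[symmetric] using t by auto
      then have "0 \<le> l" "l < 8" by linarith+
      then show ?thesis using l by (intro exI[of _ "nat l"]) auto
    qed
  qed (use n nz wF cont in auto)
  have img: "{p \<in> fermat_curve n. f p = p} = (\<lambda>t. proj (w t)) ` {0..1}"
  proof (intro equalityI subsetI)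
    fix p assume "p \<in> (\<lambda>t. proj (w t)) ` {0..1}"
    then obtain t where "p = proj (w t)" by blast
    then show "p \<in> {p \<in> fermat_curve n. f p = p}" using wF[of t] by simp
  next
    fix p assume "p \<in> {p \<in> fermat_curve n. f p = p}"
    then obtain r where r: "p = proj (\<chi> m. \<beta> m * of_real (r m))" "\<exists>m. r m \<noteq> 0"
        "(\<Sum>m\<in>UNIV. \<beta> m ^ n * complex_of_real (r m ^ n)) = 0"
      unfolding fixed by blast
    have sum: "r i ^ n + r j ^ n = r k ^ n" using r(3) rel by blast
    have rk: "r k \<noteq> 0"
    proof
      assume "r k = 0"
      then have "r k ^ n = 0" using n0 by (simp add: zero_power)
      then have "r i ^ n = 0 \<and> r j ^ n = 0"
        using sum zero_le_even_power[OF even, of "r i"] zero_le_even_power[OF even, of "r j"]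
        by linarith
      then have "\<forall>m. r m = 0" using \<open>r k = 0\<close> unfolding all_distinct3[OF ijk] by simp
      then show False using r(2) by blast
    qed
    define x y where "x = r i / r k" and "y = r j / r k"
    have xy: "x ^ n + y ^ n = 1" using sum rk by (simp add: x_def y_def power_divide flip: add_divide_distrib)
    \<comment> \<open>The inverse of u -> \<open>root n (u * \<bar>u\<bar>)\<close>: it turns a
      point of x^n + y^n = 1 into a point of the unit circle, from which the parameter is
      read.\<close>
    define \<sigma> where "\<sigma> u = sgn u * sqrt (\<bar>u\<bar> ^ n)" for u :: real
    have sig2: "(\<sigma> u)\<^sup>2 = u ^ n" for u
      using n0 even by (cases "u = 0") (auto simp: \<sigma>_def power_mult_distrib power_even_abs zero_power sgn_if)
    have sigroot: "root n (\<sigma> u * \<bar>\<sigma> u\<bar>) = u" for u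
    proof -
      have "\<sigma> u * \<bar>\<sigma> u\<bar> = sgn u * \<bar>u\<bar> ^ n"
      proof -
        have "\<sigma> u * \<bar>\<sigma> u\<bar> = (sgn u * \<bar>sgn u\<bar>) * (sqrt (\<bar>u\<bar> ^ n) * sqrt (\<bar>u\<bar> ^ n))"
          by (simp only: \<sigma>_def abs_mult real_sqrt_abs abs_of_nonneg[OF real_sqrt_ge_zero] zero_le_power abs_ge_zero mult_ac)
        also have "sqrt (\<bar>u\<bar> ^ n) * sqrt (\<bar>u\<bar> ^ n) = \<bar>u\<bar> ^ n" by (rule real_sqrt_mult_self[THEN trans]) simp
        also have "sgn u * \<bar>sgn u\<bar> = sgn u" by (simp add: sgn_if)
        finally show ?thesis .
      qed
      then show ?thesis using root_sgn_power[OF n0] by simp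
    qed
    have "(\<sigma> x)\<^sup>2 + (\<sigma> y)\<^sup>2 = 1" using xy by (simp add: sig2)
    then obtain \<theta> where th: "0 \<le> \<theta>" "\<theta> < 2 * pi" "\<sigma> x = cos \<theta>" "\<sigma> y = sin \<theta>"
      using sincos_total_2pi by blast
    define t where "t = \<theta> / (2 * pi)"
    have t: "t \<in> {0..1}" and tt: "2 * pi * t = \<theta>" using th by (auto simp: t_def)
    have "X t = x" "Y t = y" unfolding X_def Y_def tt th(3,4)[symmetric] by (rule sigroot)+
    then have "\<forall>m. (\<chi> m. \<beta> m * complex_of_real (r m)) $ m = of_real (r k) * w t $ m"
      unfolding all_distinct3[OF ijk] using ijk rk by (simp add: w_def x_def y_def)
    moreover have "(\<chi> m. \<beta> m * complex_of_real (r m)) \<noteq> 0" using r(2) b0 by (simp add: vec_eq_iff)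
    ultimately have "p = proj (w t)"
      unfolding r(1) using nz rk by (subst proj_eq_iff) (auto intro!: exI[of _ "of_real (r k)"])
    then show "p \<in> (\<lambda>t. proj (w t)) ` {0..1}" using t by blast
  qed
  have "S = (\<lambda>t. proj (w t)) ` {0..1}"
    by (rule components_image_Icc[OF continuous_on_proj[OF cont nz] S[unfolded img]])
  then show ?thesis using pat by (simp only:)
qed

theorem theorem6p4:
  fixes n :: nat
  assumes "n \<ge> 2"
  shows "(odd n \<longrightarrow>
            (\<forall>S\<in>mirrors n. has_pattern n S [0, 1] 3 \<or> has_pattern n S [0, 2, 1, 2] n)) \<and>
         (even n \<longrightarrow>
            (\<forall>S\<in>mirrors n. has_pattern n S [0, 1] 4 \<or> has_pattern n S [0, 2, 1, 2] 2))"
proof -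
  have pattern: "(odd n \<longrightarrow> has_pattern n S [0, 1] 3 \<or> has_pattern n S [0, 2, 1, 2] n) \<and>
      (even n \<longrightarrow> has_pattern n S [0, 1] 4 \<or> has_pattern n S [0, 2, 1, 2] 2)"
    if mirror: "S \<in> mirrors n" for S
  proof -
    obtain f where f: "map_reflection n f" and S: "S \<in> components {p \<in> fermat_curve n. f p = p}"
      using mirror unfolding mirrors_def by blast
    show ?thesis
      using assms f
    proof (cases rule: reflection_cases)
      case (diag d)
      show ?thesis
        using mirror_pattern_diag_odd[OF assms _ diag S] mirror_pattern_diag_even[OF assms _ diag S] by simp
    next
      case (swap i j k a)
      show ?thesis
        using mirror_pattern_swap_odd[OF assms _ swap S] mirror_pattern_swap_even[OF assms _ swap S] by simp
    qed
  qed
  then show ?thesis by blast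
qed

end
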